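(* Let $\Theta$ be a compatible collection of irreducible Pisot substitutions on $\mathcal A=\{1,\dots,d\}$, with enveloping random substitution $\vartheta$. Let $\mathbf p=(p_\theta)_{\theta\in\Theta}$ be a probability vector, let $\nu=\bigotimes_{i=1}^\infty\mathbf p$ be the corresponding Bernoulli measure on $\Theta^{\mathbb N}$, and let $\mathbf P$ be the data derived from $\mathbf p$, assumed non-degenerate. Let $\overline\mu=(\overline\mu_a)_{a\in\mathcal A}$ be the vector of Rauzy measures associated with $(\vartheta,\mathbf P)$. Then, for all $a\in\mathcal A$, $$\mathbb E_\nu[\mu_{\boldsymbol\theta,a}]=\overline\mu_a,\qquad\text{where }\ \mathbb E_\nu[\mu_{\boldsymbol\theta,a}]=\int_{\Theta^{\mathbb N}}\mu_{\boldsymbol\theta,a}\,d\nu(\boldsymbol\theta).$$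
   Context: Let $\mathcal A^+$ be the set of non-empty finite words over $\mathcal A$, $|u|$ the length of $u$, $|u|_i$ the number of occurrences of $i$ in $u$, $\psi(u)=(|u|_1,\dots,|u|_d)^T$, and $u_{[1,m]}=u_1\cdots u_m$ (empty if $m=0$; also for infinite sequences). A (deterministic) substitution is a map $\theta\colon\mathcal A\to\mathcal A^+$, extended to words by concatenation; its matrix is $M_{i,j}=|\theta(j)|_i$. A non-empty set $\Theta$ of substitutions is compatible if all have the same matrix $M$ (so $\Theta$ is finite). Throughout, $M$ is primitive; the elements of $\Theta$ are irreducible Pisot if the Perron–Frobenius eigenvalue $\lambda$ of $M$ is a Pisot number and the characteristic polynomial of $M$ is irreducible over $\mathbb Z$. $\mathbf L,\mathbf R$ are left and right Perron–Frobenius eigenvectors of $M$ with $\|\mathbf R\|_1=1=\mathbf L^T\mathbf R$; $\mathbb H\subset\mathbb R^d$ is the hyperplane orthogonal to $\mathbf L$; $\pi$ is the linear projection along $\mathbf R$ onto $\mathbb H$. For a finite word $w$ and $a\in\mathcal A$, $\mu_a(w)=\sum_{0\le m\le|w|-1,\ w_{m+1}=a}\delta_{\pi(\psi(w_{[1,m]}))}$; for an infinite sequence $u$, $\mu_a(u)=\lim_{n\to\infty}\frac1n\mu_a(u_{[1,n]})$ (weak limit) when it exists. S-adic Rauzy measures: for $\boldsymbol\theta=(\theta_n)_{n\in\mathbb N}\in\Theta^{\mathbb N}$, a letter sequence $\mathbf a=(a_n)_{n\in\mathbb N}$ is adapted to $\boldsymbol\theta$ if $\theta_n(a_n)$ starts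 with $a_{n-1}$ for all $n\ge2$. Then $u(\boldsymbol\theta,\mathbf a)\in\mathcal A^{\mathbb N}$ is the unique sequence having $\theta_1\circ\cdots\circ\theta_n(a_n)$ as a prefix for all $n$. Put $\mu_{\boldsymbol\theta,a}=\mu_a(u(\boldsymbol\theta,\mathbf a))$; this limit exists, does not depend on the adapted sequence $\mathbf a$, and depends weakly continuously on $\boldsymbol\theta\in\Theta^{\mathbb N}$ (product topology), so the integral above is well defined by integrating against bounded continuous functions. The enveloping random substitution of $\Theta$ is the set-valued map $\vartheta(a)=\{\theta(a):\theta\in\Theta\}$. The data $\mathbf P$ derived from $\mathbf p$ is given by $\mathbb P[\vartheta_{\mathbf P}(a)=u]=\sum_{\theta\in\Theta:\,\theta(a)=u}p_\theta$ for $a\in\mathcal A$, $u\in\vartheta(a)$; non-degenerate means that all these numbers are positive. For a word $u=u_1\cdots u_n$, $\vartheta_{\mathbf P}(u)$ is the random word obtained by independently replacing each letter $u_k$ by a realisation $v\in\vartheta(u_k)$ with probability $\mathbb P[\vartheta_{\mathbf P}(u_k)=v]$ and concatenating in order; $(\vartheta_{\mathbf P}^n(u))_{n\ge0}$ is the Markov chain started at $u$ with these transition probabilities, with expectation $\mathbb E$; all realisations of $\vartheta_{\mathbf P}^n(u)$ have a common length $|\vartheta^n(u)|$. The Rauzy measure $\overline\mu_a$ of $(\vartheta,\mathbf P)$ is the weak limit $\lim_{n\to\infty}|\vartheta^n(v)|^{-1}\mathbb E[\mu_a(\vartheta_{\mathbf P}^n(v))]$, which exists and is the same for every $v\in\mathcal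 A^+$. *)

theory Defs
  imports "HOL-Probability.Probability" "HOL-Computational_Algebra.Computational_Algebra"
begin

text \<open>
  The alphabet \<open>{1,\<dots>,d}\<close> is a finite type \<open>'a\<close>, so that \<open>d\<close> is \<open>CARD('a)\<close> and the ambient space
  is \<open>real ^ 'a\<close>.  Sequences are indexed from \<open>0\<close>: the value at \<open>n\<close> is the mathematical
  \<open>(n + 1)\<close>-st term.
\<close>

type_synonym 'a subst = "'a \<Rightarrow> 'a list"

section \<open>Compatible irreducible Pisot substitutions\<close>

definition subst_word :: "'a subst \<Rightarrow> 'a list \<Rightarrow> 'a list" where
  "subst_word \<theta> w = concat (map \<theta> w)"

definition subst_matrix :: "('a::finite) subst \<Rightarrow> int ^ 'a ^ 'a" where
  "subst_matrix \<theta> = (\<chi> i j. int (count_list (\<theta> j) i))"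

definition compatible :: "('a::finite) subst set \<Rightarrow> int ^ 'a ^ 'a \<Rightarrow> bool" where
  "compatible \<Theta> M \<longleftrightarrow> \<Theta> \<noteq> {} \<and> (\<forall>\<theta>\<in>\<Theta>. (\<forall>a. \<theta> a \<noteq> []) \<and> subst_matrix \<theta> = M)"

definition primitive_matrix :: "int ^ ('a::finite) ^ 'a \<Rightarrow> bool" where
  "primitive_matrix M \<longleftrightarrow> (\<exists>k\<ge>1. \<forall>i j. 0 < (((**) M ^^ k) (mat 1)) $ i $ j)"

definition of_int_matrix :: "int ^ 'n ^ 'm \<Rightarrow> ('b::ring_1) ^ 'n ^ 'm" where
  "of_int_matrix M = (\<chi> i j. of_int (M $ i $ j))"

definition charpoly :: "int ^ ('a::finite) ^ 'a \<Rightarrow> int poly" where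
  "charpoly M = det (\<chi> i j. (if i = j then [:0, 1:] else 0) - [:M $ i $ j:])"

definition eigenvalue :: "int ^ ('a::finite) ^ 'a \<Rightarrow> complex \<Rightarrow> bool" where
  "eigenvalue M z \<longleftrightarrow> (\<exists>v. v \<noteq> 0 \<and> of_int_matrix M *v v = z *s v)"

definition perron_frobenius_eigenvalue :: "int ^ ('a::finite) ^ 'a \<Rightarrow> real \<Rightarrow> bool" where
  "perron_frobenius_eigenvalue M l \<longleftrightarrow>
     eigenvalue M (of_real l) \<and> (\<forall>z. eigenvalue M z \<and> z \<noteq> of_real l \<longrightarrow> cmod z < l)"

text \<open>The polynomial \<open>q\<close> below, being monic and irreducible, is the minimal polynomial of \<open>x\<close>;
  its other complex roots are the Galois conjugates.\<close>

definition pisot_number :: "real \<Rightarrow> bool" where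
  "pisot_number x \<longleftrightarrow> 1 < x \<and>
     (\<exists>q :: int poly. lead_coeff q = 1 \<and> irreducible q \<and> poly (map_poly of_int q) x = 0 \<and>
        (\<forall>z :: complex. poly (map_poly of_int q) z = 0 \<and> z \<noteq> of_real x \<longrightarrow> cmod z < 1))"

definition irreducible_pisot :: "int ^ ('a::finite) ^ 'a \<Rightarrow> real \<Rightarrow> bool" where
  "irreducible_pisot M l \<longleftrightarrow>
     perron_frobenius_eigenvalue M l \<and> pisot_number l \<and> irreducible (charpoly M)"

definition perron_frobenius_vectors ::
  "int ^ ('a::finite) ^ 'a \<Rightarrow> real \<Rightarrow> real ^ 'a \<Rightarrow> real ^ 'a \<Rightarrow> bool" where
  "perron_frobenius_vectors M l L R \<longleftrightarrow>
     of_int_matrix M *v R = l *\<^sub>R R \<and> L v* of_int_matrix M = l *\<^sub>R L \<and>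
     (\<forall>i. 0 < R $ i) \<and> (\<forall>i. 0 < L $ i) \<and>
     (\<Sum>i\<in>UNIV. \<bar>R $ i\<bar>) = 1 \<and> L \<bullet> R = 1"

section \<open>Measures attached to words\<close>

definition abelianisation :: "('a::finite) list \<Rightarrow> real ^ 'a" where
  "abelianisation w = (\<chi> i. real (count_list w i))"

text \<open>Since \<open>L \<bullet> R = 1\<close>, this is the projection along \<open>R\<close> onto the hyperplane orthogonal to \<open>L\<close>.\<close>

definition rauzy_proj :: "real ^ 'a \<Rightarrow> real ^ 'a \<Rightarrow> real ^ 'a \<Rightarrow> real ^ ('a::finite)" where
  "rauzy_proj L R x = x - (L \<bullet> x) *\<^sub>R R"

text \<open>The sum of the Dirac measures at \<open>rauzy_proj L R (abelianisation (take m w))\<close>, over the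
  positions \<open>m\<close> at which \<open>w\<close> has the letter \<open>a\<close>, is the image of the counting measure on these
  positions.  It is regarded as a Borel measure on the whole space, carried by the hyperplane.\<close>

definition word_measure ::
  "real ^ 'a \<Rightarrow> real ^ 'a \<Rightarrow> 'a \<Rightarrow> 'a list \<Rightarrow> (real ^ ('a::finite)) measure" where
  "word_measure L R a w =
     distr (count_space {m. m < length w \<and> w ! m = a}) borel
       (\<lambda>m. rauzy_proj L R (abelianisation (take m w)))"

definition weakly_converges :: "(nat \<Rightarrow> 'b measure) \<Rightarrow> ('b::topological_space) measure \<Rightarrow> bool" where
  "weakly_converges \<mu> m \<longleftrightarrow>
     sets m = sets borel \<and> finite_measure m \<and>
     (\<forall>f :: 'b \<Rightarrow> real. continuous_on UNIV f \<and> bounded (range f) \<longrightarrow>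
        (\<lambda>n. integral\<^sup>L (\<mu> n) f) \<longlonglongrightarrow> integral\<^sup>L m f)"

section \<open>S-adic Rauzy measures\<close>

definition adapted :: "(nat \<Rightarrow> 'a subst) \<Rightarrow> (nat \<Rightarrow> 'a) \<Rightarrow> bool" where
  "adapted \<theta> b \<longleftrightarrow> (\<forall>n. hd (\<theta> (Suc n) (b (Suc n))) = b n)"

text \<open>\<open>sadic_image \<theta> n\<close> applies the first \<open>n\<close> substitutions, that is,
  \<open>\<theta> 0 \<circ> \<dots> \<circ> \<theta> (n - 1)\<close>.\<close>

primrec sadic_image :: "(nat \<Rightarrow> 'a subst) \<Rightarrow> nat \<Rightarrow> 'a list \<Rightarrow> 'a list" where
  "sadic_image \<theta> 0 w = w"
| "sadic_image \<theta> (Suc n) w = sadic_image \<theta> n (subst_word (\<theta> n) w)"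

definition sadic_word :: "(nat \<Rightarrow> 'a subst) \<Rightarrow> (nat \<Rightarrow> 'a) \<Rightarrow> nat \<Rightarrow> 'a" where
  "sadic_word \<theta> b =
     (THE u. \<forall>n. let w = sadic_image \<theta> (Suc n) [b n] in map u [0..<length w] = w)"

definition sadic_rauzy_measure ::
  "real ^ 'a \<Rightarrow> real ^ 'a \<Rightarrow> (nat \<Rightarrow> 'a subst) \<Rightarrow> 'a \<Rightarrow> (real ^ ('a::finite)) measure" where
  "sadic_rauzy_measure L R \<theta> a =
     (THE m. \<forall>b. adapted \<theta> b \<longrightarrow>
        weakly_converges
          (\<lambda>n. scale_measure (ennreal (1 / real n))
                 (word_measure L R a (map (sadic_word \<theta> b) [0..<n]))) m)"

section \<open>Random substitutions and their Rauzy measures\<close>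

definition enveloping :: "'a subst set \<Rightarrow> 'a \<Rightarrow> 'a list set" where
  "enveloping \<Theta> a = (\<lambda>\<theta>. \<theta> a) ` \<Theta>"

text \<open>Data for a random substitution \<open>\<phi>\<close>: for each letter \<open>a\<close>, the distribution \<open>P a\<close> of the
  random word replacing \<open>a\<close>.\<close>

definition derived_data ::
  "'a subst set \<Rightarrow> ('a subst \<Rightarrow> real) \<Rightarrow> ('a \<Rightarrow> 'a list pmf) \<Rightarrow> bool" where
  "derived_data \<Theta> p P \<longleftrightarrow> (\<forall>a u. pmf (P a) u = (\<Sum>\<theta> | \<theta> \<in> \<Theta> \<and> \<theta> a = u. p \<theta>))"

definition non_degenerate :: "('a \<Rightarrow> 'a list set) \<Rightarrow> ('a \<Rightarrow> 'a list pmf) \<Rightarrow> bool" where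
  "non_degenerate \<phi> P \<longleftrightarrow> (\<forall>a. \<forall>u\<in>\<phi> a. 0 < pmf (P a) u)"

primrec random_subst :: "('a \<Rightarrow> 'a list pmf) \<Rightarrow> 'a list \<Rightarrow> 'a list pmf" where
  "random_subst P [] = return_pmf []"
| "random_subst P (a # w) =
     bind_pmf (P a) (\<lambda>u. bind_pmf (random_subst P w) (\<lambda>v. return_pmf (u @ v)))"

primrec random_subst_iter :: "('a \<Rightarrow> 'a list pmf) \<Rightarrow> nat \<Rightarrow> 'a list \<Rightarrow> 'a list pmf" where
  "random_subst_iter P 0 w = return_pmf w"
| "random_subst_iter P (Suc n) w = bind_pmf (random_subst_iter P n w) (random_subst P)"

definition inflated_length :: "('a \<Rightarrow> 'a list pmf) \<Rightarrow> nat \<Rightarrow> 'a list \<Rightarrow> nat" where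
  "inflated_length P n w = (THE l. \<forall>u\<in>set_pmf (random_subst_iter P n w). length u = l)"

definition expected_word_measure ::
  "real ^ 'a \<Rightarrow> real ^ 'a \<Rightarrow> 'a \<Rightarrow> 'a list pmf \<Rightarrow> (real ^ ('a::finite)) measure" where
  "expected_word_measure L R a W =
     measure_of UNIV (sets borel) (\<lambda>B. \<integral>\<^sup>+w. emeasure (word_measure L R a w) B \<partial>measure_pmf W)"

definition rauzy_measure ::
  "real ^ 'a \<Rightarrow> real ^ 'a \<Rightarrow> ('a \<Rightarrow> 'a list pmf) \<Rightarrow> 'a \<Rightarrow> (real ^ ('a::finite)) measure" where
  "rauzy_measure L R P a =
     (THE m. \<forall>v. v \<noteq> [] \<longrightarrow>
        weakly_converges
          (\<lambda>n. scale_measure (ennreal (1 / real (inflated_length P n v)))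
                 (expected_word_measure L R a (random_subst_iter P n v))) m)"

section \<open>Expectation over the S-adic sequences\<close>

definition bernoulli_measure :: "'a subst set \<Rightarrow> ('a subst \<Rightarrow> real) \<Rightarrow> (nat \<Rightarrow> 'a subst) measure" where
  "bernoulli_measure \<Theta> p = PiM UNIV (\<lambda>_. point_measure \<Theta> (\<lambda>\<theta>. ennreal (p \<theta>)))"

text \<open>\<open>has_measure_expectation N \<kappa> m\<close>: the measure-valued function \<open>\<kappa>\<close> has a well-defined integral
  with respect to \<open>N\<close>, taken against bounded continuous functions, and this integral is \<open>m\<close>.  There
  is at most one such \<open>m\<close> when \<open>'b\<close> is a metric space.\<close>

definition has_measure_expectation ::
  "'c measure \<Rightarrow> ('c \<Rightarrow> 'b measure) \<Rightarrow> ('b::topological_space) measure \<Rightarrow> bool" where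
  "has_measure_expectation N \<kappa> m \<longleftrightarrow>
     sets m = sets borel \<and> finite_measure m \<and>
     (\<forall>f :: 'b \<Rightarrow> real. continuous_on UNIV f \<and> bounded (range f) \<longrightarrow>
        integrable N (\<lambda>x. integral\<^sup>L (\<kappa> x) f) \<and>
        (\<integral>x. integral\<^sup>L (\<kappa> x) f \<partial>N) = integral\<^sup>L m f)"

end

theory Submission
  imports Defs
begin

text \<open>All substitutions in \<open>\<Theta>\<close> have the same matrix, so the place to which a
  letter inside an image is displaced depends on the abelianisation of the letters before it, and
  not on which substitutions have been applied to them.  For a test function \<open>f\<close>, the sum of \<open>f\<close>
  over the points that a random image of a letter contributes is therefore a sum of translated
  sums for its constituents, and its expectation is computed level by level, one letter at a time.
  In the S-adic model one substitution is drawn per level and used at all positions, in the random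
  model the draws at different positions are independent; but the expectation of a sum does not
  see correlations between the summands.  So after \<open>n\<close> levels both models have exactly the same
  expected sum (\<open>bernoulli_expectation\<close>, \<open>patch_random_subst_iter\<close>).

  Both models are treated together: \<open>supertile q a n b f\<close> is the expected sum of \<open>f\<close> over the
  points of type \<open>a\<close> in the \<open>n\<close>-fold image of \<open>b\<close>, when the substitution of level \<open>k\<close> has
  distribution \<open>q k\<close>.  Point weights give the S-adic words, constant weights the random
  substitution.  Three facts about general \<open>q\<close> let \<open>n\<close> tend to infinity.

  \<^item> The matrix contracts the hyperplane orthogonal to \<open>L\<close> summably (\<open>hyperplane_orbit_summable\<close>).
    This is where irreducibility and the Pisot property enter: every eigenvalue other than \<open>lam\<close>
    is a Galois conjugate of \<open>lam\<close>, hence of modulus less than one.  Thus all projected points lie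
    in one ball, and the displacement caused by the levels above \<open>n\<close> is at most a constant
    times a tail of a convergent series.

  \<^item> A long word therefore consists of supertiles of a fixed level \<open>n\<close> that are hardly translated,
    and their types occur with frequencies \<open>R\<close> up to a bounded error.  Consequently the averages
    along long words converge to the limit of \<open>(\<Sum>b. R $ b * supertile q a n b f) / lam ^ n\<close>
    (\<open>average_tendsto\<close>).  For prefixes of S-adic words the supertiles come from the decomposition
    of Dumont and Thomas (\<open>sadic_prefix_decomposition\<close>), for the random substitution from
    \<open>patch_decomposition\<close>.

  \<^item> This limit is the integral of \<open>f\<close> against a measure (\<open>supertile_limit_measure\<close>).  Starting from
    the letter \<open>a\<close>, climb to a random occurrence of the current letter in the image of another
    letter \<open>b\<close>, with probabilities proportional to \<open>R $ b\<close>, and add up the displacements.  By the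
    eigenvector equation these are transition probabilities of a Markov chain, whose expectation of
    \<open>f\<close> at time \<open>n\<close>, times \<open>R $ a\<close>, is the weighted supertile sum above; by contraction the accumulated displacements converge, and \<open>R $ a\<close> times
    the law of their limit is the measure wanted.

  Since finite Borel measures on a metric space are determined by their integrals of bounded
  continuous functions, and since every sequence of substitutions has an adapted letter sequence,
  these measures are the S-adic Rauzy measures and the Rauzy measure of the random substitution.
  The theorem follows by dominated convergence.\<close>

section \<open>Contraction of the hyperplane by a Pisot matrix\<close>

text \<open>The polynomial \<open>p\<close> applied to the shift operator on sequences.\<close>

definition recurrence :: "complex poly \<Rightarrow> (nat \<Rightarrow> complex) \<Rightarrow> nat \<Rightarrow> complex" where
  "recurrence p s k = (\<Sum>i\<le>degree p. coeff p i * s (k + i))"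

lemma recurrence_altdef:
  assumes "degree p \<le> n"
  shows "recurrence p s k = (\<Sum>i\<le>n. coeff p i * s (k + i))"
  unfolding recurrence_def
  by (rule sum.mono_neutral_left) (use assms in \<open>auto simp: coeff_eq_0\<close>)

text \<open>Composition of polynomials in the shift operator, for a linear factor.  It lets a recurrence be
  solved one root at a time.\<close>

lemma recurrence_linear_factor:
  "recurrence ([:- z, 1:] * r) s k = recurrence r (\<lambda>j. s (Suc j) - z * s j) k"
proof -
  have e: "[:- z, 1:] * r = pCons 0 r - smult z r" by simp
  define n where "n = degree r"
  have "degree ([:- z, 1:] * r) \<le> Suc n"
    unfolding n_def by (rule order_trans[OF degree_mult_le]) simp
  then have "recurrence ([:- z, 1:] * r) s k = (\<Sum>i\<le>Suc n. coeff (pCons 0 r - smult z r) i * s (k + i))"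
    unfolding e[symmetric] by (rule recurrence_altdef)
  also have "\<dots> = (\<Sum>i\<le>Suc n. coeff (pCons 0 r) i * s (k + i)) - (\<Sum>i\<le>Suc n. z * coeff r i * s (k + i))"
    by (simp add: left_diff_distrib sum_subtractf del: sum.atMost_Suc)
  also have "(\<Sum>i\<le>Suc n. coeff (pCons 0 r) i * s (k + i)) = (\<Sum>i\<le>n. coeff r i * s (k + Suc i))"
    by (subst sum.atMost_Suc_shift) simp
  also have "(\<Sum>i\<le>Suc n. z * coeff r i * s (k + i)) = (\<Sum>i\<le>n. z * coeff r i * s (k + i))"
    by (simp add: n_def coeff_eq_0)
  finally show ?thesis
    by (simp add: recurrence_def n_def sum_subtractf[symmetric] algebra_simps)
qed

lemma summable_geometric_perturbation:
  fixes t y :: "nat \<Rightarrow> real"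
  assumes "\<And>k. 0 \<le> t k" and "\<And>k. t (Suc k) \<le> c * t k + y k" and "c < 1" and "0 \<le> c"
    and "\<And>k. 0 \<le> y k" and "summable y"
  shows "summable t"
proof (rule summableI_nonneg_bounded)
  fix n
  let ?S = "\<lambda>n. \<Sum>k<n. t k"
  have "?S (Suc n) = t 0 + (\<Sum>k<n. t (Suc k))" by (rule sum.lessThan_Suc_shift)
  also have "\<dots> \<le> t 0 + (\<Sum>k<n. c * t k + y k)" using assms(2) by (simp add: sum_mono)
  also have "\<dots> = t 0 + c * ?S n + (\<Sum>k<n. y k)" by (simp add: sum.distrib sum_distrib_left)
  also have "(\<Sum>k<n. y k) \<le> suminf y" using assms by (intro sum_le_suminf) auto
  finally have "?S (Suc n) \<le> t 0 + c * ?S n + suminf y" by simp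
  moreover have "?S n \<le> ?S (Suc n)" using assms(1) by simp
  ultimately have "(1 - c) * ?S n \<le> t 0 + suminf y" by (simp add: algebra_simps)
  then show "?S n \<le> (t 0 + suminf y) / (1 - c)" using assms(3) by (simp add: field_simps)
qed (use assms in auto)

text \<open>Splitting off a root \<open>z\<close> leaves a sequence \<open>y\<close> that satisfies a recurrence of smaller degree
  and is summable by induction; then \<open>s (Suc k) = z * s k + y k\<close> with \<open>cmod z < 1\<close>.  Repeated roots
  need no separate treatment.\<close>

lemma summable_recurrence:
  assumes "p \<noteq> 0" and "\<And>z. poly p z = 0 \<Longrightarrow> cmod z < 1" and "\<And>k. recurrence p s k = 0"
  shows "summable (\<lambda>k. cmod (s k))"
  using assms
proof (induction "degree p" arbitrary: p s)
  case 0
  then obtain c where c: "p = [:c:]" by (metis degree_eq_zeroE)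
  then have "s k = 0" for k using 0(2) 0(4)[of k] by (simp add: recurrence_def)
  then show ?case by simp
next
  case (Suc n)
  then have "\<not> constant (poly p)" by (simp add: constant_degree)
  then obtain z where z: "poly p z = 0" using fundamental_theorem_of_algebra by blast
  then obtain r where r: "p = [:- z, 1:] * r" by (auto simp: poly_eq_0_iff_dvd)
  have r0: "r \<noteq> 0" using Suc r by auto
  have "degree p = Suc (degree r)" unfolding r using r0 by (subst degree_mult_eq) auto
  then have "n = degree r" using Suc by simp
  moreover have "\<And>w. poly r w = 0 \<Longrightarrow> cmod w < 1" using Suc.prems(2) by (simp add: r)
  moreover have "recurrence r (\<lambda>j. s (Suc j) - z * s j) k = 0" for k
    using Suc.prems(3)[of k] unfolding r recurrence_linear_factor .
  ultimately have y: "summable (\<lambda>k. cmod (s (Suc k) - z * s k))"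
    using Suc.hyps(1) r0 by blast
  show ?case
  proof (rule summable_geometric_perturbation[OF _ _ _ _ _ y])
    show "cmod (s (Suc k)) \<le> cmod z * cmod (s k) + cmod (s (Suc k) - z * s k)" for k
      using norm_triangle_ineq[of "z * s k" "s (Suc k) - z * s k"] by (simp add: norm_mult)
    show "cmod z < 1" using Suc.prems(2) z by blast
  qed auto
qed

lemma poly_of_int_pCons:
  "poly (map_poly of_int (pCons a q)) x = of_int a + x * poly (map_poly of_int q) (x :: 'b::{comm_ring_1})"
  by (simp add: map_poly_pCons)

lemma poly_of_int_add:
  "poly (map_poly of_int (p + q)) x = poly (map_poly of_int p) x + poly (map_poly of_int q) (x :: 'b::{comm_ring_1})"
proof (induction p q rule: poly_induct2)
  case (pCons a p b q)
  then show ?case by (simp add: poly_of_int_pCons algebra_simps)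
qed simp

lemma poly_of_int_smult:
  "poly (map_poly of_int (smult c q)) x = of_int c * poly (map_poly of_int q) (x :: 'b::{comm_ring_1})"
  by (induction q) (auto simp: poly_of_int_pCons algebra_simps)

lemma poly_of_int_mult:
  "poly (map_poly of_int (p * q)) x = poly (map_poly of_int p) x * poly (map_poly of_int q) (x :: 'b::{comm_ring_1})"
  by (induction p) (auto simp: poly_of_int_pCons poly_of_int_add poly_of_int_smult algebra_simps)

lemma poly_of_int_1: "poly (map_poly of_int (1 :: int poly)) (x :: 'b::comm_ring_1) = 1"
  by (simp add: one_pCons poly_of_int_pCons)

lemma poly_of_int_of_real:
  "poly (map_poly of_int q) (of_real x :: complex) = of_real (poly (map_poly of_int q) x)"
  by (induction q) (auto simp: poly_of_int_pCons)

text \<open>By minimality, pseudo-division of \<open>q\<close> by \<open>g\<close> leaves no remainder.  So the prime element \<open>q\<close> divides \<open>g\<close>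
  or the quotient, and for reasons of degree it divides \<open>g\<close>.\<close>

lemma irreducible_root_associate:
  fixes q g :: "int poly" and x :: real
  assumes q: "irreducible q" "poly (map_poly of_int q) x = 0"
    and g: "g \<noteq> 0" "poly (map_poly of_int g) x = 0"
    and min: "\<And>h. h \<noteq> 0 \<Longrightarrow> poly (map_poly of_int h) x = 0 \<Longrightarrow> degree g \<le> degree h"
  shows "\<exists>c d. c \<noteq> 0 \<and> d \<noteq> 0 \<and> smult c g = smult d q"
proof -
  obtain u r where ur: "pseudo_divmod q g = (u, r)" by force
  define a where "a = coeff g (degree g) ^ (Suc (degree q) - degree g)"
  have a0: "a \<noteq> 0" using g by (simp add: a_def)
  have eq: "smult a q = g * u + r" and r: "r = 0 \<or> degree r < degree g"
    using pseudo_divmod[OF g(1) ur] by (auto simp: a_def)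
  have "of_int a * poly (map_poly of_int q) x = poly (map_poly of_int g) x * poly (map_poly of_int u) x
      + poly (map_poly of_int r) x"
    using arg_cong[OF eq, of "\<lambda>h. poly (map_poly of_int h) x"]
    by (simp add: poly_of_int_add poly_of_int_mult poly_of_int_smult)
  then have "poly (map_poly of_int r) x = 0" using q g by simp
  then have "r = 0" using r min by force
  then have eq: "smult a q = g * u" using eq by simp
  have q0: "q \<noteq> 0" using q by auto
  have u0: "u \<noteq> 0" using eq a0 q0 by auto
  have deg: "degree q = degree g + degree u"
    using arg_cong[OF eq, of degree] a0 g u0 by (simp add: degree_mult_eq)
  have "prime_elem q" using q by (simp add: irreducible_imp_prime_poly)
  moreover have "q dvd g * u" using eq by (metis dvd_smult dvd_refl)
  ultimately consider "q dvd g" | "q dvd u" by (meson prime_elem_dvd_multD)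
  then show ?thesis
  proof cases
    case 1
    then obtain v where v: "g = q * v" by blast
    have "degree v = 0" using deg g v by (simp add: degree_mult_eq)
    then obtain c where "v = [:c:]" by (metis degree_eq_zeroE)
    then show ?thesis using v g by (intro exI[of _ 1] exI[of _ c]) auto
  next
    case 2
    then have "degree q \<le> degree u" using u0 by (rule dvd_imp_degree_le)
    then have "degree g = 0" using deg by simp
    then obtain c where "g = [:c:]" by (metis degree_eq_zeroE)
    then show ?thesis using g by (simp add: poly_of_int_pCons)
  qed
qed

text \<open>Both polynomials agree, up to constants, with an integer polynomial of least degree that has the root
  \<open>x\<close>.  This relates the characteristic polynomial to the polynomial in the definition of Pisot numbers.\<close>

lemma irreducible_common_root:
  fixes q h :: "int poly" and x :: real and z :: complex
  assumes "irreducible q" "poly (map_poly of_int q) x = 0"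
    and "irreducible h" "poly (map_poly of_int h) x = 0"
    and "poly (map_poly of_int h) z = 0"
  shows "poly (map_poly of_int q) z = 0"
proof -
  let ?P = "\<lambda>g :: int poly. g \<noteq> 0 \<and> poly (map_poly of_int g) x = 0"
  have "?P q" using assms by auto
  then obtain g where g: "?P g" "\<And>h. ?P h \<Longrightarrow> degree g \<le> degree h"
    using ex_has_least_nat[of ?P q degree] by blast
  have g0: "g \<noteq> 0" and g1: "poly (map_poly of_int g) x = 0"
    and min: "\<And>h. h \<noteq> 0 \<Longrightarrow> poly (map_poly of_int h) x = 0 \<Longrightarrow> degree g \<le> degree h"
    using g by auto
  obtain c d where cd: "c \<noteq> 0" "d \<noteq> 0" "smult c g = smult d q"
    using irreducible_root_associate[OF assms(1,2) g0 g1 min] by auto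
  obtain c' d' where cd': "c' \<noteq> 0" "d' \<noteq> 0" "smult c' g = smult d' h"
    using irreducible_root_associate[OF assms(3,4) g0 g1 min] by auto
  have "of_int c' * poly (map_poly of_int g) z = of_int d' * poly (map_poly of_int h) z"
    using arg_cong[OF cd'(3), of "\<lambda>h. poly (map_poly of_int h) z"] by (simp add: poly_of_int_smult)
  then have "poly (map_poly of_int g) z = 0" using cd' assms by simp
  moreover have "of_int c * poly (map_poly of_int g) z = of_int d * poly (map_poly of_int q) z"
    using arg_cong[OF cd(3), of "\<lambda>h. poly (map_poly of_int h) z"] by (simp add: poly_of_int_smult)
  ultimately show ?thesis using cd by simp
qed

lemma poly_of_int_sum:
  "poly (map_poly of_int (sum f S)) x = (\<Sum>i\<in>S. poly (map_poly of_int (f i)) (x :: 'b::comm_ring_1))"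
  by (induction S rule: infinite_finite_induct) (auto simp: poly_of_int_add)

lemma poly_of_int_prod:
  "poly (map_poly of_int (prod f S)) x = (\<Prod>i\<in>S. poly (map_poly of_int (f i)) (x :: 'b::comm_ring_1))"
  by (induction S rule: infinite_finite_induct) (auto simp: poly_of_int_mult poly_of_int_1)

lemma poly_of_int_of_int:
  "poly (map_poly of_int (of_int k :: int poly)) x = (of_int k :: 'b::comm_ring_1)"
  by (simp add: of_int_poly poly_of_int_pCons)

lemma poly_of_int_det:
  "poly (map_poly of_int (det (B :: int poly ^ 'n ^ 'n))) x
     = det (\<chi> i j. poly (map_poly of_int (B $ i $ j)) (x :: 'b::comm_ring_1))"
  by (simp add: det_def poly_of_int_sum poly_of_int_mult poly_of_int_prod poly_of_int_of_int)

lemma charpoly_root_of_eigenvalue: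
  assumes "eigenvalue M z"
  shows "poly (map_poly of_int (charpoly M)) z = 0"
proof -
  let ?B = "\<chi> i j. (if i = j then z else 0) - (of_int (M $ i $ j) :: complex)"
  have e: "poly (map_poly of_int ((if i = j then [:0, 1:] else 0) - [:k:])) z = (if i = j then z else 0) - of_int k"
    for i j :: 'a and k
    by (simp add: poly_of_int_pCons)
  have eq: "poly (map_poly of_int (charpoly M)) z = det ?B"
    unfolding charpoly_def poly_of_int_det by (simp add: e)
  obtain v where v: "v \<noteq> 0" "of_int_matrix M *v v = z *s v" using assms by (auto simp: eigenvalue_def)
  have "?B *v v = z *s v - of_int_matrix M *v v"
    by (simp add: vec_eq_iff matrix_vector_mult_def of_int_matrix_def left_diff_distrib sum_subtractf
        if_distrib[of "\<lambda>x. x * _"] cong: if_cong)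
  then have "?B *v v = 0" using v by simp
  then have "\<not> invertible ?B"
    using v(1) matrix_left_invertible_ker invertible_left_inverse by blast
  then show ?thesis by (simp add: eq invertible_det_nz)
qed

lemma pisot_conjugates:
  assumes "irreducible_pisot M lam" "eigenvalue M z" "z \<noteq> of_real lam"
  shows "cmod z < 1"
proof -
  obtain q where q: "irreducible q" "poly (map_poly of_int q) lam = 0"
    and conj: "\<And>z :: complex. poly (map_poly of_int q) z = 0 \<Longrightarrow> z \<noteq> of_real lam \<Longrightarrow> cmod z < 1"
    using assms(1) unfolding irreducible_pisot_def pisot_number_def by blast
  have "eigenvalue M (of_real lam)" "irreducible (charpoly M)"
    using assms(1) by (auto simp: irreducible_pisot_def perron_frobenius_eigenvalue_def)
  then have "poly (map_poly of_int (charpoly M)) (of_real lam :: complex) = 0"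
    by (intro charpoly_root_of_eigenvalue)
  then have "poly (map_poly of_int (charpoly M)) lam = 0" by (simp add: poly_of_int_of_real)
  then have "poly (map_poly of_int q) z = 0"
    using irreducible_common_root[OF q] \<open>irreducible (charpoly M)\<close>
      charpoly_root_of_eigenvalue[OF assms(2)] by blast
  then show ?thesis using conj assms(3) by blast
qed

lemma matrix_power_mult_vector:
  fixes A :: "'b::semiring_1 ^ 'n ^ 'n"
  shows "(((**) A ^^ k) (mat 1)) *v x = ((*v) A ^^ k) x"
  by (induction k) (auto simp: matrix_vector_mul_assoc[symmetric])

lemma of_int_matrix_mult:
  "of_int_matrix (A ** B) = (of_int_matrix A ** of_int_matrix B :: 'b::ring_1 ^ _ ^ _)"
  by (simp add: vec_eq_iff of_int_matrix_def matrix_matrix_mult_def)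

lemma of_int_matrix_power:
  fixes M :: "int ^ 'n ^ 'n"
  shows "of_int_matrix (((**) M ^^ k) (mat 1)) = ((**) (of_int_matrix M) ^^ k) (mat 1 :: 'b::ring_1 ^ _ ^ _)"
proof (induction k)
  case 0
  show ?case by (simp add: vec_eq_iff of_int_matrix_def mat_def)
next
  case (Suc k)
  then show ?case by (simp add: of_int_matrix_mult)
qed

lemma matrix_power_eigenvector:
  fixes A :: "real ^ 'n ^ 'n"
  assumes "A *v x = l *\<^sub>R x"
  shows "((*v) A ^^ k) x = l ^ k *\<^sub>R x"
  by (induction k) (auto simp: assms matrix_vector_mult_scaleR mult.commute)

text \<open>Subtract from \<open>x\<close> the largest multiple of \<open>R\<close> that leaves it nonnegative.  The difference \<open>y\<close> has a
  zero entry, but it is an eigenvector of a positive power of the matrix, so it vanishes.\<close>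

lemma perron_eigenvector_unique:
  fixes x :: "real ^ 'a::finite"
  assumes prim: "primitive_matrix M" and pf: "perron_frobenius_vectors M lam L R" and "0 \<le> lam"
    and x: "of_int_matrix M *v x = lam *\<^sub>R x"
  shows "\<exists>c. x = c *\<^sub>R R"
proof -
  let ?A = "of_int_matrix M :: real ^ 'a ^ 'a"
  have R: "?A *v R = lam *\<^sub>R R" and Rpos: "\<And>i. 0 < R $ i"
    using pf by (auto simp: perron_frobenius_vectors_def)
  obtain k where k: "\<And>i j. 0 < (((**) M ^^ k) (mat 1)) $ i $ j"
    using prim by (auto simp: primitive_matrix_def)
  define B where "B = ((**) ?A ^^ k) (mat 1)"
  have Bpos: "0 < B $ i $ j" for i j
  proof -
    have "B = of_int_matrix (((**) M ^^ k) (mat 1))" by (simp add: B_def of_int_matrix_power)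
    then show ?thesis using k[of i j] by (simp add: of_int_matrix_def)
  qed
  \<comment> \<open>The largest \<open>c\<close> with \<open>c *\<^sub>R R\<close> below \<open>x\<close>.\<close>
  let ?S = "(\<lambda>i. x $ i / R $ i) ` UNIV"
  define c where "c = Min ?S"
  define y where "y = x - c *\<^sub>R R"
  have "c \<in> ?S" unfolding c_def by (rule Min_in) auto
  then obtain i0 where i0: "c = x $ i0 / R $ i0" by blast
  have y0: "y $ i0 = 0" using Rpos[of i0] by (simp add: y_def i0)
  have ypos: "0 \<le> y $ i" for i
  proof -
    have "c \<le> x $ i / R $ i" unfolding c_def by (rule Min_le) auto
    then show ?thesis using Rpos[of i] by (simp add: y_def field_simps)
  qed
  have "?A *v y = lam *\<^sub>R y"
    by (simp add: y_def matrix_vector_mult_diff_distrib matrix_vector_mult_scaleR x R algebra_simps)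
  then have "B *v y = lam ^ k *\<^sub>R y"
    by (simp add: B_def matrix_power_mult_vector matrix_power_eigenvector)
  then have "(\<Sum>j\<in>UNIV. B $ i0 $ j * y $ j) = 0"
    using y0 by (simp add: matrix_vector_mult_def vec_eq_iff)
  then have "B $ i0 $ j * y $ j = 0" for j
    using Bpos ypos by (subst (asm) sum_nonneg_eq_0_iff) (auto simp: less_imp_le)
  then have "y = 0" using Bpos[of i0] by (auto simp: vec_eq_iff less_le)
  then show ?thesis by (auto simp: y_def)
qed

lemma perron_hyperplane_eigenvector_zero:
  fixes v :: "complex ^ 'a::finite"
  assumes prim: "primitive_matrix M" and pf: "perron_frobenius_vectors M lam L R" and "0 \<le> lam"
    and v: "of_int_matrix M *v v = of_real lam *s v" and L: "(\<Sum>i\<in>UNIV. of_real (L $ i) * v $ i) = 0"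
  shows "v = 0"
proof -
  let ?A = "of_int_matrix M :: real ^ 'a ^ 'a"
  have LR: "L \<bullet> R = 1" using pf by (simp add: perron_frobenius_vectors_def)
  have *: "x = 0" if "?A *v x = lam *\<^sub>R x" "L \<bullet> x = 0" for x
    using perron_eigenvector_unique[OF prim pf assms(3) that(1)] that(2) LR by auto
  have vi: "(\<Sum>j\<in>UNIV. of_int (M $ i $ j) * v $ j) = of_real lam * v $ i" for i
    using arg_cong[OF v, of "\<lambda>w. w $ i"] by (simp add: matrix_vector_mult_def of_int_matrix_def)
  have "(\<chi> i. Re (v $ i)) = 0"
  proof (rule *)
    show "?A *v (\<chi> i. Re (v $ i)) = lam *\<^sub>R (\<chi> i. Re (v $ i))"
      using arg_cong[OF vi, of Re] by (simp add: vec_eq_iff matrix_vector_mult_def of_int_matrix_def)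
    show "L \<bullet> (\<chi> i. Re (v $ i)) = 0"
      using arg_cong[OF L, of Re] by (simp add: inner_vec_def)
  qed
  moreover have "(\<chi> i. Im (v $ i)) = 0"
  proof (rule *)
    show "?A *v (\<chi> i. Im (v $ i)) = lam *\<^sub>R (\<chi> i. Im (v $ i))"
      using arg_cong[OF vi, of Im] by (simp add: vec_eq_iff matrix_vector_mult_def of_int_matrix_def)
    show "L \<bullet> (\<chi> i. Im (v $ i)) = 0"
      using arg_cong[OF L, of Im] by (simp add: inner_vec_def)
  qed
  ultimately show ?thesis by (simp add: vec_eq_iff complex_eq_iff)
qed

text \<open>Finitely many vectors of the orbit are linearly dependent; this replaces the theorem of Cayley and
  Hamilton.\<close>

lemma orbit_recurrence_exists:
  fixes A :: "real ^ 'n ^ 'n" and x :: "real ^ 'n"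
  shows "\<exists>p. p \<noteq> 0 \<and> (\<forall>i k. recurrence p (\<lambda>j. of_real ((((*v) A ^^ j) x) $ i)) k = 0)"
proof -
  let ?T = "\<lambda>k. ((*v) A ^^ k) x"
  define d where "d = DIM(real ^ 'n)"
  have "\<exists>c :: nat \<Rightarrow> real. (\<exists>k\<le>d. c k \<noteq> 0) \<and> (\<Sum>k\<le>d. c k *\<^sub>R ?T k) = 0"
  proof (cases "inj_on ?T {..d}")
    case True
    have "card (?T ` {..d}) = Suc d" using True by (simp add: card_image)
    then have "dependent (?T ` {..d})" by (intro dependent_biggerset) (auto simp: d_def)
    then obtain u where u: "\<exists>v\<in>?T ` {..d}. u v \<noteq> 0" "(\<Sum>v\<in>?T ` {..d}. u v *\<^sub>R v) = 0"
      by (subst (asm) dependent_finite) auto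
    show ?thesis
      by (rule exI[of _ "\<lambda>k. u (?T k)"]) (use u True in \<open>auto simp: sum.reindex\<close>)
  next
    case False
    then obtain a b where ab: "a \<le> d" "b \<le> d" "a \<noteq> b" "?T a = ?T b"
      by (auto simp: inj_on_def)
    let ?c = "\<lambda>k. if k = a then 1 else if k = b then - 1 else 0 :: real"
    have "(\<Sum>k\<le>d. ?c k *\<^sub>R ?T k) = (\<Sum>k\<in>{a, b}. ?c k *\<^sub>R ?T k)"
      by (rule sum.mono_neutral_right) (use ab in auto)
    also have "\<dots> = 0" using ab by simp
    finally show ?thesis using ab by (intro exI[of _ ?c]) auto
  qed
  then obtain c :: "nat \<Rightarrow> real" and k0 where k0: "k0 \<le> d" "c k0 \<noteq> 0" and c: "(\<Sum>k\<le>d. c k *\<^sub>R ?T k) = 0"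
    by blast
  define p :: "complex poly" where "p = (\<Sum>k\<le>d. monom (of_real (c k)) k)"
  have coeff_p: "coeff p j = (if j \<le> d then of_real (c j) else 0)" for j
    by (simp add: p_def coeff_sum if_distrib[of "\<lambda>x. x = _"] cong: if_cong)
  have "coeff p k0 \<noteq> 0" using k0 by (simp add: coeff_p)
  then have p0: "p \<noteq> 0" by auto
  have dp: "degree p \<le> d" by (rule degree_le) (simp add: coeff_p)
  have "recurrence p (\<lambda>j. of_real (?T j $ i)) k = 0" for i k
  proof -
    have "(\<Sum>j\<le>d. c j *\<^sub>R ?T (k + j)) = ((*v) A ^^ k) (\<Sum>j\<le>d. c j *\<^sub>R ?T j)"
    proof (induction k)
      case (Suc k)
      have "(\<Sum>j\<le>d. c j *\<^sub>R ?T (Suc k + j)) = A *v (\<Sum>j\<le>d. c j *\<^sub>R ?T (k + j))"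
        by (simp add: vec.sum matrix_vector_mult_scaleR)
      then show ?case using Suc by simp
    qed simp
    also have "\<dots> = 0" unfolding c by (induction k) auto
    finally have "(\<Sum>j\<le>d. c j *\<^sub>R ?T (k + j)) $ i = 0" by simp
    then have "(\<Sum>j\<le>d. c j * (?T (k + j) $ i)) = 0"
      by (simp only: sum_component vector_scaleR_component real_scaleR_def)
    moreover have "recurrence p (\<lambda>j. of_real (?T j $ i)) k = of_real (\<Sum>j\<le>d. c j * (?T (k + j) $ i))"
      unfolding recurrence_altdef[OF dp] of_real_sum by (rule sum.cong) (auto simp: coeff_p)
    ultimately show ?thesis by simp
  qed
  then show ?thesis using p0 by blast
qed

text \<open>Let \<open>p\<close> be of least degree among the polynomials that annihilate the orbit of \<open>x\<close>.  If \<open>z\<close> is a root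
  of \<open>p\<close>, then \<open>p\<close> without this linear factor does not annihilate the orbit, and applying it to the
  orbit gives an eigenvector for \<open>z\<close>.  It lies in the complexified hyperplane, so \<open>z\<close> is not \<open>lam\<close> and
  has modulus less than one.\<close>

lemma hyperplane_orbit_summable:
  fixes M :: "int ^ 'a::finite ^ 'a" and x :: "real ^ 'a"
  assumes prim: "primitive_matrix M" and pisot: "irreducible_pisot M lam"
    and pf: "perron_frobenius_vectors M lam L R" and x: "L \<bullet> x = 0"
  shows "summable (\<lambda>k. norm (((*v) (of_int_matrix M) ^^ k) x))"
proof -
  let ?A = "of_int_matrix M :: real ^ 'a ^ 'a"
  let ?T = "\<lambda>k. ((*v) ?A ^^ k) x"
  let ?s = "\<lambda>i j. of_real (?T j $ i) :: complex"
  let ?P = "\<lambda>p. p \<noteq> 0 \<and> (\<forall>i k. recurrence p (?s i) k = 0)"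
  have lam: "1 < lam" using pisot by (auto simp: irreducible_pisot_def pisot_number_def)
  have LA: "L v* ?A = lam *\<^sub>R L" using pf by (simp add: perron_frobenius_vectors_def)
  have LT: "L \<bullet> ?T k = 0" for k
    by (induction k) (auto simp: x LA dot_lmul_matrix[symmetric])
  obtain p where p: "?P p" and pmin: "\<And>r. ?P r \<Longrightarrow> degree p \<le> degree r"
    using orbit_recurrence_exists[of ?A x] ex_has_least_nat[of ?P _ degree] by blast
  have "cmod z < 1" if z: "poly p z = 0" for z
  proof -
    obtain r where r: "p = [:- z, 1:] * r" using z by (auto simp: poly_eq_0_iff_dvd)
    have r0: "r \<noteq> 0" using p r by auto
    have "degree p = Suc (degree r)" unfolding r using r0 by (subst degree_mult_eq) auto
    then have "\<not> ?P r" using pmin[of r] by auto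
    then obtain i0 k where nz: "recurrence r (?s i0) k \<noteq> 0" using r0 by auto
    \<comment> \<open>The shift operator acts on \<open>v\<close> as multiplication by \<open>z\<close>, since \<open>p\<close> annihilates the orbit, and
      as the matrix, since the sequence is an orbit.\<close>
    define v :: "complex ^ 'a" where "v = (\<chi> i. recurrence r (?s i) k)"
    have v0: "v \<noteq> 0" using nz by (auto simp: v_def vec_eq_iff)
    have "recurrence r (?s i) (Suc k) = z * recurrence r (?s i) k" for i
    proof -
      have "recurrence r (\<lambda>j. ?s i (Suc j) - z * ?s i j) k = 0"
        using p unfolding r recurrence_linear_factor by blast
      then show ?thesis
        by (simp add: recurrence_def algebra_simps sum_subtractf sum_distrib_left)
    qed
    moreover have "recurrence r (?s i) (Suc k) = (\<Sum>j\<in>UNIV. of_int (M $ i $ j) * recurrence r (?s j) k)" for i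
    proof -
      have "recurrence r (?s i) (Suc k) = (\<Sum>l\<le>degree r. coeff r l * (\<Sum>j\<in>UNIV. of_int (M $ i $ j) * ?s j (k + l)))"
        by (simp add: recurrence_def matrix_vector_mult_def of_int_matrix_def)
      also have "\<dots> = (\<Sum>j\<in>UNIV. \<Sum>l\<le>degree r. of_int (M $ i $ j) * (coeff r l * ?s j (k + l)))"
        by (subst sum.swap) (simp add: sum_distrib_left algebra_simps)
      finally show ?thesis by (simp add: recurrence_def sum_distrib_left)
    qed
    ultimately have eig: "of_int_matrix M *v v = z *s v"
      by (simp add: vec_eq_iff v_def matrix_vector_mult_def of_int_matrix_def)
    have "(\<Sum>i\<in>UNIV. of_real (L $ i) * v $ i) = (\<Sum>l\<le>degree r. coeff r l * of_real (L \<bullet> ?T (k + l)))"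
      unfolding v_def recurrence_def
      by (simp add: sum_distrib_left inner_vec_def algebra_simps) (rule sum.swap)
    then have "(\<Sum>i\<in>UNIV. of_real (L $ i) * v $ i) = 0" by (simp add: LT)
    then have "z \<noteq> of_real lam"
      using perron_hyperplane_eigenvector_zero[OF prim pf _ _, of v] eig v0 lam by auto
    moreover have "eigenvalue M z" using eig v0 by (auto simp: eigenvalue_def)
    ultimately show ?thesis using pisot_conjugates[OF pisot] by blast
  qed
  then have "summable (\<lambda>k. cmod (?s i k))" for i
    using p by (intro summable_recurrence[of p]) auto
  then have "summable (\<lambda>k. \<Sum>i\<in>UNIV. \<bar>?T k $ i\<bar>)" by (intro summable_sum) simp
  then show ?thesis
    by (rule summable_comparison_test'[where N = 0]) (simp add: norm_le_l1_cart)
qed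

section \<open>Weak limits of measures\<close>

text \<open>The indicator of an open set is the increasing limit of \<open>min 1 (n * infdist x (- S))\<close>, and the open
  sets are an intersection-stable generator.\<close>

lemma finite_borel_measure_eqI:
  fixes m m' :: "('b::metric_space) measure"
  assumes sets: "sets m = sets borel" "sets m' = sets borel"
    and fin: "finite_measure m" "finite_measure m'"
    and eq: "\<And>f :: 'b \<Rightarrow> real. continuous_on UNIV f \<Longrightarrow> bounded (range f) \<Longrightarrow> integral\<^sup>L m f = integral\<^sup>L m' f"
  shows "m = m'"
proof -
  interpret m: finite_measure m by fact
  interpret m': finite_measure m' by fact
  have total: "emeasure m UNIV = emeasure m' UNIV"
    using eq[of "\<lambda>_. 1"] sets_eq_imp_space_eq[OF sets(1)] sets_eq_imp_space_eq[OF sets(2)]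
    by (simp add: m.emeasure_eq_measure m'.emeasure_eq_measure)
  have "emeasure m S = emeasure m' S" if S: "open S" for S :: "'b set"
  proof (cases "S = UNIV")
    case False
    define f where "f n x = min 1 (real n * infdist x (- S))" for n and x :: 'b
    have cont: "continuous_on UNIV (f n)" for n
      unfolding f_def by (intro continuous_intros)
    have bd: "norm (f n x) \<le> 1" for n x
      by (auto simp: f_def infdist_nonneg min_def)
    have lim: "(\<lambda>n. f n x) \<longlonglongrightarrow> indicator S x" for x
    proof (cases "x \<in> S")
      case True
      have "closed (- S)" using S by auto
      then have "infdist x (- S) > 0"
        using True False infdist_pos_not_in_closed[of "- S" x] by auto
      then obtain N where N: "1 \<le> real N * infdist x (- S)"
        using reals_Archimedean3 by (meson less_imp_le)
      have "\<forall>\<^sub>F n in sequentially. f n x = 1"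
        using eventually_ge_at_top[of N]
      proof eventually_elim
        case (elim n)
        have "real N * infdist x (- S) \<le> real n * infdist x (- S)"
          using elim by (intro mult_right_mono) (auto simp: infdist_nonneg)
        then show ?case using N by (simp add: f_def)
      qed
      then show ?thesis using True by (simp add: tendsto_eventually)
    qed (simp add: f_def)
    have conv: "(\<lambda>n. integral\<^sup>L M (f n)) \<longlonglongrightarrow> measure M S"
      if M: "sets M = sets borel" "finite_measure M" for M
    proof -
      interpret finite_measure M by fact
      have "(\<lambda>n. integral\<^sup>L M (f n)) \<longlonglongrightarrow> integral\<^sup>L M (indicator S :: 'b \<Rightarrow> real)"
      proof (rule integral_dominated_convergence[where w = "\<lambda>_. 1"])
        show "f n \<in> borel_measurable M" for n
          using borel_measurable_continuous_onI[OF cont] measurable_cong_sets[OF M(1) refl] by blast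
        show "(indicator S :: 'b \<Rightarrow> real) \<in> borel_measurable M"
          using S M by (intro borel_measurable_indicator) auto
      qed (use lim bd in auto)
      moreover have "integral\<^sup>L M (indicator S :: 'b \<Rightarrow> real) = measure M S"
        using S M sets_eq_imp_space_eq[OF M(1)] by simp
      ultimately show ?thesis by simp
    qed
    have "bounded (range (f n))" for n using bd by (auto simp: bounded_iff)
    then have "integral\<^sup>L m (f n) = integral\<^sup>L m' (f n)" for n using eq cont by blast
    then have "measure m S = measure m' S"
      using conv[OF sets(1) fin(1)] conv[OF sets(2) fin(2)] LIMSEQ_unique by fastforce
    then show ?thesis by (simp add: m.emeasure_eq_measure m'.emeasure_eq_measure)
  qed (simp add: total)
  then show ?thesis
    by (intro measure_eqI_generator_eq[where E = "{S. open S}" and \<Omega> = UNIV and A = "\<lambda>_. UNIV"])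
       (auto simp: Int_stable_def sets borel_def)
qed

primrec chain_law :: "(nat \<Rightarrow> 's \<Rightarrow> 's pmf) \<Rightarrow> 's \<Rightarrow> nat \<Rightarrow> 's pmf" where
  "chain_law K x 0 = return_pmf x"
| "chain_law K x (Suc n) = bind_pmf (chain_law K x n) (K n)"

text \<open>The path measure is given by the theorem of Ionescu-Tulcea.  The state space is discrete but may be
  uncountable, where a pair of coordinates need not be jointly measurable with respect to all sets of
  pairs; the statement about consecutive states is therefore made through the Borel function \<open>pos\<close>.\<close>

lemma markov_chain_exists:
  fixes K :: "nat \<Rightarrow> 's \<Rightarrow> 's pmf" and x :: 's and pos :: "'s \<Rightarrow> 'v::{second_countable_topology, metric_space}"
  assumes step: "\<And>n s t. t \<in> set_pmf (K n s) \<Longrightarrow> dist (pos t) (pos s) \<le> \<epsilon> n"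
  shows "\<exists>(Q :: (nat \<Rightarrow> 's) measure). prob_space Q
    \<and> (\<forall>n. (\<lambda>\<omega>. \<omega> n) \<in> measurable Q (count_space UNIV) \<and> distr Q (count_space UNIV) (\<lambda>\<omega>. \<omega> n) = measure_pmf (chain_law K x n))
    \<and> (AE \<omega> in Q. \<forall>n. dist (pos (\<omega> (Suc n))) (pos (\<omega> n)) \<le> \<epsilon> n)"
proof -
  \<comment> \<open>Coordinate \<open>0\<close> is the initial state; coordinate \<open>Suc k\<close> is drawn from \<open>K k\<close>.\<close>
  define ker where "ker n \<omega> = (case n of 0 \<Rightarrow> return_pmf x | Suc k \<Rightarrow> K k (\<omega> k))" for n and \<omega> :: "nat \<Rightarrow> 's"
  let ?M = "\<lambda>_::nat. count_space (UNIV :: 's set)"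
  interpret IT: Ionescu_Tulcea "\<lambda>n \<omega>. measure_pmf (ker n \<omega>)" ?M
  proof
    show "(\<lambda>\<omega>. measure_pmf (ker n \<omega>)) \<in> PiM {0..<n} ?M \<rightarrow>\<^sub>M subprob_algebra (count_space UNIV)" for n
    proof (cases n)
      case 0
      then show ?thesis
        by (auto simp: ker_def intro!: measurable_const measure_pmf_in_subprob_algebra)
    next
      case (Suc k)
      have "(\<lambda>\<omega>. \<omega> k) \<in> PiM {0..<n} ?M \<rightarrow>\<^sub>M count_space UNIV"
        using Suc by (intro measurable_component_singleton) auto
      then have "(\<lambda>\<omega>. measure_pmf (K k (\<omega> k))) \<in> PiM {0..<n} ?M \<rightarrow>\<^sub>M subprob_algebra (count_space UNIV)"
        by (rule measurable_compose) (auto intro!: measure_pmf_in_subprob_algebra)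
      then show ?thesis by (simp add: ker_def Suc)
    qed
  qed
  let ?u = "\<lambda>_::nat. undefined :: 's"
  have u: "?u \<in> space (PiM {0..<0} ?M)" by (simp add: space_PiM)
  have C_Suc: "(\<integral>\<^sup>+\<omega>. g \<omega> \<partial>IT.C 0 (Suc n) ?u) = (\<integral>\<^sup>+\<omega>. \<integral>\<^sup>+t. g (fun_upd \<omega> n t) \<partial>measure_pmf (ker n \<omega>) \<partial>IT.C 0 n ?u)"
    if g: "g \<in> borel_measurable (PiM {0..<Suc n} ?M)" for g n
  proof -
    have "(\<integral>\<^sup>+\<omega>. g \<omega> \<partial>IT.C 0 (Suc n) ?u) = (\<integral>\<^sup>+\<omega>. \<integral>\<^sup>+\<omega>'. g \<omega>' \<partial>IT.eP n \<omega> \<partial>IT.C 0 n ?u)"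
      using IT.measurable_eP[of n] IT.sets_C[OF u, of n] g
      by (simp, subst nn_integral_bind[where B = "PiM {0..<Suc n} ?M"])
         (auto simp: measurable_cong_sets[OF IT.sets_C[OF u, of n] refl])
    also have "\<dots> = (\<integral>\<^sup>+\<omega>. \<integral>\<^sup>+t. g (fun_upd \<omega> n t) \<partial>measure_pmf (ker n \<omega>) \<partial>IT.C 0 n ?u)"
      using IT.space_C[OF u, of n] g by (intro nn_integral_cong IT.nn_integral_eP) auto
    finally show ?thesis .
  qed
  have coord: "(\<lambda>\<omega>. h (\<omega> i)) \<in> borel_measurable (PiM {0..<n} ?M)" if "i < n"
    for h :: "'s \<Rightarrow> 'z::topological_space" and i n
    by (rule measurable_compose[OF measurable_component_singleton[of i]]) (use that in auto)
  have law: "(\<integral>\<^sup>+\<omega>. h (\<omega> n) \<partial>IT.C 0 (Suc n) ?u) = (\<integral>\<^sup>+s. h s \<partial>chain_law K x n)" for h n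
  proof (induction n arbitrary: h)
    case 0
    have "(\<integral>\<^sup>+\<omega>. h (\<omega> 0) \<partial>IT.C 0 (Suc 0) ?u) = (\<integral>\<^sup>+\<omega>. h x \<partial>IT.C 0 0 ?u)"
      by (subst C_Suc[OF coord]) (auto simp: ker_def simp del: IT.C.simps)
    also have "\<dots> = h x"
      using prob_space.emeasure_space_1[OF IT.prob_space_C[OF u, of 0]] by (simp del: IT.C.simps)
    finally show ?case by simp
  next
    case (Suc n)
    have "(\<integral>\<^sup>+\<omega>. h (\<omega> (Suc n)) \<partial>IT.C 0 (Suc (Suc n)) ?u)
        = (\<integral>\<^sup>+\<omega>. (\<integral>\<^sup>+t. h t \<partial>measure_pmf (K n (\<omega> n))) \<partial>IT.C 0 (Suc n) ?u)"
      by (subst C_Suc[OF coord]) (auto simp: ker_def)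
    also have "\<dots> = (\<integral>\<^sup>+s. (\<integral>\<^sup>+t. h t \<partial>measure_pmf (K n s)) \<partial>chain_law K x n)"
      by (rule Suc)
    finally show ?case by simp
  qed
  define Q where "Q = IT.PF.lim"
  have restr: "distr Q (PiM {0..<n} ?M) (\<lambda>\<omega>. restrict \<omega> {0..<n}) = IT.C 0 n ?u" for n
  proof -
    have up: "IT.up_to {0..<n} = n"
      unfolding IT.up_to_def by (rule Least_equality) (auto simp: not_less[symmetric])
    have "distr Q (PiM {0..<n} ?M) (\<lambda>\<omega>. restrict \<omega> {0..<n}) = IT.CI {0..<n}"
      unfolding Q_def by (rule IT.distr_lim) auto
    also have "\<dots> = IT.C 0 n ?u"
      unfolding IT.CI_def up using IT.distr_C[of n n ?u 0] by simp
    finally show ?thesis .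
  qed
  have [measurable_cong]: "sets Q = sets (PiM UNIV ?M)" by (simp add: Q_def)
  have rm: "(\<lambda>\<omega>. restrict \<omega> {0..<n}) \<in> Q \<rightarrow>\<^sub>M PiM {0..<n} ?M" for n
    by (simp add: Q_def measurable_cong_sets[OF IT.PF.sets_lim refl] measurable_restrict_subset)
  have nnQ: "(\<integral>\<^sup>+\<omega>. g (restrict \<omega> {0..<n}) \<partial>Q) = (\<integral>\<^sup>+\<omega>. g \<omega> \<partial>IT.C 0 n ?u)"
    if "g \<in> borel_measurable (PiM {0..<n} ?M)" for g n
    unfolding restr[symmetric] using that rm by (subst nn_integral_distr) auto
  have meas: "(\<lambda>\<omega>. \<omega> n) \<in> Q \<rightarrow>\<^sub>M count_space UNIV" for n
    by (simp add: Q_def measurable_cong_sets[OF IT.PF.sets_lim refl] measurable_component_singleton)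
  have distrQ: "distr Q (count_space UNIV) (\<lambda>\<omega>. \<omega> n) = measure_pmf (chain_law K x n)" for n
  proof (rule measure_eqI)
    fix A :: "'s set"
    have "emeasure (distr Q (count_space UNIV) (\<lambda>\<omega>. \<omega> n)) A = (\<integral>\<^sup>+s. indicator A s \<partial>distr Q (count_space UNIV) (\<lambda>\<omega>. \<omega> n))"
      by simp
    also have "\<dots> = (\<integral>\<^sup>+\<omega>. indicator A (\<omega> n) \<partial>Q)"
      using meas by (subst nn_integral_distr) auto
    also have "\<dots> = (\<integral>\<^sup>+\<omega>. indicator A (restrict \<omega> {0..<Suc n} n) \<partial>Q)"
      by (intro nn_integral_cong) simp
    also have "\<dots> = (\<integral>\<^sup>+\<omega>. indicator A (\<omega> n) \<partial>IT.C 0 (Suc n) ?u)"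
      by (rule nnQ[of "\<lambda>\<omega>. indicator A (\<omega> n)"]) (rule coord, simp)
    also have "\<dots> = emeasure (measure_pmf (chain_law K x n)) A"
      unfolding law by simp
    finally show "emeasure (distr Q (count_space UNIV) (\<lambda>\<omega>. \<omega> n)) A = emeasure (measure_pmf (chain_law K x n)) A" .
  qed simp
  have prob: "prob_space Q"
    using prob_space_measure_pmf[of "chain_law K x 0"] unfolding distrQ[symmetric]
    by (rule prob_space_distrD[OF meas])
  have posm: "(\<lambda>\<omega>. pos (\<omega> n)) \<in> borel_measurable Q" for n
    by (rule measurable_compose[OF meas]) simp
  have "AE \<omega> in Q. dist (pos (\<omega> (Suc n))) (pos (\<omega> n)) \<le> \<epsilon> n" for n
  proof -
    let ?B = "{(y, z). \<not> dist y z \<le> \<epsilon> n} :: ('v \<times> 'v) set"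
    let ?g = "\<lambda>\<omega>. indicator ?B (pos (\<omega> (Suc n)), pos (\<omega> n)) :: ennreal"
    have oB: "open ?B"
      unfolding case_prod_beta not_le by (intro open_Collect_less continuous_intros)
    then have sB: "?B \<in> sets (borel \<Otimes>\<^sub>M borel)"
      unfolding borel_prod by (rule borel_open)
    have g: "?g \<in> borel_measurable (PiM {0..<Suc (Suc n)} ?M)"
      by (rule measurable_compose[OF measurable_Pair[OF coord coord] borel_measurable_indicator[OF sB]]) auto
    have "(\<integral>\<^sup>+\<omega>. ?g \<omega> \<partial>Q) = (\<integral>\<^sup>+\<omega>. ?g (restrict \<omega> {0..<Suc (Suc n)}) \<partial>Q)"
      by (intro nn_integral_cong) simp
    also have "\<dots> = (\<integral>\<^sup>+\<omega>. ?g \<omega> \<partial>IT.C 0 (Suc (Suc n)) ?u)"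
      by (rule nnQ[OF g])
    also have "\<dots> = (\<integral>\<^sup>+\<omega>. (\<integral>\<^sup>+t. indicator ?B (pos t, pos (\<omega> n)) \<partial>measure_pmf (K n (\<omega> n))) \<partial>IT.C 0 (Suc n) ?u)"
      by (subst C_Suc[OF g]) (simp add: ker_def)
    also have "\<dots> = (\<integral>\<^sup>+\<omega>. 0 \<partial>IT.C 0 (Suc n) ?u)"
    proof (rule nn_integral_cong)
      fix \<omega>
      have "AE t in measure_pmf (K n (\<omega> n)). indicator ?B (pos t, pos (\<omega> n)) = (0::ennreal)"
        by (rule AE_pmfI) (use step in auto)
      then show "(\<integral>\<^sup>+t. indicator ?B (pos t, pos (\<omega> n)) \<partial>measure_pmf (K n (\<omega> n))) = 0"
        by (simp add: nn_integral_0_iff_AE)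
    qed
    finally have "(\<integral>\<^sup>+\<omega>. ?g \<omega> \<partial>Q) = 0" by simp
    moreover have "?g \<in> borel_measurable Q"
      by (rule measurable_compose[OF measurable_Pair[OF posm posm] borel_measurable_indicator[OF sB]])
    ultimately have "AE \<omega> in Q. ?g \<omega> = 0" by (simp add: nn_integral_0_iff_AE)
    then show ?thesis by eventually_elim (auto simp: indicator_def split: if_splits)
  qed
  then have "AE \<omega> in Q. \<forall>n. dist (pos (\<omega> (Suc n))) (pos (\<omega> n)) \<le> \<epsilon> n"
    by (simp add: AE_all_countable)
  then show ?thesis using prob meas distrQ by blast
qed

text \<open>Laws that are coupled by a Markov chain with summable jumps converge weakly, because the paths of the
  chain converge almost surely.  The rate is stated as a transfer of the oscillation of \<open>f\<close> near the
  support of the law at time \<open>n\<close>; this makes the limit explicit without a compactness theorem for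
  families of measures.\<close>

lemma coupled_limit_measure:
  fixes K :: "nat \<Rightarrow> 's \<Rightarrow> 's pmf" and x :: 's and pos :: "'s \<Rightarrow> 'v::{banach, second_countable_topology}"
  assumes step: "\<And>n s t. t \<in> set_pmf (K n s) \<Longrightarrow> dist (pos t) (pos s) \<le> \<epsilon> n"
    and sum: "summable \<epsilon>" and nonneg: "\<And>n. 0 \<le> \<epsilon> n"
  shows "\<exists>m :: 'v measure. prob_space m \<and> sets m = sets borel \<and>
    (\<forall>n (f :: 'v \<Rightarrow> real) \<delta>. f \<in> borel_measurable borel \<longrightarrow> bounded (range f) \<longrightarrow>
      (\<forall>s\<in>set_pmf (chain_law K x n). \<forall>y. dist y (pos s) \<le> (\<Sum>i. \<epsilon> (i + n)) \<longrightarrow> \<bar>f y - f (pos s)\<bar> \<le> \<delta>) \<longrightarrow>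
      \<bar>integral\<^sup>L m f - measure_pmf.expectation (chain_law K x n) (\<lambda>s. f (pos s))\<bar> \<le> \<delta>)"
proof -
  obtain Q :: "(nat \<Rightarrow> 's) measure" where Q: "prob_space Q"
    and meas: "\<And>n. (\<lambda>\<omega>. \<omega> n) \<in> measurable Q (count_space UNIV)"
    and law: "\<And>n. distr Q (count_space UNIV) (\<lambda>\<omega>. \<omega> n) = measure_pmf (chain_law K x n)"
    and ae: "AE \<omega> in Q. \<forall>n. dist (pos (\<omega> (Suc n))) (pos (\<omega> n)) \<le> \<epsilon> n"
    using markov_chain_exists[of K pos \<epsilon> x] step by blast
  interpret prob_space Q by fact
  have posm: "(\<lambda>\<omega>. pos (\<omega> n)) \<in> borel_measurable Q" for n
    by (rule measurable_compose[OF meas]) simp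
  define X where "X \<omega> = lim (\<lambda>n. pos (\<omega> n))" for \<omega>
  have Xm: "X \<in> borel_measurable Q"
    unfolding X_def by (rule borel_measurable_lim_metric) (rule posm)
  have near: "dist (X \<omega>) (pos (\<omega> n)) \<le> (\<Sum>i. \<epsilon> (i + n))"
    if d: "\<And>n. dist (pos (\<omega> (Suc n))) (pos (\<omega> n)) \<le> \<epsilon> n" for \<omega> n
  proof -
    have part: "dist (pos (\<omega> (n + k))) (pos (\<omega> n)) \<le> (\<Sum>i<k. \<epsilon> (i + n))" for n k
    proof (induction k)
      case (Suc k)
      have "dist (pos (\<omega> (n + Suc k))) (pos (\<omega> n)) \<le> dist (pos (\<omega> (Suc (n + k)))) (pos (\<omega> (n + k))) + dist (pos (\<omega> (n + k))) (pos (\<omega> n))"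
        using dist_triangle by simp
      then show ?case using Suc d[of "n + k"] by (simp add: add.commute)
    qed simp
    have tail: "dist (pos (\<omega> (n + k))) (pos (\<omega> n)) \<le> (\<Sum>i. \<epsilon> (i + n))" for n k
      using part[of n k] sum_le_suminf[of "\<lambda>i. \<epsilon> (i + n)" "{..<k}"] sum nonneg
      by (auto simp: summable_iff_shift intro: order_trans)
    have "Cauchy (\<lambda>n. pos (\<omega> n))"
    proof (rule metric_CauchyI)
      fix e :: real assume "0 < e"
      then have "\<forall>\<^sub>F n in sequentially. (\<Sum>i. \<epsilon> (i + n)) < e / 2"
        using suminf_exist_split2[OF sum] by (intro order_tendstoD(2)[of _ 0]) auto
      then obtain N where N: "(\<Sum>i. \<epsilon> (i + N)) < e / 2" by (auto simp: eventually_sequentially)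
      have "dist (pos (\<omega> a)) (pos (\<omega> b)) < e" if "N \<le> a" "N \<le> b" for a b
        using tail[of N "a - N"] tail[of N "b - N"] that N dist_triangle2[of "pos (\<omega> a)" "pos (\<omega> b)" "pos (\<omega> N)"]
        by auto
      then show "\<exists>M. \<forall>m\<ge>M. \<forall>n\<ge>M. dist (pos (\<omega> m)) (pos (\<omega> n)) < e" by blast
    qed
    then have "(\<lambda>n. pos (\<omega> n)) \<longlonglongrightarrow> X \<omega>"
      unfolding X_def using Cauchy_convergent convergent_LIMSEQ_iff by blast
    then have "(\<lambda>k. dist (pos (\<omega> (k + n))) (pos (\<omega> n))) \<longlonglongrightarrow> dist (X \<omega>) (pos (\<omega> n))"
      by (intro tendsto_intros LIMSEQ_ignore_initial_segment)
    then show ?thesis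
      by (rule LIMSEQ_le_const2) (intro exI[of _ 0] allI impI, subst add.commute[of _ n], rule tail)
  qed
  show ?thesis
  proof (intro exI[of _ "distr Q borel X"] conjI allI impI)
    show "prob_space (distr Q borel X)" using Xm by (rule prob_space_distr)
    fix n and f :: "'v \<Rightarrow> real" and \<delta>
    assume f: "f \<in> borel_measurable borel" and bf: "bounded (range f)"
      and close: "\<forall>s\<in>set_pmf (chain_law K x n). \<forall>y. dist y (pos s) \<le> (\<Sum>i. \<epsilon> (i + n)) \<longrightarrow> \<bar>f y - f (pos s)\<bar> \<le> \<delta>"
    obtain D where D: "\<And>y. norm (f y) \<le> D" using bf by (auto simp: bounded_iff)
    have i1: "integrable Q (\<lambda>\<omega>. f (X \<omega>))"
      by (rule integrable_const_bound[where B = D]) (use D f Xm in \<open>auto intro: measurable_compose\<close>)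
    have i2: "integrable Q (\<lambda>\<omega>. f (pos (\<omega> n)))"
      by (rule integrable_const_bound[where B = D]) (use D f posm in \<open>auto intro: measurable_compose\<close>)
    have "AE s in measure_pmf (chain_law K x n). s \<in> set_pmf (chain_law K x n)" by (rule AE_pmfI)
    then have inset: "AE \<omega> in Q. \<omega> n \<in> set_pmf (chain_law K x n)"
      unfolding law[symmetric] using meas[of n] by (subst (asm) AE_distr_iff) auto
    have "measure_pmf.expectation (chain_law K x n) (\<lambda>s. f (pos s)) = (\<integral>\<omega>. f (pos (\<omega> n)) \<partial>Q)"
      unfolding law[symmetric] using meas[of n] by (subst integral_distr) auto
    moreover have "integral\<^sup>L (distr Q borel X) f = (\<integral>\<omega>. f (X \<omega>) \<partial>Q)"
      using Xm f by (rule integral_distr)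
    ultimately have "\<bar>integral\<^sup>L (distr Q borel X) f - measure_pmf.expectation (chain_law K x n) (\<lambda>s. f (pos s))\<bar>
        = \<bar>\<integral>\<omega>. f (X \<omega>) - f (pos (\<omega> n)) \<partial>Q\<bar>"
      using i1 i2 by simp
    also have "\<dots> \<le> (\<integral>\<omega>. \<bar>f (X \<omega>) - f (pos (\<omega> n))\<bar> \<partial>Q)" by (rule integral_abs_bound)
    also have "\<dots> \<le> (\<integral>\<omega>. \<delta> \<partial>Q)"
    proof (rule integral_mono_AE)
      show "AE \<omega> in Q. \<bar>f (X \<omega>) - f (pos (\<omega> n))\<bar> \<le> \<delta>"
        using ae inset by eventually_elim (use close near in blast)
    qed (use i1 i2 in auto)
    finally show "\<bar>integral\<^sup>L (distr Q borel X) f - measure_pmf.expectation (chain_law K x n) (\<lambda>s. f (pos s))\<bar> \<le> \<delta>"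
      by (simp add: prob_space)
  qed simp
qed

lemma weakly_converges_unique:
  fixes m m' :: "('b::metric_space) measure"
  assumes "weakly_converges \<mu> m" "weakly_converges \<mu> m'"
  shows "m = m'"
  using assms unfolding weakly_converges_def
  by (intro finite_borel_measure_eqI) (blast intro: LIMSEQ_unique)+

lemma scale_measure_eq_density: "scale_measure r M = density M (\<lambda>_. r)"
  by (rule measure_eqI) (auto simp: emeasure_density_const)

lemma integral_scale_measure:
  assumes "f \<in> borel_measurable M" "0 \<le> r"
  shows "integral\<^sup>L (scale_measure (ennreal r) M) f = r * integral\<^sup>L M (f :: _ \<Rightarrow> real)"
  using assms by (simp add: scale_measure_eq_density integral_density)

lemma finite_scale_measure:
  assumes "finite_measure M"
  shows "finite_measure (scale_measure (ennreal r) M)"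
proof (rule finite_measureI)
  interpret finite_measure M by fact
  show "emeasure (scale_measure (ennreal r) M) (space (scale_measure (ennreal r) M)) \<noteq> \<infinity>"
    by (simp add: space_scale_measure ennreal_mult_eq_top_iff)
qed

section \<open>Sums along a word\<close>

text \<open>The sum of \<open>g b\<close> over the letters \<open>b\<close> of a word, where each letter sees the function \<open>f\<close> translated
  by the displacements \<open>s\<close> of the letters before it.  All sums over the points of a word have this
  form.\<close>

primrec displaced_sum :: "('a \<Rightarrow> ('v \<Rightarrow> real) \<Rightarrow> real) \<Rightarrow> ('a \<Rightarrow> 'v::monoid_add) \<Rightarrow> 'a list \<Rightarrow> ('v \<Rightarrow> real) \<Rightarrow> real" where
  "displaced_sum g s [] f = 0"
| "displaced_sum g s (b # w) f = g b f + displaced_sum g s w (\<lambda>y. f (y + s b))"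

lemma displaced_sum_append:
  fixes s :: "'a \<Rightarrow> 'v::ab_group_add"
  shows "displaced_sum g s (u @ v) f = displaced_sum g s u f + displaced_sum g s v (\<lambda>y. f (y + sum_list (map s u)))"
  by (induction u arbitrary: f) (auto simp: add.assoc add.commute add.left_commute)

lemma displaced_sum_altdef:
  fixes s :: "'a \<Rightarrow> 'v::ab_group_add"
  shows "displaced_sum g s w f = (\<Sum>j<length w. g (w ! j) (\<lambda>y. f (y + sum_list (map s (take j w)))))"
proof (induction w arbitrary: f)
  case (Cons b w)
  show ?case
    unfolding displaced_sum.simps Cons length_Cons by (subst sum.lessThan_Suc_shift) (simp add: add.commute add.left_commute)
qed simp

lemma sum_list_map_nth: "sum_list (map h w) = (\<Sum>j<length w. h (w ! j))"
  by (simp add: sum_list_sum_nth atLeast0LessThan)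

text \<open>The form in which translated summands are compared with contributions \<open>h\<close> that depend on the letter
  only.\<close>

lemma displaced_sum_estimate:
  fixes s :: "'a \<Rightarrow> 'v::ab_group_add" and h :: "'a \<Rightarrow> real"
  assumes "\<And>j. j < length w \<Longrightarrow> \<bar>g (w ! j) (\<lambda>y. f (y + sum_list (map s (take j w)))) - h (w ! j)\<bar> \<le> e (w ! j)"
  shows "\<bar>displaced_sum g s w f - sum_list (map h w)\<bar> \<le> sum_list (map e w)"
  unfolding displaced_sum_altdef sum_list_map_nth[of h w] sum_list_map_nth[of e w] sum_subtractf[symmetric]
  by (intro order_trans[OF sum_abs] sum_mono assms) simp

lemma sum_list_component_sum:
  fixes v :: "'b \<Rightarrow> real ^ 'c::finite"
  shows "sum_list (map (\<lambda>b. \<Sum>c\<in>UNIV. v b $ c * g c) w) = (\<Sum>c\<in>UNIV. sum_list (map v w) $ c * g c)"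
  by (induction w) (auto simp: algebra_simps sum.distrib)

lemma abelianisation_Nil [simp]: "abelianisation [] = 0"
  by (simp add: abelianisation_def vec_eq_iff)

lemma abelianisation_Cons: "abelianisation (b # w) = axis b 1 + abelianisation w"
  by (simp add: abelianisation_def vec_eq_iff axis_def)

lemma linear_rauzy_proj: "linear (rauzy_proj L R)"
  by (rule linearI) (simp_all add: rauzy_proj_def inner_add_right scaleR_diff_right scaleR_add_left)

lemma subst_word_append: "subst_word \<theta> (u @ v) = subst_word \<theta> u @ subst_word \<theta> v"
  by (simp add: subst_word_def)

lemma subst_word_Cons: "subst_word \<theta> (b # w) = \<theta> b @ subst_word \<theta> w"
  by (simp add: subst_word_def)

lemma subst_word_Nil [simp]: "subst_word \<theta> [] = []"
  by (simp add: subst_word_def)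

lemma subst_word_single: "subst_word \<theta> [b] = \<theta> b"
  by (simp add: subst_word_def)

lemma sadic_image_append: "sadic_image \<theta>s n (u @ v) = sadic_image \<theta>s n u @ sadic_image \<theta>s n v"
  by (induction n arbitrary: u v) (auto simp: subst_word_append)

lemma sadic_image_Nil [simp]: "sadic_image \<theta>s n [] = []"
  by (induction n) auto

text \<open>Grouping the letters of the image of a word by the letters that they come from.\<close>

lemma displaced_sum_subst_word:
  fixes s :: "'a \<Rightarrow> 'v::ab_group_add"
  shows "displaced_sum (\<lambda>b. displaced_sum g s (\<theta> b)) (\<lambda>b. sum_list (map s (\<theta> b))) w f = displaced_sum g s (subst_word \<theta> w) f"
  by (induction w arbitrary: f) (auto simp: subst_word_Cons displaced_sum_append)

text \<open>One step of the decomposition of Dumont and Thomas: a prefix of the image of \<open>w\<close> consists of the image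
  of a prefix of \<open>w\<close> and a prefix of the image of the next letter.\<close>

lemma prefix_of_image:
  assumes "w \<noteq> []" "N \<le> length (sadic_image \<theta>s n w)"
  shows "\<exists>j<length w. \<exists>N'\<le>length (sadic_image \<theta>s n [w ! j]).
    take N (sadic_image \<theta>s n w) = sadic_image \<theta>s n (take j w) @ take N' (sadic_image \<theta>s n [w ! j])
    \<and> N = length (sadic_image \<theta>s n (take j w)) + N'"
  using assms
proof (induction w arbitrary: N)
  case (Cons b w)
  have app: "sadic_image \<theta>s n (b # u) = sadic_image \<theta>s n [b] @ sadic_image \<theta>s n u" for u
    using sadic_image_append[of \<theta>s n "[b]" u] by simp
  show ?case
  proof (cases "N \<le> length (sadic_image \<theta>s n [b])")
    case True
    then show ?thesis by (intro exI[of _ 0]) (auto simp: app[of w])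
  next
    case False
    let ?N = "N - length (sadic_image \<theta>s n [b])"
    have "?N \<le> length (sadic_image \<theta>s n w)" using Cons.prems(2) app[of w] by simp
    moreover have "w \<noteq> []" using Cons.prems(2) False by auto
    ultimately obtain j N' where "j < length w" "N' \<le> length (sadic_image \<theta>s n [w ! j])"
      "take ?N (sadic_image \<theta>s n w) = sadic_image \<theta>s n (take j w) @ take N' (sadic_image \<theta>s n [w ! j])"
      "?N = length (sadic_image \<theta>s n (take j w)) + N'"
      using Cons.IH by blast
    then show ?thesis using False
      by (intro exI[of _ "Suc j"]) (auto simp: app[of w] app[of "take j w"] intro!: exI[of _ N'])
  qed
qed simp

text \<open>The recursive definition adds a substitution on the inside.  Peeling off the outermost one instead
  makes the remaining ones a shifted sequence, which suits induction over product measures.\<close>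

lemma sadic_image_Suc_outer:
  "sadic_image \<theta>s (Suc n) w = subst_word (\<theta>s 0) (sadic_image (\<lambda>i. \<theta>s (Suc i)) n w)"
  by (induction n arbitrary: w) auto

section \<open>Adapted sequences\<close>

lemma finite_pigeonhole:
  fixes Q :: "'a::finite \<Rightarrow> nat \<Rightarrow> bool"
  assumes "\<And>k. \<exists>c. Q c k" and mono: "\<And>c k k'. Q c k \<Longrightarrow> k' \<le> k \<Longrightarrow> Q c k'"
  shows "\<exists>c. \<forall>k. Q c k"
proof (rule ccontr)
  assume "\<not> ?thesis"
  then have "\<forall>c. \<exists>k. \<not> Q c k" by blast
  then obtain f where f: "\<And>c. \<not> Q c (f c)" by metis
  obtain c where "Q c (Max (range f))" using assms(1) by blast
  then have "Q c (f c)" by (rule mono) simp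
  then show False using f by blast
qed

text \<open>An inverse sequence of finite nonempty sets has a thread: extend, one level at a time, a letter
  from which the system can be continued to every finite depth.\<close>

lemma inverse_system_thread:
  fixes h :: "nat \<Rightarrow> 'a::finite \<Rightarrow> 'a"
  shows "\<exists>b. \<forall>n. h n (b (Suc n)) = b n"
proof -
  \<comment> \<open>The letter \<open>c\<close> at level \<open>n\<close> can be continued by \<open>k\<close> further levels.\<close>
  define ext where "ext n c k \<longleftrightarrow> (\<exists>x. x n = c \<and> (\<forall>i. n \<le> i \<and> i < n + k \<longrightarrow> h i (x (Suc i)) = x i))" for n c k
  have ext_mono: "ext n c k'" if e: "ext n c k" and k: "k' \<le> k" for n c k k'
  proof -
    obtain x where "x n = c" "\<forall>i. n \<le> i \<and> i < n + k \<longrightarrow> h i (x (Suc i)) = x i"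
      using e unfolding ext_def by (elim exE conjE)
    then show ?thesis using k unfolding ext_def by (intro exI[of _ x]) simp
  qed
  have ext_step: "\<exists>d. h n d = c \<and> ext (Suc n) d k" if e: "ext n c (Suc k)" for n c k
  proof -
    obtain x where x: "x n = c" "\<And>i. n \<le> i \<Longrightarrow> i < n + Suc k \<Longrightarrow> h i (x (Suc i)) = x i"
      using e unfolding ext_def by (elim exE conjE) simp
    have "ext (Suc n) (x (Suc n)) k"
      unfolding ext_def using x(2) by (intro exI[of _ x]) simp
    then show ?thesis using x by (intro exI[of _ "x (Suc n)"]) simp
  qed
  have ext_exists: "\<exists>x. x (n + k) = d \<and> (\<forall>i. n \<le> i \<and> i < n + k \<longrightarrow> h i (x (Suc i)) = x i)" for n k d
  proof (induction k arbitrary: d)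
    case 0
    show ?case by (intro exI[of _ "\<lambda>_. d"]) auto
  next
    case (Suc k)
    obtain x where x: "x (n + k) = h (n + k) d" "\<And>i. n \<le> i \<Longrightarrow> i < n + k \<Longrightarrow> h i (x (Suc i)) = x i"
      using Suc[of "h (n + k) d"] by (elim exE conjE) simp
    have "h i ((x(n + Suc k := d)) (Suc i)) = (x(n + Suc k := d)) i" if "n \<le> i" "i < n + Suc k" for i
    proof (cases "i = n + k")
      case True
      then show ?thesis using x(1) by simp
    next
      case False
      then have "i < n + k" using that by simp
      then show ?thesis using x(2) that by simp
    qed
    then show ?case by (intro exI[of _ "x(n + Suc k := d)"]) simp
  qed
  have "\<exists>c. \<forall>k. ext 0 c k"
  proof (rule finite_pigeonhole)
    show "\<exists>c. ext 0 c k" for k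
    proof -
      obtain x where "\<forall>i. 0 \<le> i \<and> i < 0 + k \<longrightarrow> h i (x (Suc i)) = x i"
        using ext_exists[of 0 k undefined] by (elim exE conjE)
      then have "ext 0 (x 0) k" unfolding ext_def by (intro exI[of _ x] conjI refl)
      then show ?thesis ..
    qed
  qed (rule ext_mono)
  moreover have "\<exists>d. (\<forall>k. ext (Suc n) d k) \<and> h n d = c" if "\<forall>k. ext n c k" for n c
  proof -
    have "\<exists>d. \<forall>k. h n d = c \<and> ext (Suc n) d k"
      by (rule finite_pigeonhole) (use that ext_step ext_mono in blast)+
    then show ?thesis by blast
  qed
  ultimately obtain b where "\<forall>n. (\<forall>k. ext n (b n) k) \<and> h n (b (Suc n)) = b n"
    using dependent_nat_choice[of "\<lambda>n c. \<forall>k. ext n c k" "\<lambda>n c d. h n d = c"] by blast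
  then show ?thesis by blast
qed

lemma adapted_exists: "\<exists>b. adapted \<theta>s (b :: nat \<Rightarrow> 'a::finite)"
  using inverse_system_thread[of "\<lambda>n c. hd (\<theta>s (Suc n) c)"] by (simp add: adapted_def)

section \<open>Masses and displacements of substituted letters\<close>

text \<open>\<open>A\<close> is the common matrix, over the reals.  The assumption \<open>contraction\<close> condenses what the Galois
  conjugates of a Pisot number contribute to the proof.\<close>

locale substitution_family =
  fixes \<Theta> :: "('a::finite) subst set" and A :: "real ^ 'a ^ 'a" and lam :: real and L R :: "real ^ 'a"
  assumes finite_family: "finite \<Theta>" and family_nonempty: "\<Theta> \<noteq> {}"
    and image_nonempty: "\<theta> \<in> \<Theta> \<Longrightarrow> \<theta> b \<noteq> []"
    and abelianisation_image: "\<theta> \<in> \<Theta> \<Longrightarrow> abelianisation (\<theta> b) = A *v axis b 1"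
    and right_eigenvector: "A *v R = lam *\<^sub>R R"
    and left_eigenvector: "L v* A = lam *\<^sub>R L"
    and R_pos: "0 < R $ b" and L_pos: "0 < L $ b"
    and R_sum: "(\<Sum>b\<in>UNIV. R $ b) = 1" and L_R: "L \<bullet> R = 1"
    and lam_gt_1: "1 < lam"
    and contraction: "L \<bullet> x = 0 \<Longrightarrow> summable (\<lambda>k. norm (((*v) A ^^ k) x))"
begin

abbreviation proj :: "real ^ 'a \<Rightarrow> real ^ 'a" where "proj \<equiv> rauzy_proj L R"

text \<open>The displacement in the hyperplane that is caused by an \<open>n\<close>-fold image of the letter \<open>b\<close>.\<close>

definition shift :: "nat \<Rightarrow> 'a \<Rightarrow> real ^ 'a" where
  "shift n b = ((*v) A ^^ n) (proj (axis b 1))"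

text \<open>The length of every \<open>n\<close>-fold image of the letter \<open>b\<close>.\<close>

definition mass :: "nat \<Rightarrow> 'a \<Rightarrow> real" where
  "mass n b = (\<Sum>i\<in>UNIV. ((*v) A ^^ n) (axis b 1) $ i)"

abbreviation word_shift :: "nat \<Rightarrow> 'a list \<Rightarrow> real ^ 'a" where
  "word_shift n w \<equiv> sum_list (map (shift n) w)"

abbreviation word_mass :: "nat \<Rightarrow> 'a list \<Rightarrow> real" where
  "word_mass n w \<equiv> sum_list (map (mass n) w)"

lemma linear_power: "linear ((*v) A ^^ n)"
proof (induction n)
  case (Suc n)
  then have "linear ((*v) A \<circ> ((*v) A ^^ n))"
    by (intro linear_compose matrix_vector_mul_linear)
  then show ?case by (simp add: comp_def)
qed (simp add: linear_id[unfolded id_def] linear_iff)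

lemma power_zero [simp]: "((*v) A ^^ n) 0 = 0"
  by (induction n) auto

lemma power_add: "((*v) A ^^ n) (x + y) = ((*v) A ^^ n) x + ((*v) A ^^ n) y"
  using linear_power by (rule linear_add)

lemma power_word:
  "((*v) A ^^ n) (abelianisation w) = sum_list (map (\<lambda>b. ((*v) A ^^ n) (axis b 1)) w)"
  by (induction w) (auto simp: abelianisation_Cons power_add)

lemma proj_abelianisation_power: "((*v) A ^^ n) (proj (abelianisation w)) = word_shift n w"
  by (induction w)
    (auto simp: abelianisation_Cons power_add linear_add[OF linear_rauzy_proj] linear_0[OF linear_rauzy_proj] shift_def)

lemma proj_abelianisation: "proj (abelianisation w) = word_shift 0 w"
  using proj_abelianisation_power[of 0 w] by simp

lemma proj_mult: "proj (A *v x) = A *v proj x"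
proof -
  have "L \<bullet> (A *v x) = lam * (L \<bullet> x)"
    by (simp add: dot_lmul_matrix[symmetric] left_eigenvector)
  then show ?thesis
    by (simp add: rauzy_proj_def matrix_vector_mult_diff_distrib matrix_vector_mult_scaleR right_eigenvector mult.commute)
qed

lemma proj_power: "proj (((*v) A ^^ n) x) = ((*v) A ^^ n) (proj x)"
  by (induction n) (auto simp: proj_mult)

text \<open>An \<open>n\<close>-fold image of \<open>\<theta> b\<close> causes the same displacement for every \<open>\<theta>\<close> in the family.  On this
  the comparison of S-adic and random words rests.\<close>

lemma word_shift_image: "\<theta> \<in> \<Theta> \<Longrightarrow> word_shift n (\<theta> b) = shift (Suc n) b"
  by (simp add: proj_abelianisation_power[symmetric] abelianisation_image proj_mult shift_def funpow_swap1)

lemma word_mass_power: "word_mass n w = (\<Sum>i\<in>UNIV. ((*v) A ^^ n) (abelianisation w) $ i)"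
  unfolding power_word mass_def by (induction w) (auto simp: sum.distrib)

lemma word_mass_image: "\<theta> \<in> \<Theta> \<Longrightarrow> word_mass n (\<theta> b) = mass (Suc n) b"
  unfolding word_mass_power by (simp add: abelianisation_image mass_def funpow_swap1)

lemma mass_0 [simp]: "mass 0 b = 1"
  by (simp add: mass_def axis_def)

lemma inner_L_proj: "L \<bullet> proj x = 0"
  by (simp add: rauzy_proj_def inner_diff_right L_R)

lemma power_R: "((*v) A ^^ n) R = lam ^ n *\<^sub>R R"
  by (induction n) (auto simp: matrix_vector_mult_scaleR right_eigenvector mult.commute)

lemma lam_pos: "0 < lam" using lam_gt_1 by simp

lemma vec_axis_sum: "x = (\<Sum>c\<in>UNIV. (x $ c) *\<^sub>R axis c (1::real))" for x :: "real ^ 'a"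
  by (simp add: vec_eq_iff axis_def if_distrib[of "\<lambda>x. _ * x"] cong: if_cong)

lemma sum_mass: "(\<Sum>c\<in>UNIV. x $ c * mass n c) = (\<Sum>i\<in>UNIV. ((*v) A ^^ n) x $ i)"
proof -
  have "((*v) A ^^ n) x = (\<Sum>c\<in>UNIV. (x $ c) *\<^sub>R ((*v) A ^^ n) (axis c 1))"
    by (subst vec_axis_sum[of x]) (simp only: linear_sum[OF linear_power] linear_scale[OF linear_power])
  then have "(\<Sum>i\<in>UNIV. ((*v) A ^^ n) x $ i) = (\<Sum>i\<in>UNIV. \<Sum>c\<in>UNIV. x $ c * ((*v) A ^^ n) (axis c 1) $ i)"
    by simp
  also have "\<dots> = (\<Sum>c\<in>UNIV. x $ c * mass n c)"
    by (subst sum.swap) (simp add: mass_def sum_distrib_left)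
  finally show ?thesis by simp
qed

lemma sum_R_mass: "(\<Sum>c\<in>UNIV. R $ c * mass n c) = lam ^ n"
  by (simp add: sum_mass power_R sum_distrib_left[symmetric] R_sum)

definition step_size :: "nat \<Rightarrow> real" where
  "step_size n = (\<Sum>b\<in>UNIV. norm (shift n b))"

text \<open>Up to the factor of a word length, a bound for the total displacement that levels from \<open>n\<close> on can
  cause.\<close>

definition tail :: "nat \<Rightarrow> real" where
  "tail n = (\<Sum>i. step_size (i + n))"

lemma step_size_nonneg: "0 \<le> step_size n"
  by (simp add: step_size_def sum_nonneg)

lemma norm_shift_le: "norm (shift n b) \<le> step_size n"
  unfolding step_size_def by (rule member_le_sum) auto

lemma summable_step_size: "summable step_size"
  unfolding step_size_def shift_def by (intro summable_sum contraction inner_L_proj)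

lemma tail_Suc: "tail n = step_size n + tail (Suc n)"
proof -
  have "summable (\<lambda>i. step_size (i + n))" using summable_step_size by (simp add: summable_iff_shift)
  from suminf_split_head[OF this] show ?thesis by (simp add: tail_def)
qed

lemma tail_nonneg: "0 \<le> tail n"
  unfolding tail_def using summable_step_size
  by (intro suminf_nonneg) (auto simp: step_size_nonneg summable_iff_shift)

lemma step_size_le_tail: "step_size n \<le> tail n"
  using tail_Suc[of n] tail_nonneg[of "Suc n"] by simp

lemma tail_0: "tail 0 = sum step_size {..<n} + tail n"
proof (induction n)
  case (Suc n)
  then show ?case using tail_Suc[of n] by simp
qed simp

lemma tail_tendsto_0: "tail \<longlonglongrightarrow> 0"
  unfolding tail_def using suminf_exist_split2[OF summable_step_size] .

lemma norm_word_shift_le: "norm (word_shift n w) \<le> real (length w) * step_size n"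
proof (induction w)
  case (Cons b w)
  have "norm (word_shift n (b # w)) \<le> norm (shift n b) + norm (word_shift n w)"
    by (simp add: norm_triangle_ineq)
  then show ?case using Cons norm_shift_le[of n b] by (simp add: algebra_simps)
qed simp

lemma norm_prefix_shift_le:
  assumes "real (length w) \<le> K"
  shows "norm (word_shift n (take j w)) \<le> K * step_size n"
proof -
  have "real (length (take j w)) * step_size n \<le> K * step_size n"
    using assms by (intro mult_right_mono step_size_nonneg) simp
  then show ?thesis using norm_word_shift_le[of n "take j w"] by linarith
qed

definition length_bound :: real where
  "length_bound = (\<Sum>\<theta>\<in>\<Theta>. \<Sum>b\<in>UNIV. real (length (\<theta> b)))"

lemma length_le_bound: "\<theta> \<in> \<Theta> \<Longrightarrow> real (length (\<theta> b)) \<le> length_bound"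
  unfolding length_bound_def
  by (rule order_trans[OF member_le_sum[of b UNIV "\<lambda>b. real (length (\<theta> b))"]
        member_le_sum[of \<theta> \<Theta> "\<lambda>\<theta>. \<Sum>b\<in>UNIV. real (length (\<theta> b))"]])
     (auto simp: finite_family sum_nonneg)

lemma length_bound_nonneg: "0 \<le> length_bound"
  by (simp add: length_bound_def sum_nonneg)

lemma word_mass_0: "word_mass 0 w = real (length w)"
  by (induction w) auto

text \<open>Split the unit vector of \<open>b\<close> along \<open>R\<close> and the hyperplane: the first part grows like \<open>lam ^ n\<close>, and the
  entries of the second are at most \<open>tail 0\<close> in modulus.\<close>

lemma mass_lower_bound: "L $ b * lam ^ n - real CARD('a) * tail 0 \<le> mass n b"
proof -
  have e: "axis b 1 = (L $ b) *\<^sub>R R + proj (axis b 1)"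
    by (simp add: rauzy_proj_def inner_axis)
  have "((*v) A ^^ n) ((L $ b) *\<^sub>R R + proj (axis b 1)) = (L $ b * lam ^ n) *\<^sub>R R + shift n b"
    by (simp add: power_add linear_scale[OF linear_power] power_R shift_def)
  then have "((*v) A ^^ n) (axis b 1) = (L $ b * lam ^ n) *\<^sub>R R + shift n b"
    unfolding e[symmetric] .
  then have "mass n b = L $ b * lam ^ n + (\<Sum>i\<in>UNIV. shift n b $ i)"
    by (simp add: mass_def sum.distrib sum_distrib_left[symmetric] R_sum)
  moreover have "- (real CARD('a) * tail 0) \<le> (\<Sum>i\<in>UNIV. shift n b $ i)"
  proof -
    have t: "step_size n \<le> tail 0"
      using step_size_le_tail[of n] tail_0[of n] sum_nonneg[of "{..<n}" step_size] step_size_nonneg by auto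
    have "(\<Sum>i\<in>(UNIV :: 'a set). - tail 0) \<le> (\<Sum>i\<in>UNIV. shift n b $ i)"
    proof (rule sum_mono)
      fix i
      have "\<bar>shift n b $ i\<bar> \<le> tail 0"
        using component_le_norm_cart[of "shift n b" i] norm_shift_le[of n b] t by linarith
      then show "- tail 0 \<le> shift n b $ i" by linarith
    qed
    then show ?thesis by simp
  qed
  ultimately show ?thesis by linarith
qed

lemma mass_at_top: "filterlim (\<lambda>n. mass n (b n)) at_top sequentially"
proof -
  \<comment> \<open>The letter may change with \<open>n\<close>, so the lower bound has to be uniform in it.\<close>
  define c where "c = Min (range (\<lambda>b. L $ b))"
  have c: "0 < c" "\<And>b. c \<le> L $ b" unfolding c_def using L_pos by auto
  have "filterlim (\<lambda>n. - (real CARD('a) * tail 0) + c * lam ^ n) at_top sequentially"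
    by (intro filterlim_tendsto_add_at_top[OF tendsto_const] filterlim_tendsto_pos_mult_at_top[OF tendsto_const c(1)]
        filterlim_at_infinity_imp_filterlim_at_top[OF filterlim_realpow_sequentially_gt1])
      (use lam_gt_1 in auto)
  then show ?thesis
  proof (rule filterlim_at_top_mono)
    have "c * lam ^ n \<le> L $ b n * lam ^ n" for n
      using c(2) lam_pos by (intro mult_right_mono) auto
    then show "\<forall>\<^sub>F n in sequentially. - (real CARD('a) * tail 0) + c * lam ^ n \<le> mass n (b n)"
      using mass_lower_bound by (intro always_eventually allI) (smt (verit, best))
  qed
qed

section \<open>Supertiles and patches\<close>

text \<open>\<open>q n\<close> is the distribution of the substitution that is applied at level \<open>n\<close>.\<close>

definition stochastic :: "(nat \<Rightarrow> 'a subst \<Rightarrow> real) \<Rightarrow> bool" where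
  "stochastic q \<longleftrightarrow> (\<forall>n. (\<forall>\<theta>\<in>\<Theta>. 0 \<le> q n \<theta>) \<and> (\<Sum>\<theta>\<in>\<Theta>. q n \<theta>) = 1)"

text \<open>The expected sum of \<open>f\<close> over the points of type \<open>a\<close> in the image of \<open>b\<close> under the substitutions of the
  levels \<open>n - 1\<close> down to \<open>0\<close>.  The function \<open>f\<close> is an argument that is translated, so that the recursion
  needs no measures.  The definition does not say whether the draws at different positions are
  independent, as the expectation does not depend on it.\<close>

primrec supertile :: "(nat \<Rightarrow> 'a subst \<Rightarrow> real) \<Rightarrow> 'a \<Rightarrow> nat \<Rightarrow> 'a \<Rightarrow> (real ^ 'a \<Rightarrow> real) \<Rightarrow> real" where
  "supertile q a 0 = (\<lambda>b f. if b = a then f 0 else 0)"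
| "supertile q a (Suc n) = (\<lambda>b f. \<Sum>\<theta>\<in>\<Theta>. q n \<theta> * displaced_sum (supertile q a n) (shift n) (\<theta> b) f)"

lemma stochastic_estimate:
  assumes q: "stochastic q" and "\<And>\<theta>. \<theta> \<in> \<Theta> \<Longrightarrow> \<bar>X \<theta> - y\<bar> \<le> e"
  shows "\<bar>(\<Sum>\<theta>\<in>\<Theta>. q n \<theta> * X \<theta>) - y\<bar> \<le> (e :: real)"
proof -
  have q0: "0 \<le> q n \<theta>" if "\<theta> \<in> \<Theta>" for \<theta> using q that by (simp add: stochastic_def)
  have q1: "(\<Sum>\<theta>\<in>\<Theta>. q n \<theta> * c) = c" for c
    using q by (simp add: stochastic_def sum_distrib_right[symmetric])
  have "(\<Sum>\<theta>\<in>\<Theta>. q n \<theta> * X \<theta>) - y = (\<Sum>\<theta>\<in>\<Theta>. q n \<theta> * (X \<theta> - y))"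
    by (simp add: right_diff_distrib sum_subtractf q1)
  also have "\<bar>\<dots>\<bar> \<le> (\<Sum>\<theta>\<in>\<Theta>. \<bar>q n \<theta> * (X \<theta> - y)\<bar>)" by (rule sum_abs)
  also have "\<dots> \<le> (\<Sum>\<theta>\<in>\<Theta>. q n \<theta> * e)"
    using assms(2) q0 by (intro sum_mono) (auto simp: abs_mult intro!: mult_left_mono)
  finally show ?thesis by (simp add: q1)
qed

lemma supertile_linear:
  "supertile q a n b (\<lambda>y. c * f y + h y) = c * supertile q a n b f + supertile q a n b h"
proof (induction n arbitrary: b f h)
  case (Suc n)
  have "displaced_sum (supertile q a n) (shift n) w (\<lambda>y. c * f y + h y)
      = c * displaced_sum (supertile q a n) (shift n) w f + displaced_sum (supertile q a n) (shift n) w h" for w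
    by (simp add: displaced_sum_altdef Suc sum.distrib sum_distrib_left)
  then show ?case by (simp add: algebra_simps sum.distrib sum_distrib_left)
qed simp

lemma supertile_diff: "supertile q a n b (\<lambda>y. f y - h y) = supertile q a n b f - supertile q a n b h"
  using supertile_linear[of q a n b "- 1" h f] by simp

lemma supertile_zero: "supertile q a n b (\<lambda>y. 0) = 0"
  using supertile_linear[of q a n b "- 1" "\<lambda>_. 0" "\<lambda>_. 0"] by simp

lemma supertile_sum:
  "supertile q a n b (\<lambda>y. \<Sum>i\<in>I. c i * f i y) = (\<Sum>i\<in>I. c i * supertile q a n b (f i))"
  by (induction I rule: infinite_finite_induct) (auto simp: supertile_zero supertile_linear)

text \<open>All points of a supertile of level \<open>n\<close> are at distance at most \<open>K * sum step_size {..<n}\<close> from the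
  origin, so only the values of \<open>f\<close> on this ball count.\<close>

lemma supertile_bound:
  fixes f :: "real ^ 'a \<Rightarrow> real"
  assumes q: "stochastic q" and K: "length_bound \<le> K"
    and f: "\<And>y. norm y \<le> K * sum step_size {..<n} \<Longrightarrow> \<bar>f y\<bar> \<le> D"
  shows "\<bar>supertile q a n b f\<bar> \<le> D * mass n b"
  using f
proof (induction n arbitrary: b f)
  case 0
  then have "\<bar>f 0\<bar> \<le> D" by simp
  then show ?case using abs_ge_zero order_trans by fastforce
next
  case (Suc n)
  have "\<bar>displaced_sum (supertile q a n) (shift n) (\<theta> b) f - 0\<bar> \<le> D * mass (Suc n) b" if \<theta>: "\<theta> \<in> \<Theta>" for \<theta>
  proof -
    have "\<bar>displaced_sum (supertile q a n) (shift n) (\<theta> b) f - sum_list (map (\<lambda>_. 0) (\<theta> b))\<bar>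
        \<le> sum_list (map (\<lambda>c. D * mass n c) (\<theta> b))"
    proof (rule displaced_sum_estimate)
      fix j
      let ?s = "word_shift n (take j (\<theta> b))"
      have s: "norm ?s \<le> K * step_size n"
        using length_le_bound[OF \<theta>, of b] K by (intro norm_prefix_shift_le) simp
      have "\<bar>supertile q a n (\<theta> b ! j) (\<lambda>y. f (y + ?s))\<bar> \<le> D * mass n (\<theta> b ! j)"
      proof (rule Suc.IH)
        fix y :: "real ^ 'a"
        assume "norm y \<le> K * sum step_size {..<n}"
        then have "norm (y + ?s) \<le> K * sum step_size {..<Suc n}"
          using s norm_triangle_ineq[of y ?s] by (simp add: distrib_left)
        then show "\<bar>f (y + ?s)\<bar> \<le> D" by (rule Suc.prems)
      qed
      then show "\<bar>supertile q a n (\<theta> b ! j) (\<lambda>y. f (y + ?s)) - 0\<bar> \<le> D * mass n (\<theta> b ! j)" by simp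
    qed
    then show ?thesis by (simp add: sum_list_const_mult word_mass_image[OF \<theta>])
  qed
  from stochastic_estimate[OF q this, where n = n] show ?case by simp
qed

lemma mass_nonneg: "0 \<le> mass n b"
proof (induction n arbitrary: b)
  case (Suc n)
  obtain \<theta> where \<theta>: "\<theta> \<in> \<Theta>" using family_nonempty by blast
  show ?case unfolding word_mass_image[OF \<theta>, symmetric] using Suc by (intro sum_list_nonneg) auto
qed simp

text \<open>The ball contains the points of the supertiles of level \<open>n\<close>, and \<open>s\<close> ranges over the translations that
  the levels from \<open>n\<close> on can cause.\<close>

definition oscillates_at_most :: "real \<Rightarrow> nat \<Rightarrow> real \<Rightarrow> (real ^ 'a \<Rightarrow> real) \<Rightarrow> bool" where
  "oscillates_at_most K n \<epsilon> f \<longleftrightarrow>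
     (\<forall>y s. norm y \<le> K * sum step_size {..<n} \<and> norm s \<le> K * tail n \<longrightarrow> \<bar>f (y + s) - f y\<bar> \<le> \<epsilon>)"

text \<open>For all \<open>n\<close> the points \<open>y\<close> and \<open>y + s\<close> stay in one compact ball, on which \<open>f\<close> is uniformly continuous.\<close>

lemma eventually_oscillates_at_most:
  assumes f: "continuous_on UNIV f" and "0 < \<epsilon>" and K: "0 \<le> K"
  shows "\<forall>\<^sub>F n in sequentially. oscillates_at_most K n \<epsilon> f"
proof -
  let ?B = "cball (0 :: real ^ 'a) (K * tail 0)"
  have "uniformly_continuous_on ?B f"
    by (intro compact_uniformly_continuous continuous_on_subset[OF f]) auto
  then obtain d where d: "0 < d" "\<And>y y'. y \<in> ?B \<Longrightarrow> y' \<in> ?B \<Longrightarrow> dist y' y < d \<Longrightarrow> dist (f y') (f y) < \<epsilon>"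
    using \<open>0 < \<epsilon>\<close> by (rule uniformly_continuous_onE) auto
  have "(\<lambda>n. K * tail n) \<longlonglongrightarrow> K * 0" by (intro tendsto_intros tail_tendsto_0)
  then have "\<forall>\<^sub>F n in sequentially. K * tail n < d" using d(1) by (intro order_tendstoD) auto
  then show ?thesis
  proof eventually_elim
    case (elim n)
    have "\<bar>f (y + s) - f y\<bar> \<le> \<epsilon>" if y: "norm y \<le> K * sum step_size {..<n}" and s: "norm s \<le> K * tail n" for y s
    proof -
      have "K * tail 0 = K * sum step_size {..<n} + K * tail n"
        by (simp add: tail_0[of n] distrib_left)
      moreover have "0 \<le> K * tail n" using K tail_nonneg by simp
      ultimately have "y \<in> ?B" "y + s \<in> ?B"
        using y s norm_triangle_ineq[of y s] by auto
      moreover have "dist (y + s) y < d" using s elim by (simp add: dist_norm)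
      ultimately show ?thesis using d(2)[of y "y + s"] by (simp add: dist_real_def)
    qed
    then show ?case by (simp add: oscillates_at_most_def)
  qed
qed

text \<open>The induction step of \<open>supertile_decomposition\<close>, for a whole word.  A translation by at most
  \<open>K * tail (Suc n + k)\<close> and a displacement of level \<open>n + k\<close> add up to at most \<open>K * tail (n + k)\<close>, so the
  permitted translation shrinks exactly by what the step uses up.\<close>

lemma patch_decomposition_step:
  assumes K: "length_bound \<le> K" and w: "real (length w) \<le> K"
    and s: "norm s \<le> K * tail (Suc n + k)"
    and letters: "\<And>b s. norm s \<le> K * tail (n + k) \<Longrightarrow>
      \<bar>supertile q a (n + k) b (\<lambda>y. f (y + s))
        - (\<Sum>c\<in>UNIV. ((*v) A ^^ k) (axis b 1) $ c * supertile q a n c f)\<bar> \<le> \<epsilon> * mass (n + k) b"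
  shows "\<bar>displaced_sum (supertile q a (n + k)) (shift (n + k)) w (\<lambda>y. f (y + s))
      - (\<Sum>c\<in>UNIV. ((*v) A ^^ k) (abelianisation w) $ c * supertile q a n c f)\<bar> \<le> \<epsilon> * word_mass (n + k) w"
proof -
  let ?h = "\<lambda>b. \<Sum>c\<in>UNIV. ((*v) A ^^ k) (axis b 1) $ c * supertile q a n c f"
  have "\<bar>displaced_sum (supertile q a (n + k)) (shift (n + k)) w (\<lambda>y. f (y + s)) - sum_list (map ?h w)\<bar>
      \<le> sum_list (map (\<lambda>c. \<epsilon> * mass (n + k) c) w)"
  proof (rule displaced_sum_estimate)
    fix j
    let ?s = "word_shift (n + k) (take j w)"
    have "norm ?s \<le> K * step_size (n + k)"
      using w by (rule norm_prefix_shift_le)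
    then have "norm (?s + s) \<le> K * tail (n + k)"
      using s norm_triangle_ineq[of ?s s] by (simp add: tail_Suc[of "n + k"] distrib_left)
    from letters[OF this, of "w ! j"]
    show "\<bar>supertile q a (n + k) (w ! j) (\<lambda>y. f (y + ?s + s)) - ?h (w ! j)\<bar> \<le> \<epsilon> * mass (n + k) (w ! j)"
      by (simp add: add.assoc)
  qed
  then show ?thesis
    by (simp add: sum_list_const_mult sum_list_component_sum power_word)
qed

text \<open>A supertile of level \<open>n + k\<close> consists of supertiles of level \<open>n\<close>, whose numbers are the entries of the
  \<open>k\<close>-th power of the matrix; forgetting their translations costs \<open>\<epsilon>\<close> per point.\<close>

lemma supertile_decomposition:
  assumes q: "stochastic q" and K: "length_bound \<le> K" and osc: "oscillates_at_most K n \<epsilon> f"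
    and s: "norm s \<le> K * tail (n + k)"
  shows "\<bar>supertile q a (n + k) b (\<lambda>y. f (y + s))
      - (\<Sum>c\<in>UNIV. ((*v) A ^^ k) (axis b 1) $ c * supertile q a n c f)\<bar> \<le> \<epsilon> * mass (n + k) b"
  using s
proof (induction k arbitrary: b s)
  case 0
  have "\<bar>supertile q a n b (\<lambda>y. f (y + s) - f y)\<bar> \<le> \<epsilon> * mass n b"
    using osc 0 by (intro supertile_bound[OF q K]) (auto simp: oscillates_at_most_def)
  then show ?case
    by (simp add: supertile_diff axis_def if_distrib[of "\<lambda>x. x * _"] cong: if_cong)
next
  case (Suc k)
  have "\<bar>displaced_sum (supertile q a (n + k)) (shift (n + k)) (\<theta> b) (\<lambda>y. f (y + s))
      - (\<Sum>c\<in>UNIV. ((*v) A ^^ Suc k) (axis b 1) $ c * supertile q a n c f)\<bar> \<le> \<epsilon> * mass (Suc (n + k)) b"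
    if \<theta>: "\<theta> \<in> \<Theta>" for \<theta>
  proof -
    have "((*v) A ^^ k) (abelianisation (\<theta> b)) = ((*v) A ^^ Suc k) (axis b 1)"
      by (simp add: abelianisation_image[OF \<theta>] funpow_swap1)
    moreover have "norm s \<le> K * tail (Suc n + k)" using Suc.prems by simp
    from patch_decomposition_step[OF K order_trans[OF length_le_bound[OF \<theta>] K] this Suc.IH, of b]
    have "\<bar>displaced_sum (supertile q a (n + k)) (shift (n + k)) (\<theta> b) (\<lambda>y. f (y + s))
      - (\<Sum>c\<in>UNIV. ((*v) A ^^ k) (abelianisation (\<theta> b)) $ c * supertile q a n c f)\<bar> \<le> \<epsilon> * word_mass (n + k) (\<theta> b)"
      by simp
    ultimately show ?thesis by (simp only: word_mass_image[OF \<theta>])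
  qed
  from stochastic_estimate[OF q this, where n = "n + k"] show ?case by simp
qed

lemma patch_decomposition:
  assumes "stochastic q" and K: "length_bound \<le> K" and "oscillates_at_most K n \<epsilon> f"
    and "real (length w) \<le> K" and "norm s \<le> K * tail (Suc (n + k))"
  shows "\<bar>displaced_sum (supertile q a (n + k)) (shift (n + k)) w (\<lambda>y. f (y + s))
      - (\<Sum>c\<in>UNIV. ((*v) A ^^ k) (abelianisation w) $ c * supertile q a n c f)\<bar> \<le> \<epsilon> * word_mass (n + k) w"
  using assms by (intro patch_decomposition_step[OF K] supertile_decomposition) auto

text \<open>The integral of \<open>f\<close> against the measure of the word \<open>w\<close> (see \<open>integral_word_measure\<close>).\<close>

definition visits :: "'a \<Rightarrow> 'a list \<Rightarrow> (real ^ 'a \<Rightarrow> real) \<Rightarrow> real" where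
  "visits a = displaced_sum (\<lambda>b f. if b = a then f 0 else 0) (shift 0)"

abbreviation patch :: "(nat \<Rightarrow> 'a subst \<Rightarrow> real) \<Rightarrow> 'a \<Rightarrow> nat \<Rightarrow> 'a list \<Rightarrow> (real ^ 'a \<Rightarrow> real) \<Rightarrow> real" where
  "patch q a n \<equiv> displaced_sum (supertile q a n) (shift n)"

lemma visits_eq_patch: "visits a = patch q a 0"
  by (simp add: visits_def)

lemma visits_append: "visits a (u @ v) f = visits a u f + visits a v (\<lambda>y. f (y + word_shift 0 u))"
  by (simp add: visits_def displaced_sum_append)

lemma visits_bound:
  assumes "\<And>y. \<bar>f y\<bar> \<le> D"
  shows "\<bar>visits a w f\<bar> \<le> D * real (length w)"
proof -
  have "0 \<le> D" using assms[of 0] by linarith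
  have "\<bar>visits a w f - sum_list (map (\<lambda>_. 0) w)\<bar> \<le> sum_list (map (\<lambda>_. D) w)"
    unfolding visits_def by (rule displaced_sum_estimate) (use assms \<open>0 \<le> D\<close> in auto)
  then show ?thesis by (simp add: sum_list_triv mult.commute)
qed

lemma patch_bound:
  assumes q: "stochastic q" and f: "\<And>y. \<bar>f y\<bar> \<le> D"
  shows "\<bar>patch q a n w f\<bar> \<le> D * word_mass n w"
proof -
  have "\<bar>patch q a n w f - sum_list (map (\<lambda>_. 0) w)\<bar> \<le> sum_list (map (\<lambda>b. D * mass n b) w)"
    by (rule displaced_sum_estimate) (use supertile_bound[OF q order_refl] f in simp)
  then show ?thesis by (simp add: sum_list_const_mult)
qed

section \<open>Averages over long words\<close>

text \<open>\<open>Z N\<close> is a sum over \<open>len N\<close> points which, up to errors that are small compared to \<open>len N\<close>, consists of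
  \<open>e $ c\<close> supertiles of level \<open>n\<close> and type \<open>c\<close>.  A bounded projection of \<open>e\<close> means that \<open>e\<close> is a multiple
  of \<open>R\<close> up to a bounded error.  Both \<open>Z N\<close> and \<open>len N\<close> are then proportional to this multiple, which
  cancels in the quotient.\<close>

lemma average_tendsto:
  assumes lim: "(\<lambda>n. (\<Sum>b\<in>UNIV. R $ b * supertile q a n b f) / lam ^ n) \<longlonglongrightarrow> l"
    and len: "filterlim len at_top sequentially"
    and decomp: "\<And>\<epsilon>. 0 < \<epsilon> \<Longrightarrow> \<forall>\<^sub>F n in sequentially. \<exists>C. \<forall>\<^sub>F N in sequentially. \<exists>e. norm (proj e) \<le> C
      \<and> \<bar>Z N - (\<Sum>c\<in>UNIV. e $ c * supertile q a n c f)\<bar> \<le> \<epsilon> * len N + C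
      \<and> \<bar>len N - (\<Sum>c\<in>UNIV. e $ c * mass n c)\<bar> \<le> C"
  shows "(\<lambda>N. Z N / len N) \<longlonglongrightarrow> l"
proof (rule tendstoI)
  fix \<epsilon>0 :: real assume "0 < \<epsilon>0"
  \<comment> \<open>One third for the level \<open>n\<close>, one for forgetting the translations, one for the bounded errors.\<close>
  define \<epsilon> where "\<epsilon> = \<epsilon>0 / 3"
  have \<epsilon>: "0 < \<epsilon>" using \<open>0 < \<epsilon>0\<close> by (simp add: \<epsilon>_def)
  let ?A = "\<lambda>n. \<Sum>b\<in>UNIV. R $ b * supertile q a n b f"
  obtain n C where n: "\<bar>?A n / lam ^ n - l\<bar> < \<epsilon>"
    and ev: "\<forall>\<^sub>F N in sequentially. \<exists>e. norm (proj e) \<le> C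
      \<and> \<bar>Z N - (\<Sum>c\<in>UNIV. e $ c * supertile q a n c f)\<bar> \<le> \<epsilon> * len N + C
      \<and> \<bar>len N - (\<Sum>c\<in>UNIV. e $ c * mass n c)\<bar> \<le> C"
    using eventually_happens[OF eventually_conj[OF tendstoD[OF lim \<epsilon>] decomp[OF \<epsilon>]]]
    by (auto simp: dist_real_def)
  define \<alpha> where "\<alpha> = ?A n / lam ^ n"
  define S where "S = (\<Sum>c\<in>UNIV. \<bar>supertile q a n c f\<bar>)"
  define S' where "S' = (\<Sum>c\<in>UNIV. \<bar>mass n c\<bar>)"
  define C' where "C' = (C + C * S) + \<bar>\<alpha>\<bar> * (C + C * S')"
  have "\<forall>\<^sub>F N in sequentially. C' / \<epsilon> < len N \<and> 0 < len N"
    using len by (auto simp: filterlim_at_top_dense intro: eventually_conj)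
  with ev show "\<forall>\<^sub>F N in sequentially. dist (Z N / len N) l < \<epsilon>0"
  proof eventually_elim
    case (elim N)
    then obtain e where e: "norm (proj e) \<le> C"
      "\<bar>Z N - (\<Sum>c\<in>UNIV. e $ c * supertile q a n c f)\<bar> \<le> \<epsilon> * len N + C"
      "\<bar>len N - (\<Sum>c\<in>UNIV. e $ c * mass n c)\<bar> \<le> C" by blast
    \<comment> \<open>\<open>e = t *\<^sub>R R + proj e\<close>\<close>
    define t where "t = L \<bullet> e"
    have split: "(\<Sum>c\<in>UNIV. e $ c * X c) = t * (\<Sum>c\<in>UNIV. R $ c * X c) + (\<Sum>c\<in>UNIV. proj e $ c * X c)" for X
      by (simp add: rauzy_proj_def t_def sum_distrib_left sum.distrib[symmetric] algebra_simps)
    have small: "\<bar>\<Sum>c\<in>UNIV. proj e $ c * X c\<bar> \<le> C * (\<Sum>c\<in>UNIV. \<bar>X c\<bar>)" for X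
    proof -
      have "\<bar>\<Sum>c\<in>UNIV. proj e $ c * X c\<bar> \<le> (\<Sum>c\<in>UNIV. \<bar>proj e $ c * X c\<bar>)" by (rule sum_abs)
      also have "\<dots> \<le> (\<Sum>c\<in>UNIV. C * \<bar>X c\<bar>)"
        using e(1) component_le_norm_cart[of "proj e"]
        by (intro sum_mono) (auto simp: abs_mult intro!: mult_right_mono intro: order_trans)
      finally show ?thesis by (simp add: sum_distrib_left)
    qed
    have Z: "\<bar>Z N - t * ?A n\<bar> \<le> \<epsilon> * len N + (C + C * S)"
      using e(2) small[of "\<lambda>c. supertile q a n c f"] unfolding split S_def by linarith
    have l: "\<bar>len N - t * lam ^ n\<bar> \<le> C + C * S'"
      using e(3) small[of "mass n"] unfolding split S'_def sum_R_mass by linarith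
    have "?A n = \<alpha> * lam ^ n" using lam_pos by (simp add: \<alpha>_def)
    then have "Z N - \<alpha> * len N = (Z N - t * ?A n) - \<alpha> * (len N - t * lam ^ n)"
      by (simp add: algebra_simps)
    also have "\<bar>\<dots>\<bar> \<le> \<bar>Z N - t * ?A n\<bar> + \<bar>\<alpha>\<bar> * \<bar>len N - t * lam ^ n\<bar>"
      using abs_triangle_ineq4 by (simp add: abs_mult[symmetric])
    also have "\<dots> \<le> (\<epsilon> * len N + (C + C * S)) + \<bar>\<alpha>\<bar> * (C + C * S')"
      using Z l by (intro add_mono mult_left_mono) auto
    also have "\<dots> = \<epsilon> * len N + C'" by (simp add: C'_def)
    also have "C' < \<epsilon> * len N" using elim \<epsilon> by (simp add: field_simps)
    finally have "\<bar>Z N - \<alpha> * len N\<bar> < 2 * \<epsilon> * len N" by simp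
    moreover have "Z N / len N - \<alpha> = (Z N - \<alpha> * len N) / len N" using elim by (simp add: field_simps)
    ultimately have "\<bar>Z N / len N - \<alpha>\<bar> < 2 * \<epsilon>" using elim by (simp add: abs_divide divide_less_eq)
    moreover have "\<bar>\<alpha> - l\<bar> < \<epsilon>" using n by (simp add: \<alpha>_def)
    ultimately have "\<bar>Z N / len N - l\<bar> < 3 * \<epsilon>" by linarith
    then show ?case by (simp add: dist_real_def \<epsilon>_def)
  qed
qed

section \<open>Limit measures from a climbing Markov chain\<close>

text \<open>All ways in which a letter can occur in the image of another: \<open>(b, \<theta>, j)\<close> stands for the letter at
  position \<open>j\<close> of \<open>\<theta> b\<close>.\<close>

definition occurrences :: "('a \<times> 'a subst \<times> nat) set" where
  "occurrences = (SIGMA b:UNIV. SIGMA \<theta>:\<Theta>. {..<length (\<theta> b)})"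

text \<open>The probability of climbing from the letter \<open>b\<close> to an occurrence of \<open>b\<close> in the image of \<open>b'\<close>.  The
  factors \<open>R\<close> make these probabilities sum to one and telescope along a path.\<close>

definition parent_weight :: "(nat \<Rightarrow> 'a subst \<Rightarrow> real) \<Rightarrow> nat \<Rightarrow> 'a \<Rightarrow> 'a \<times> 'a subst \<times> nat \<Rightarrow> real" where
  "parent_weight q n b = (\<lambda>(b', \<theta>, j).
     if (b', \<theta>, j) \<in> occurrences \<and> \<theta> b' ! j = b then R $ b' * q n \<theta> / (lam * R $ b) else 0)"

definition parent :: "(nat \<Rightarrow> 'a subst \<Rightarrow> real) \<Rightarrow> nat \<Rightarrow> 'a \<Rightarrow> ('a \<times> 'a subst \<times> nat) pmf" where
  "parent q n b = embed_pmf (parent_weight q n b)"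

text \<open>The state is the current letter together with the displacement of the starting point within the
  supertile reached.\<close>

definition climb :: "(nat \<Rightarrow> 'a subst \<Rightarrow> real) \<Rightarrow> nat \<Rightarrow> 'a \<times> (real ^ 'a) \<Rightarrow> ('a \<times> (real ^ 'a)) pmf" where
  "climb q n s = map_pmf (\<lambda>(b', \<theta>, j). (b', snd s + word_shift n (take j (\<theta> b')))) (parent q n (fst s))"

lemma finite_occurrences: "finite occurrences"
  by (auto simp: occurrences_def finite_family)

lemma sum_occurrences:
  "(\<Sum>x\<in>occurrences. h x) = (\<Sum>b\<in>UNIV. \<Sum>\<theta>\<in>\<Theta>. \<Sum>j<length (\<theta> b). h (b, \<theta>, j))"
  by (simp add: occurrences_def sum.Sigma finite_family split_def)

lemma count_image: "\<theta> \<in> \<Theta> \<Longrightarrow> real (count_list (\<theta> b') b) = A $ b $ b'"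
  using arg_cong[OF abelianisation_image, of \<theta> "\<lambda>v. v $ b" b']
  by (simp add: abelianisation_def matrix_vector_mult_def axis_def if_distrib[of "\<lambda>x. _ * x"] cong: if_cong)

lemma sum_nth_eq_count: "(\<Sum>j<length w. if w ! j = b then c else 0) = real (count_list w b) * c"
proof (induction w)
  case (Cons x w)
  show ?case unfolding length_Cons
    by (subst sum.lessThan_Suc_shift) (simp add: Cons algebra_simps)
qed simp

lemma stochastic_const: "stochastic q \<Longrightarrow> (\<Sum>\<theta>\<in>\<Theta>. q n \<theta> * c) = c"
  by (simp add: stochastic_def sum_distrib_right[symmetric])

text \<open>This is the equation \<open>A *v R = lam *\<^sub>R R\<close> at the entry \<open>b\<close>.\<close>

lemma sum_parent_weight:
  assumes q: "stochastic q"
  shows "(\<Sum>x\<in>occurrences. parent_weight q n b x) = 1"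
proof -
  have "(\<Sum>x\<in>occurrences. parent_weight q n b x)
      = (\<Sum>b'\<in>UNIV. \<Sum>\<theta>\<in>\<Theta>. \<Sum>j<length (\<theta> b'). if \<theta> b' ! j = b then R $ b' * q n \<theta> / (lam * R $ b) else 0)"
    unfolding sum_occurrences
    by (intro sum.cong refl) (auto simp: parent_weight_def occurrences_def)
  also have "\<dots> = (\<Sum>b'\<in>UNIV. \<Sum>\<theta>\<in>\<Theta>. q n \<theta> * (A $ b $ b' * R $ b' / (lam * R $ b)))"
    unfolding sum_nth_eq_count by (intro sum.cong refl) (simp add: count_image)
  also have "\<dots> = (\<Sum>b'\<in>UNIV. A $ b $ b' * R $ b' / (lam * R $ b))"
    by (simp only: stochastic_const[OF q])
  also have "\<dots> = (A *v R) $ b / (lam * R $ b)"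
    by (simp add: matrix_vector_mult_def sum_divide_distrib)
  also have "\<dots> = 1" using lam_pos R_pos[of b] by (simp add: right_eigenvector)
  finally show ?thesis .
qed

lemma pmf_parent:
  assumes q: "stochastic q"
  shows "pmf (parent q n b) x = parent_weight q n b x"
proof -
  have nn: "0 \<le> parent_weight q n b x" for x
    using q lam_pos R_pos by (auto simp: parent_weight_def stochastic_def occurrences_def less_imp_le split: prod.splits)
  have "(\<integral>\<^sup>+x. ennreal (parent_weight q n b x) \<partial>count_space UNIV) = (\<Sum>x\<in>occurrences. ennreal (parent_weight q n b x))"
    by (rule nn_integral_count_space') (auto simp: finite_occurrences parent_weight_def)
  also have "\<dots> = 1" using sum_parent_weight[OF q] nn by (simp add: sum_ennreal)
  finally show ?thesis unfolding parent_def using nn by (intro pmf_embed_pmf) auto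
qed

lemma set_parent:
  assumes q: "stochastic q" and "(b', \<theta>, j) \<in> set_pmf (parent q n b)"
  shows "\<theta> \<in> \<Theta>"
  using assms(2) by (auto simp: set_pmf_iff pmf_parent[OF q] parent_weight_def occurrences_def split: if_splits)

lemma finite_set_parent: "stochastic q \<Longrightarrow> finite (set_pmf (parent q n b))"
  by (rule finite_subset[OF _ finite_occurrences])
     (auto simp: set_pmf_iff pmf_parent parent_weight_def split: if_splits)

lemma expectation_parent:
  assumes q: "stochastic q"
  shows "measure_pmf.expectation (parent q n b) h = (\<Sum>x\<in>occurrences. parent_weight q n b x * h x)"
proof -
  have "measure_pmf.expectation (parent q n b) h = (\<Sum>x\<in>occurrences. pmf (parent q n b) x *\<^sub>R h x)"
    by (rule integral_measure_pmf[OF finite_occurrences])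
       (auto simp: set_pmf_iff pmf_parent[OF q] parent_weight_def split: if_splits)
  then show ?thesis by (simp add: pmf_parent[OF q])
qed

lemma climb_step:
  assumes q: "stochastic q" and "t \<in> set_pmf (climb q n s)"
  shows "norm (snd t - snd s) \<le> length_bound * step_size n"
proof -
  obtain b' \<theta> j where "(b', \<theta>, j) \<in> set_pmf (parent q n (fst s))"
    and t: "t = (b', snd s + word_shift n (take j (\<theta> b')))"
    using assms(2) by (auto simp: climb_def)
  then have "\<theta> \<in> \<Theta>" using set_parent[OF q] by blast
  then show ?thesis using norm_prefix_shift_le[OF length_le_bound] by (simp add: t)
qed

lemma finite_chain_law: "stochastic q \<Longrightarrow> finite (set_pmf (chain_law (climb q) s n))"
  by (induction n) (auto simp: climb_def finite_set_parent)

lemma chain_law_norm: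
  assumes q: "stochastic q" and "s \<in> set_pmf (chain_law (climb q) (a, 0) n)"
  shows "norm (snd s) \<le> length_bound * sum step_size {..<n}"
  using assms(2)
proof (induction n arbitrary: s)
  case (Suc n)
  then obtain r where r: "r \<in> set_pmf (chain_law (climb q) (a, 0) n)" "s \<in> set_pmf (climb q n r)" by auto
  show ?case
    using Suc.IH[OF r(1)] climb_step[OF q r(2)] norm_triangle_ineq[of "snd r" "snd s - snd r"]
    by (simp add: distrib_left)
qed simp

text \<open>Climbing from \<open>a\<close> reaches each point of type \<open>a\<close> of a supertile of type \<open>b\<close> with the same
  probability up to its weight, as the product of the transition probabilities telescopes to
  \<open>R $ b / (lam ^ n * R $ a)\<close>.  The function \<open>\<phi>\<close> may depend on the letter reached; the induction needs
  this.\<close>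

lemma expectation_chain_law:
  assumes q: "stochastic q"
  shows "R $ a * measure_pmf.expectation (chain_law (climb q) (a, 0) n) \<phi>
    = (\<Sum>b\<in>UNIV. R $ b * supertile q a n b (\<lambda>y. \<phi> (b, y))) / lam ^ n"
proof (induction n arbitrary: \<phi>)
  case 0
  show ?case by (simp add: if_distrib[of "\<lambda>x. _ * x"] cong: if_cong)
next
  case (Suc n)
  let ?C = "chain_law (climb q) (a, 0) n"
  let ?y = "\<lambda>y (b', \<theta>, j). (b', y + word_shift n (take j (\<theta> b')))"
  let ?G = "\<lambda>x b. supertile q a n b (\<lambda>y. \<phi> (?y y x))"
  have step: "measure_pmf.expectation (climb q n s) \<phi> = (\<Sum>x\<in>occurrences. parent_weight q n (fst s) x * \<phi> (?y (snd s) x))" for s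
    by (simp add: climb_def expectation_parent[OF q])
  have "measure_pmf.expectation (chain_law (climb q) (a, 0) (Suc n)) \<phi>
      = (\<Sum>s\<in>set_pmf ?C. pmf ?C s *\<^sub>R measure_pmf.expectation (climb q n s) \<phi>)"
    unfolding chain_law.simps
    by (rule pmf_expectation_bind) (auto simp: finite_chain_law[OF q] climb_def finite_set_parent[OF q])
  also have "\<dots> = measure_pmf.expectation ?C (\<lambda>s. measure_pmf.expectation (climb q n s) \<phi>)"
    by (rule integral_measure_pmf[symmetric]) (auto simp: finite_chain_law[OF q])
  finally have "R $ a * measure_pmf.expectation (chain_law (climb q) (a, 0) (Suc n)) \<phi>
      = R $ a * measure_pmf.expectation ?C (\<lambda>s. measure_pmf.expectation (climb q n s) \<phi>)" by simp
  also have "\<dots> = (\<Sum>b\<in>UNIV. R $ b * (\<Sum>x\<in>occurrences. parent_weight q n b x * ?G x b)) / lam ^ n"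
    unfolding Suc step fst_conv snd_conv supertile_sum ..
  also have "(\<Sum>b\<in>UNIV. R $ b * (\<Sum>x\<in>occurrences. parent_weight q n b x * ?G x b))
      = (\<Sum>x\<in>occurrences. \<Sum>b\<in>UNIV. R $ b * (parent_weight q n b x * ?G x b))"
    unfolding sum_distrib_left by (rule sum.swap)
  also have "\<dots> = (\<Sum>(b', \<theta>, j)\<in>occurrences. R $ b' * q n \<theta> / lam * ?G (b', \<theta>, j) (\<theta> b' ! j))"
  proof (rule sum.cong[OF refl])
    fix x assume "x \<in> occurrences"
    then obtain b' \<theta> j where x_eq: "x = (b', \<theta>, j)" and x: "(b', \<theta>, j) \<in> occurrences"
      by (cases x) auto
    have "(\<Sum>b\<in>UNIV. R $ b * (parent_weight q n b (b', \<theta>, j) * ?G (b', \<theta>, j) b))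
        = (\<Sum>b\<in>UNIV. if b = \<theta> b' ! j then R $ b' * q n \<theta> / lam * ?G (b', \<theta>, j) b else 0)"
      using x R_pos by (intro sum.cong refl) (auto simp: parent_weight_def less_le)
    then show "(\<Sum>b\<in>UNIV. R $ b * (parent_weight q n b x * ?G x b))
        = (case x of (b', \<theta>, j) \<Rightarrow> R $ b' * q n \<theta> / lam * ?G (b', \<theta>, j) (\<theta> b' ! j))"
      by (simp add: x_eq)
  qed
  also have "\<dots> = (\<Sum>b'\<in>UNIV. R $ b' * supertile q a (Suc n) b' (\<lambda>y. \<phi> (b', y))) / lam"
    unfolding sum_occurrences supertile.simps displaced_sum_altdef sum_distrib_left sum_divide_distrib
    by (simp add: algebra_simps)
  finally show ?case by (simp add: mult.commute)
qed

text \<open>The measure is \<open>R $ a\<close> times the limit law of the displacement of the climbing chain that starts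
  at \<open>a\<close>.\<close>

lemma supertile_limit_measure:
  assumes q: "stochastic q"
  shows "\<exists>m. finite_measure m \<and> sets m = sets borel \<and> (\<forall>f. continuous_on UNIV f \<longrightarrow> bounded (range f) \<longrightarrow>
    (\<lambda>n. (\<Sum>b\<in>UNIV. R $ b * supertile q a n b f) / lam ^ n) \<longlonglongrightarrow> integral\<^sup>L m f)"
proof -
  let ?C = "chain_law (climb q) (a, 0)"
  have "\<exists>m :: (real ^ 'a) measure. prob_space m \<and> sets m = sets borel \<and>
    (\<forall>n (f :: real ^ 'a \<Rightarrow> real) \<delta>. f \<in> borel_measurable borel \<longrightarrow> bounded (range f) \<longrightarrow>
      (\<forall>s\<in>set_pmf (?C n). \<forall>y. dist y (snd s) \<le> (\<Sum>i. length_bound * step_size (i + n)) \<longrightarrow> \<bar>f y - f (snd s)\<bar> \<le> \<delta>) \<longrightarrow>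
      \<bar>integral\<^sup>L m f - measure_pmf.expectation (?C n) (\<lambda>s. f (snd s))\<bar> \<le> \<delta>)"
  proof (rule coupled_limit_measure)
    show "dist (snd t) (snd s) \<le> length_bound * step_size n" if "t \<in> set_pmf (climb q n s)" for n s t
      using climb_step[OF q that] by (simp add: dist_norm)
    show "summable (\<lambda>n. length_bound * step_size n)" using summable_step_size by (rule summable_mult)
    show "0 \<le> length_bound * step_size n" for n using length_bound_nonneg step_size_nonneg by simp
  qed
  then obtain m :: "(real ^ 'a) measure" where m: "prob_space m" "sets m = sets borel"
    and approx: "\<forall>n (f :: real ^ 'a \<Rightarrow> real) \<delta>. f \<in> borel_measurable borel \<longrightarrow> bounded (range f) \<longrightarrow>
      (\<forall>s\<in>set_pmf (?C n). \<forall>y. dist y (snd s) \<le> (\<Sum>i. length_bound * step_size (i + n)) \<longrightarrow> \<bar>f y - f (snd s)\<bar> \<le> \<delta>) \<longrightarrow>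
      \<bar>integral\<^sup>L m f - measure_pmf.expectation (?C n) (\<lambda>s. f (snd s))\<bar> \<le> \<delta>"
    by (elim exE conjE) (rule that)
  interpret m: prob_space m by fact
  have tail: "(\<Sum>i. length_bound * step_size (i + n)) = length_bound * tail n" for n
    unfolding tail_def using summable_step_size by (intro suminf_mult) (simp add: summable_iff_shift)
  have lim: "(\<lambda>n. (\<Sum>b\<in>UNIV. R $ b * supertile q a n b f) / lam ^ n) \<longlonglongrightarrow> R $ a * integral\<^sup>L m f"
    if f: "continuous_on UNIV f" "bounded (range f)" for f
  proof -
    have "(\<lambda>n. measure_pmf.expectation (?C n) (\<lambda>s. f (snd s))) \<longlonglongrightarrow> integral\<^sup>L m f"
    proof (rule tendstoI)
      fix \<epsilon> :: real assume "0 < \<epsilon>"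
      then have "\<forall>\<^sub>F n in sequentially. oscillates_at_most length_bound n (\<epsilon> / 2) f"
        using f length_bound_nonneg by (intro eventually_oscillates_at_most) auto
      then show "\<forall>\<^sub>F n in sequentially. dist (measure_pmf.expectation (?C n) (\<lambda>s. f (snd s))) (integral\<^sup>L m f) < \<epsilon>"
      proof eventually_elim
        case (elim n)
        have "\<bar>integral\<^sup>L m f - measure_pmf.expectation (?C n) (\<lambda>s. f (snd s))\<bar> \<le> \<epsilon> / 2"
        proof (rule approx[rule_format])
          fix s and y :: "real ^ 'a"
          assume "s \<in> set_pmf (?C n)" "dist y (snd s) \<le> (\<Sum>i. length_bound * step_size (i + n))"
          then have "norm (snd s) \<le> length_bound * sum step_size {..<n}" "norm (y - snd s) \<le> length_bound * tail n"
            using chain_law_norm[OF q] by (auto simp: tail dist_norm)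
          then have "\<bar>f (snd s + (y - snd s)) - f (snd s)\<bar> \<le> \<epsilon> / 2"
            using elim unfolding oscillates_at_most_def by blast
          then show "\<bar>f y - f (snd s)\<bar> \<le> \<epsilon> / 2" by simp
        qed (use f in \<open>auto intro: borel_measurable_continuous_onI\<close>)
        then show ?case using \<open>0 < \<epsilon>\<close> by (simp add: dist_real_def abs_minus_commute)
      qed
    qed
    then have "(\<lambda>n. R $ a * measure_pmf.expectation (?C n) (\<lambda>s. f (snd s))) \<longlonglongrightarrow> R $ a * integral\<^sup>L m f"
      by (intro tendsto_intros)
    then show ?thesis by (simp add: expectation_chain_law[OF q])
  qed
  show ?thesis
  proof (intro exI conjI allI impI)
    show "finite_measure (scale_measure (ennreal (R $ a)) m)" by (intro finite_scale_measure) unfold_locales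
    show "sets (scale_measure (ennreal (R $ a)) m) = sets borel" using m by simp
    fix f :: "real ^ 'a \<Rightarrow> real" assume f: "continuous_on UNIV f" "bounded (range f)"
    have "f \<in> borel_measurable m"
      using borel_measurable_continuous_onI[OF f(1)] measurable_cong_sets[OF m(2) refl] by blast
    then show "(\<lambda>n. (\<Sum>b\<in>UNIV. R $ b * supertile q a n b f) / lam ^ n) \<longlonglongrightarrow> integral\<^sup>L (scale_measure (ennreal (R $ a)) m) f"
      using lim[OF f] R_pos[of a] by (simp add: integral_scale_measure less_imp_le)
  qed
qed

section \<open>S-adic Rauzy measures\<close>

definition point_weights :: "(nat \<Rightarrow> 'a subst) \<Rightarrow> nat \<Rightarrow> 'a subst \<Rightarrow> real" where
  "point_weights \<theta>s n \<theta> = (if \<theta> = \<theta>s n then 1 else 0)"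

lemma point_weights_sum:
  assumes "\<theta>s n \<in> \<Theta>"
  shows "(\<Sum>\<theta>\<in>\<Theta>. point_weights \<theta>s n \<theta> * X \<theta>) = X (\<theta>s n)"
  unfolding point_weights_def using assms finite_family
  by (simp add: if_distrib[of "\<lambda>x. x * _"] cong: if_cong)

lemma stochastic_point_weights: "(\<And>n. \<theta>s n \<in> \<Theta>) \<Longrightarrow> stochastic (point_weights \<theta>s)"
  using point_weights_sum[of \<theta>s _ "\<lambda>_. 1"] by (simp add: stochastic_def point_weights_def)

lemma word_shift_subst_word: "\<theta> \<in> \<Theta> \<Longrightarrow> word_shift n (subst_word \<theta> w) = word_shift (Suc n) w"
  by (induction w) (auto simp: subst_word_Cons word_shift_image)

lemma word_mass_subst_word: "\<theta> \<in> \<Theta> \<Longrightarrow> word_mass n (subst_word \<theta> w) = word_mass (Suc n) w"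
  by (induction w) (auto simp: subst_word_Cons word_mass_image)

lemma word_shift_sadic_image:
  "(\<And>n. \<theta>s n \<in> \<Theta>) \<Longrightarrow> word_shift 0 (sadic_image \<theta>s n w) = word_shift n w"
  by (induction n arbitrary: w) (auto simp: word_shift_subst_word)

lemma length_sadic_image:
  "(\<And>n. \<theta>s n \<in> \<Theta>) \<Longrightarrow> real (length (sadic_image \<theta>s n w)) = word_mass n w"
  by (induction n arbitrary: w) (auto simp: word_mass_subst_word word_mass_0)

text \<open>With point weights there is nothing random.\<close>

lemma patch_sadic_image:
  assumes \<theta>s: "\<And>n. \<theta>s n \<in> \<Theta>"
  shows "patch (point_weights \<theta>s) a n w f = visits a (sadic_image \<theta>s n w) f"
proof (induction n arbitrary: w)
  case (Suc n)
  let ?G = "supertile (point_weights \<theta>s) a n"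
  have "supertile (point_weights \<theta>s) a (Suc n) = (\<lambda>b. displaced_sum ?G (shift n) (\<theta>s n b))"
    by (simp add: fun_eq_iff point_weights_sum[OF \<theta>s])
  moreover have "shift (Suc n) = (\<lambda>b. word_shift n (\<theta>s n b))"
    by (simp add: fun_eq_iff word_shift_image[OF \<theta>s])
  ultimately have "patch (point_weights \<theta>s) a (Suc n) w f = patch (point_weights \<theta>s) a n (subst_word (\<theta>s n) w) f"
    by (simp only: displaced_sum_subst_word)
  then show ?case using Suc by simp
qed (simp add: visits_def)

text \<open>Going down from level \<open>n + k\<close> to level \<open>n\<close>, each step splits off the images of a prefix of some
  \<open>\<theta> b\<close>, which decompose into supertiles of level \<open>n\<close>.  The vector \<open>e\<close> counts these by their type; the
  rest is a prefix of one supertile of level \<open>n\<close>, and \<open>C\<close> bounds its length.  The translation \<open>s\<close>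
  accumulates the displacements of the parts split off.\<close>

lemma sadic_prefix_decomposition:
  fixes f :: "real ^ 'a \<Rightarrow> real"
  assumes \<theta>s: "\<And>n. \<theta>s n \<in> \<Theta>" and osc: "oscillates_at_most length_bound n \<epsilon> f" and "0 \<le> \<epsilon>"
    and D: "\<And>y. \<bar>f y\<bar> \<le> D"
    and "norm s \<le> length_bound * tail (n + k)" "N \<le> length (sadic_image \<theta>s (n + k) [b])"
  defines "C \<equiv> \<Sum>c\<in>UNIV. mass n c"
  shows "\<exists>e :: real ^ 'a. norm (proj e) \<le> length_bound * sum step_size {..<k}
    \<and> \<bar>visits a (take N (sadic_image \<theta>s (n + k) [b])) (\<lambda>y. f (y + s))
        - (\<Sum>c\<in>UNIV. e $ c * supertile (point_weights \<theta>s) a n c f)\<bar> \<le> \<epsilon> * real N + D * C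
    \<and> \<bar>real N - (\<Sum>c\<in>UNIV. e $ c * mass n c)\<bar> \<le> C"
  using assms(5,6)
proof (induction k arbitrary: b s N)
  case 0
  let ?z = "take N (sadic_image \<theta>s n [b])"
  have "real N \<le> mass n b"
    using 0 \<theta>s length_sadic_image[of \<theta>s n "[b]"] by simp
  also have "\<dots> \<le> C" unfolding C_def by (rule member_le_sum) (auto simp: mass_nonneg)
  finally have N: "real N \<le> C" .
  have "0 \<le> D" using D[of 0] by linarith
  have "\<bar>visits a ?z (\<lambda>y. f (y + s))\<bar> \<le> D * real (length ?z)" using D by (intro visits_bound)
  also have "\<dots> \<le> D * C" using N \<open>0 \<le> D\<close> by (intro mult_left_mono) auto
  also have "\<dots> \<le> \<epsilon> * real N + D * C" using \<open>0 \<le> \<epsilon>\<close> by simp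
  finally show ?case
    using N by (intro exI[of _ 0]) (simp add: linear_0[OF linear_rauzy_proj])
next
  case (Suc k)
  define u where "u = \<theta>s (n + k) b"
  let ?S = "sadic_image \<theta>s (n + k)"
  have u0: "u \<noteq> []" using image_nonempty \<theta>s by (simp add: u_def)
  have Su: "sadic_image \<theta>s (n + Suc k) [b] = ?S u" by (simp add: u_def subst_word_single)
  obtain j N' where j: "j < length u" and N': "N' \<le> length (?S [u ! j])"
    and tk: "take N (?S u) = ?S (take j u) @ take N' (?S [u ! j])"
    and N: "N = length (?S (take j u)) + N'"
    using prefix_of_image[OF u0, of N \<theta>s "n + k"] Suc.prems(2) unfolding Su by blast
  let ?v = "take j u" and ?G = "\<lambda>c. supertile (point_weights \<theta>s) a n c f"
  let ?s = "word_shift (n + k) ?v"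
  have lu: "real (length u) \<le> length_bound" unfolding u_def by (rule length_le_bound[OF \<theta>s])
  have "norm ?s \<le> length_bound * step_size (n + k)" using lu by (rule norm_prefix_shift_le)
  then have "norm (?s + s) \<le> length_bound * tail (n + k)"
    using Suc.prems(1) norm_triangle_ineq[of ?s s] by (simp add: tail_Suc[of "n + k"] distrib_left)
  from Suc.IH[OF this N'] obtain e :: "real ^ 'a"
    where e: "norm (proj e) \<le> length_bound * sum step_size {..<k}"
    "\<bar>visits a (take N' (?S [u ! j])) (\<lambda>y. f (y + (?s + s))) - (\<Sum>c\<in>UNIV. e $ c * ?G c)\<bar> \<le> \<epsilon> * real N' + D * C"
    "\<bar>real N' - (\<Sum>c\<in>UNIV. e $ c * mass n c)\<bar> \<le> C" by blast
  \<comment> \<open>The numbers of supertiles of level \<open>n\<close> in the part that this step splits off.\<close>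
  define e0 where "e0 = ((*v) A ^^ k) (abelianisation ?v)"
  have "proj (e0 + e) = word_shift k ?v + proj e"
    by (simp add: e0_def linear_add[OF linear_rauzy_proj] proj_power proj_abelianisation_power)
  then have 1: "norm (proj (e0 + e)) \<le> length_bound * sum step_size {..<Suc k}"
    using e(1) norm_prefix_shift_le[OF lu, of k j] norm_triangle_ineq[of "word_shift k ?v" "proj e"]
    by (simp add: distrib_left)
  have mass0: "(\<Sum>c\<in>UNIV. e0 $ c * mass n c) = real (length (?S ?v))"
    unfolding length_sadic_image[OF \<theta>s] sum_mass word_mass_power e0_def
    by (simp add: funpow_add)
  have "\<bar>visits a (?S ?v) (\<lambda>y. f (y + s)) - (\<Sum>c\<in>UNIV. e0 $ c * ?G c)\<bar> \<le> \<epsilon> * real (length (?S ?v))"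
    unfolding patch_sadic_image[OF \<theta>s, symmetric] length_sadic_image[OF \<theta>s] e0_def
    by (rule patch_decomposition[OF stochastic_point_weights[OF \<theta>s] order_refl osc])
      (use lu Suc.prems(1) in auto)
  moreover have "visits a (take N (?S u)) (\<lambda>y. f (y + s))
      = visits a (?S ?v) (\<lambda>y. f (y + s)) + visits a (take N' (?S [u ! j])) (\<lambda>y. f (y + (?s + s)))"
    unfolding tk visits_append word_shift_sadic_image[OF \<theta>s] by (simp add: add.assoc)
  ultimately have 2: "\<bar>visits a (take N (?S u)) (\<lambda>y. f (y + s)) - (\<Sum>c\<in>UNIV. (e0 + e) $ c * ?G c)\<bar> \<le> \<epsilon> * real N + D * C"
    using e(2) by (simp add: N distrib_right distrib_left sum.distrib)
  have 3: "\<bar>real N - (\<Sum>c\<in>UNIV. (e0 + e) $ c * mass n c)\<bar> \<le> C"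
    using e(3) mass0 by (simp add: N distrib_right sum.distrib)
  show ?case using 1 2 3 unfolding Su by blast
qed

lemma integral_word_measure:
  assumes f: "f \<in> borel_measurable borel"
  shows "integral\<^sup>L (word_measure L R a w) f = visits a w f"
proof -
  let ?S = "{m. m < length w \<and> w ! m = a}"
  have fin: "finite ?S" by simp
  have "integral\<^sup>L (word_measure L R a w) f = (\<Sum>m\<in>?S. f (proj (abelianisation (take m w))))"
    unfolding word_measure_def using f fin
    by (subst integral_distr) (auto simp: lebesgue_integral_count_space_finite)
  also have "\<dots> = (\<Sum>m<length w. if w ! m = a then f (word_shift 0 (take m w)) else 0)"
    unfolding proj_abelianisation by (rule sum.mono_neutral_cong_left) auto
  also have "\<dots> = visits a w f"
    unfolding visits_def displaced_sum_altdef by (rule sum.cong) auto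
  finally show ?thesis .
qed

text \<open>Adaptedness makes the words \<open>sadic_image \<theta>s (Suc n) [b n]\<close> prefixes of each other.  As their lengths
  are unbounded, they determine one infinite word.\<close>

lemma sadic_word_prefix:
  assumes \<theta>s: "\<And>n. \<theta>s n \<in> \<Theta>" and b: "adapted \<theta>s b"
  shows "map (sadic_word \<theta>s b) [0..<length (sadic_image \<theta>s (Suc n) [b n])] = sadic_image \<theta>s (Suc n) [b n]"
    and "\<exists>n\<ge>n0. N \<le> length (sadic_image \<theta>s (Suc n) [b n])"
proof -
  define w where "w n = sadic_image \<theta>s (Suc n) [b n]" for n
  have suffix: "\<exists>r. w (Suc n) = w n @ r" for n
  proof -
    have "\<theta>s (Suc n) (b (Suc n)) = b n # tl (\<theta>s (Suc n) (b (Suc n)))"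
      using b image_nonempty[OF \<theta>s] by (metis adapted_def list.collapse)
    then have "w (Suc n) = sadic_image \<theta>s (Suc n) ([b n] @ tl (\<theta>s (Suc n) (b (Suc n))))"
      by (simp add: w_def subst_word_single)
    then show ?thesis unfolding sadic_image_append w_def by blast
  qed
  have "\<exists>r. w (n + k) = w n @ r" for n k
  proof (induction k)
    case (Suc k)
    then obtain r where "w (n + k) = w n @ r" by blast
    moreover obtain r' where "w (Suc (n + k)) = w (n + k) @ r'" using suffix by blast
    ultimately show ?case by simp
  qed simp
  then have pre: "\<exists>r. w n' = w n @ r" if "n \<le> n'" for n n'
    using that le_Suc_ex by blast
  have len: "real (length (w n)) = mass (Suc n) (b n)" for n
    unfolding w_def length_sadic_image[OF \<theta>s] by simp
  have unbounded: "\<exists>n\<ge>n0. N \<le> length (w n)" for N n0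
  proof -
    have "filterlim (\<lambda>n. mass n (b (n - 1))) at_top sequentially" by (rule mass_at_top)
    then have "\<forall>\<^sub>F n in sequentially. real N \<le> mass n (b (n - 1))"
      by (simp add: filterlim_at_top)
    then obtain n1 where "\<And>n. n1 \<le> n \<Longrightarrow> real N \<le> mass n (b (n - 1))"
      by (auto simp: eventually_sequentially)
    from this[of "Suc (max n0 n1)"] have "real N \<le> real (length (w (max n0 n1)))"
      unfolding len by simp
    then show ?thesis by (intro exI[of _ "max n0 n1"]) simp
  qed
  then show "\<exists>n\<ge>n0. N \<le> length (sadic_image \<theta>s (Suc n) [b n])" by (simp add: w_def)
  define first where "first k = (LEAST n. k < length (w n))" for k
  have first: "k < length (w (first k))" for k
  proof -
    obtain n where "Suc k \<le> length (w n)" using unbounded[of 0 "Suc k"] by (elim exE conjE)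
    then have "k < length (w n)" by simp
    then show ?thesis unfolding first_def by (rule LeastI)
  qed
  define u where "u k = w (first k) ! k" for k
  have u: "u k = w n ! k" if "k < length (w n)" for k n
  proof -
    have "first k \<le> n" unfolding first_def using that by (rule Least_le)
    then obtain r where "w n = w (first k) @ r" using pre by blast
    then show ?thesis using first[of k] by (simp add: u_def nth_append)
  qed
  let ?P = "\<lambda>u. \<forall>n. let w = sadic_image \<theta>s (Suc n) [b n] in map u [0..<length w] = w"
  have Pu: "?P u"
  proof -
    have "map u [0..<length (w n)] = w n" for n
      by (rule nth_equalityI) (auto simp: u)
    then show ?thesis unfolding w_def Let_def by blast
  qed
  have uniq: "v = u" if "?P v" for v
  proof
    fix k
    obtain n where n: "k < length (w n)" using first by blast
    have "map v [0..<length (w n)] = w n" using that unfolding w_def Let_def by blast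
    then have "map v [0..<length (w n)] ! k = w n ! k" by simp
    then show "v k = u k" using n u[OF n] by simp
  qed
  have "sadic_word \<theta>s b = u" unfolding sadic_word_def using Pu uniq by (rule the_equality)
  then show "map (sadic_word \<theta>s b) [0..<length (sadic_image \<theta>s (Suc n) [b n])] = sadic_image \<theta>s (Suc n) [b n]"
    using Pu by (simp add: Let_def)
qed

lemma sadic_weak_limit:
  assumes \<theta>s: "\<And>n. \<theta>s n \<in> \<Theta>" and b: "adapted \<theta>s b"
    and m: "finite_measure m" "sets m = sets borel"
    and lim: "\<And>f. continuous_on UNIV f \<Longrightarrow> bounded (range f) \<Longrightarrow>
      (\<lambda>n. (\<Sum>b\<in>UNIV. R $ b * supertile (point_weights \<theta>s) a n b f) / lam ^ n) \<longlonglongrightarrow> integral\<^sup>L m f"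
  shows "weakly_converges (\<lambda>n. scale_measure (ennreal (1 / real n))
    (word_measure L R a (map (sadic_word \<theta>s b) [0..<n]))) m"
  unfolding weakly_converges_def
proof (intro conjI allI impI m)
  fix f :: "real ^ 'a \<Rightarrow> real" assume f: "continuous_on UNIV f \<and> bounded (range f)"
  have fm: "f \<in> borel_measurable borel" using f by (intro borel_measurable_continuous_onI) blast
  obtain D where D: "\<And>y. \<bar>f y\<bar> \<le> D" using f by (auto simp: bounded_iff)
  define Z where "Z N = visits a (map (sadic_word \<theta>s b) [0..<N]) f" for N
  have "(\<lambda>N. Z N / real N) \<longlonglongrightarrow> integral\<^sup>L m f"
  proof (rule average_tendsto[where q = "point_weights \<theta>s" and a = a and f = f])
    show "(\<lambda>n. (\<Sum>b\<in>UNIV. R $ b * supertile (point_weights \<theta>s) a n b f) / lam ^ n) \<longlonglongrightarrow> integral\<^sup>L m f"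
      using lim f by blast
    show "filterlim real at_top sequentially" by (rule filterlim_real_sequentially)
    fix \<epsilon> :: real assume \<epsilon>: "0 < \<epsilon>"
    have "\<forall>\<^sub>F n in sequentially. oscillates_at_most length_bound n \<epsilon> f"
      using f \<epsilon> length_bound_nonneg by (intro eventually_oscillates_at_most) auto
    then show "\<forall>\<^sub>F n in sequentially. \<exists>C. \<forall>\<^sub>F N in sequentially. \<exists>e. norm (proj e) \<le> C
      \<and> \<bar>Z N - (\<Sum>c\<in>UNIV. e $ c * supertile (point_weights \<theta>s) a n c f)\<bar> \<le> \<epsilon> * real N + C
      \<and> \<bar>real N - (\<Sum>c\<in>UNIV. e $ c * mass n c)\<bar> \<le> C"
    proof eventually_elim
      case (elim n)
      let ?M = "\<Sum>c\<in>UNIV. mass n c"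
      define C where "C = max (length_bound * tail 0) (max (D * ?M) ?M)"
      have "\<exists>e. norm (proj e) \<le> C
          \<and> \<bar>Z N - (\<Sum>c\<in>UNIV. e $ c * supertile (point_weights \<theta>s) a n c f)\<bar> \<le> \<epsilon> * real N + C
          \<and> \<bar>real N - (\<Sum>c\<in>UNIV. e $ c * mass n c)\<bar> \<le> C" for N
      proof -
        obtain i where i: "n \<le> i" "N \<le> length (sadic_image \<theta>s (Suc i) [b i])"
          using sadic_word_prefix(2)[OF \<theta>s b] by blast
        define k where "k = Suc i - n"
        have nk: "n + k = Suc i" using i by (simp add: k_def)
        have "map (sadic_word \<theta>s b) [0..<N] = take N (map (sadic_word \<theta>s b) [0..<length (sadic_image \<theta>s (Suc i) [b i])])"
          using i by (simp add: take_map)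
        also have "\<dots> = take N (sadic_image \<theta>s (n + k) [b i])"
          unfolding nk sadic_word_prefix(1)[OF \<theta>s b] ..
        finally have Z: "Z N = visits a (take N (sadic_image \<theta>s (n + k) [b i])) (\<lambda>y. f (y + 0))"
          by (simp add: Z_def)
        have "0 \<le> length_bound * tail (n + k)" using length_bound_nonneg tail_nonneg by simp
        then obtain e :: "real ^ 'a" where e: "norm (proj e) \<le> length_bound * sum step_size {..<k}"
          "\<bar>Z N - (\<Sum>c\<in>UNIV. e $ c * supertile (point_weights \<theta>s) a n c f)\<bar> \<le> \<epsilon> * real N + D * ?M"
          "\<bar>real N - (\<Sum>c\<in>UNIV. e $ c * mass n c)\<bar> \<le> ?M"
          using sadic_prefix_decomposition[of \<theta>s n \<epsilon> f D 0 k N "b i" a] \<theta>s elim \<epsilon> D i(2)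
          unfolding Z nk by auto
        have "length_bound * sum step_size {..<k} \<le> length_bound * tail 0"
          using tail_0[of k] tail_nonneg[of k] length_bound_nonneg by (intro mult_left_mono) auto
        then show ?thesis using e by (intro exI[of _ e]) (auto simp: C_def max_def)
      qed
      then show ?case by (intro exI[of _ C] always_eventually) blast
    qed
  qed
  moreover have "integral\<^sup>L (scale_measure (ennreal (1 / real n)) (word_measure L R a (map (sadic_word \<theta>s b) [0..<n]))) f
      = Z n / real n" for n
  proof -
    have "f \<in> borel_measurable (word_measure L R a w)" for w using fm by (simp add: word_measure_def)
    then show ?thesis by (simp add: integral_scale_measure integral_word_measure[OF fm] Z_def)
  qed
  ultimately show "(\<lambda>n. integral\<^sup>L (scale_measure (ennreal (1 / real n))
      (word_measure L R a (map (sadic_word \<theta>s b) [0..<n]))) f) \<longlonglongrightarrow> integral\<^sup>L m f"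
    by simp
qed

text \<open>The limit measure for point weights has the property that defines the S-adic Rauzy measure.  An adapted
  letter sequence exists, so this property determines the measure.\<close>

lemma sadic_rauzy_measure_limit:
  assumes \<theta>s: "\<And>n. \<theta>s n \<in> \<Theta>" and f: "continuous_on UNIV f" "bounded (range f)"
  shows "(\<lambda>n. (\<Sum>b\<in>UNIV. R $ b * visits a (sadic_image \<theta>s n [b]) f) / lam ^ n)
    \<longlonglongrightarrow> integral\<^sup>L (sadic_rauzy_measure L R \<theta>s a) f"
proof -
  obtain m where m: "finite_measure m" "sets m = sets borel"
    and lim: "\<And>f. continuous_on UNIV f \<Longrightarrow> bounded (range f) \<Longrightarrow>
      (\<lambda>n. (\<Sum>b\<in>UNIV. R $ b * supertile (point_weights \<theta>s) a n b f) / lam ^ n) \<longlonglongrightarrow> integral\<^sup>L m f"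
    using supertile_limit_measure[of "point_weights \<theta>s" a] stochastic_point_weights[of \<theta>s] \<theta>s by blast
  note conv = sadic_weak_limit[OF \<theta>s _ m lim]
  obtain b where b: "adapted \<theta>s b" using adapted_exists by blast
  have "sadic_rauzy_measure L R \<theta>s a = m"
    unfolding sadic_rauzy_measure_def
  proof (rule the_equality)
    fix m' assume "\<forall>b. adapted \<theta>s b \<longrightarrow> weakly_converges (\<lambda>n. scale_measure (ennreal (1 / real n))
      (word_measure L R a (map (sadic_word \<theta>s b) [0..<n]))) m'"
    then show "m' = m" using weakly_converges_unique conv[OF b] b by blast
  qed (use conv in blast)
  moreover have "supertile (point_weights \<theta>s) a n b f = visits a (sadic_image \<theta>s n [b]) f" for n b
    using patch_sadic_image[OF \<theta>s, where w = "[b]"] by simp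
  ultimately show ?thesis using lim[OF f] by simp
qed

section \<open>Averages over Bernoulli sequences of substitutions\<close>

text \<open>Here one substitution is drawn for the whole word.  The left side is a sum over the letters of \<open>w\<close>, each
  of which sees the average over its own image, since the displacement of what precedes it is the same
  for all \<open>\<theta>\<close>.\<close>

lemma patch_average_outer:
  "(\<Sum>\<theta>\<in>\<Theta>. q n \<theta> * patch q a n (subst_word \<theta> w) f) = patch q a (Suc n) w f" if q: "stochastic q"
proof (induction w arbitrary: f)
  case (Cons b w)
  have "(\<Sum>\<theta>\<in>\<Theta>. q n \<theta> * patch q a n (subst_word \<theta> (b # w)) f)
      = (\<Sum>\<theta>\<in>\<Theta>. q n \<theta> * patch q a n (\<theta> b) f + q n \<theta> * patch q a n (subst_word \<theta> w) (\<lambda>y. f (y + shift (Suc n) b)))"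
    by (intro sum.cong refl) (simp add: subst_word_Cons displaced_sum_append word_shift_image distrib_left)
  then show ?case by (simp add: sum.distrib Cons)
qed simp

lemma word_mass_sadic_image:
  "(\<And>n. \<theta>s n \<in> \<Theta>) \<Longrightarrow> word_mass k (sadic_image \<theta>s n w) = word_mass (k + n) w"
proof (induction n arbitrary: k \<theta>s)
  case (Suc n)
  have "word_mass k (sadic_image \<theta>s (Suc n) w) = word_mass (Suc k) (sadic_image (\<lambda>i. \<theta>s (Suc i)) n w)"
    unfolding sadic_image_Suc_outer by (rule word_mass_subst_word) (rule Suc.prems)
  then show ?case using Suc.IH[of "\<lambda>i. \<theta>s (Suc i)" "Suc k"] Suc.prems by simp
qed simp

text \<open>Induction on \<open>n\<close>: integrate over the first coordinate, the outermost substitution, and use that the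
  shifted sequence is again Bernoulli.\<close>

lemma bernoulli_expectation:
  fixes f :: "real ^ 'a \<Rightarrow> real"
  assumes p: "\<And>\<theta>. \<theta> \<in> \<Theta> \<Longrightarrow> 0 \<le> p \<theta>" "(\<Sum>\<theta>\<in>\<Theta>. p \<theta>) = 1" and f: "\<And>y. \<bar>f y\<bar> \<le> D"
  shows "prob_space (bernoulli_measure \<Theta> p)"
    and "space (bernoulli_measure \<Theta> p) = {\<theta>s. \<forall>n. \<theta>s n \<in> \<Theta>}"
    and "(\<lambda>\<theta>s. sadic_image \<theta>s n w) \<in> bernoulli_measure \<Theta> p \<rightarrow>\<^sub>M count_space UNIV"
    and "(\<integral>\<theta>s. patch (\<lambda>_. p) a k (sadic_image \<theta>s n w) f \<partial>bernoulli_measure \<Theta> p) = patch (\<lambda>_. p) a (k + n) w f"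
proof -
  let ?M = "point_measure \<Theta> (\<lambda>\<theta>. ennreal (p \<theta>))"
  have q: "stochastic (\<lambda>_. p)" using p by (simp add: stochastic_def)
  have "emeasure ?M (space ?M) = (\<Sum>\<theta>\<in>\<Theta>. ennreal (p \<theta>))"
    by (simp add: space_point_measure emeasure_point_measure_finite finite_family)
  also have "\<dots> = 1" using p by (simp add: sum_ennreal)
  finally have "prob_space ?M" by (rule prob_spaceI)
  then interpret M: prob_space ?M .
  \<comment> \<open>Provides the isomorphism of the sequence space with its product with one more factor.\<close>
  interpret S: sequence_space ?M by unfold_locales
  have eqS: "bernoulli_measure \<Theta> p = PiM UNIV (\<lambda>_. ?M)" by (simp add: bernoulli_measure_def)
  show ps: "prob_space (bernoulli_measure \<Theta> p)" unfolding eqS by unfold_locales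
  show sp: "space (bernoulli_measure \<Theta> p) = {\<theta>s. \<forall>n. \<theta>s n \<in> \<Theta>}"
    by (auto simp: eqS space_PiM space_point_measure PiE_iff)
  have coord: "(\<lambda>\<theta>s. \<theta>s i) \<in> bernoulli_measure \<Theta> p \<rightarrow>\<^sub>M count_space \<Theta>" for i
  proof -
    have "(\<lambda>\<theta>s. \<theta>s i) \<in> bernoulli_measure \<Theta> p \<rightarrow>\<^sub>M ?M"
      unfolding eqS by (rule measurable_component_singleton) simp
    moreover have "sets ?M = sets (count_space \<Theta>)" by (simp add: sets_point_measure)
    ultimately show ?thesis using measurable_cong_sets[OF refl, of ?M "count_space \<Theta>"] by blast
  qed
  show meas: "(\<lambda>\<theta>s. sadic_image \<theta>s n w) \<in> bernoulli_measure \<Theta> p \<rightarrow>\<^sub>M count_space UNIV" for n w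
  proof (induction n arbitrary: w)
    case (Suc n)
    have "(\<lambda>\<theta>s. (\<lambda>\<theta> \<theta>s. sadic_image \<theta>s n (subst_word \<theta> w)) (\<theta>s n) \<theta>s) \<in> bernoulli_measure \<Theta> p \<rightarrow>\<^sub>M count_space UNIV"
      by (rule measurable_compose_countable'[OF Suc coord]) (simp add: finite_family countable_finite)
    then show ?case by simp
  qed simp
  show "(\<integral>\<theta>s. patch (\<lambda>_. p) a k (sadic_image \<theta>s n w) f \<partial>bernoulli_measure \<Theta> p) = patch (\<lambda>_. p) a (k + n) w f"
  proof (induction n arbitrary: k)
    case 0
    interpret prob_space "bernoulli_measure \<Theta> p" by (rule ps)
    show ?case by (simp add: prob_space)
  next
    case (Suc n)
    let ?N = "bernoulli_measure \<Theta> p"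
    let ?X = "\<lambda>\<theta>s. patch (\<lambda>_. p) a k (sadic_image \<theta>s (Suc n) w) f"
    interpret N: prob_space ?N by (rule ps)
    interpret P: pair_prob_space ?M ?N by unfold_locales
    have Xm: "?X \<in> borel_measurable ?N"
      by (rule measurable_compose[OF meas]) simp
    have cm: "(\<lambda>(t, \<theta>s). case_nat t \<theta>s) \<in> ?M \<Otimes>\<^sub>M ?N \<rightarrow>\<^sub>M ?N"
      unfolding eqS by measurable
    have bound: "norm (?X (case_nat t \<theta>s)) \<le> D * word_mass (k + Suc n) w"
      if "t \<in> \<Theta>" "\<And>n. \<theta>s n \<in> \<Theta>" for t \<theta>s
    proof -
      have "case_nat t \<theta>s n \<in> \<Theta>" for n using that by (cases n) auto
      then show ?thesis
        using patch_bound[OF q f, where w = "sadic_image (case_nat t \<theta>s) (Suc n) w"]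
        by (simp only: word_mass_sadic_image real_norm_def)
    qed
    have int: "integrable (?M \<Otimes>\<^sub>M ?N) (\<lambda>(t, \<theta>s). ?X (case_nat t \<theta>s))"
    proof (rule P.integrable_const_bound)
      show "AE x in ?M \<Otimes>\<^sub>M ?N. norm (case x of (t, \<theta>s) \<Rightarrow> ?X (case_nat t \<theta>s)) \<le> D * word_mass (k + Suc n) w"
        using bound by (intro AE_I2) (auto simp: space_pair_measure sp space_point_measure)
      show "(\<lambda>(t, \<theta>s). ?X (case_nat t \<theta>s)) \<in> borel_measurable (?M \<Otimes>\<^sub>M ?N)"
        using measurable_compose[OF cm Xm] by (simp add: case_prod_beta')
    qed
    have "(\<integral>\<theta>s. ?X \<theta>s \<partial>?N) = (\<integral>\<theta>s. ?X \<theta>s \<partial>distr (?M \<Otimes>\<^sub>M ?N) ?N (\<lambda>(t, \<theta>s). case_nat t \<theta>s))"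
      using S.PiM_iter by (simp add: eqS)
    also have "\<dots> = (\<integral>x. ?X (case x of (t, \<theta>s) \<Rightarrow> case_nat t \<theta>s) \<partial>(?M \<Otimes>\<^sub>M ?N))"
      using cm Xm by (rule integral_distr)
    also have "\<dots> = (\<integral>x. (case x of (t, \<theta>s) \<Rightarrow> ?X (case_nat t \<theta>s)) \<partial>(?M \<Otimes>\<^sub>M ?N))"
      by (simp add: case_prod_beta')
    also have "\<dots> = (\<integral>\<theta>s. (\<integral>t. ?X (case_nat t \<theta>s) \<partial>?M) \<partial>?N)"
      using P.integral_snd[OF int] by simp
    also have "\<dots> = (\<integral>\<theta>s. patch (\<lambda>_. p) a (Suc k) (sadic_image \<theta>s n w) f \<partial>?N)"
    proof (rule Bochner_Integration.integral_cong[OF refl])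
      fix \<theta>s
      have "(\<integral>t. ?X (case_nat t \<theta>s) \<partial>?M) = (\<Sum>t\<in>\<Theta>. p t *\<^sub>R ?X (case_nat t \<theta>s))"
        using finite_family p(1) by (rule lebesgue_integral_point_measure_finite)
      also have "\<dots> = (\<Sum>t\<in>\<Theta>. p t * patch (\<lambda>_. p) a k (subst_word t (sadic_image \<theta>s n w)) f)"
        unfolding sadic_image_Suc_outer by simp
      also have "\<dots> = patch (\<lambda>_. p) a (Suc k) (sadic_image \<theta>s n w) f"
        by (rule patch_average_outer[OF q])
      finally show "(\<integral>t. ?X (case_nat t \<theta>s) \<partial>?M) = patch (\<lambda>_. p) a (Suc k) (sadic_image \<theta>s n w) f" .
    qed
    also have "\<dots> = patch (\<lambda>_. p) a (Suc k + n) w f" by (rule Suc.IH)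
    finally show ?case by simp
  qed
qed

end

section \<open>Rauzy measures of random substitutions\<close>

lemma expectation_bind_finite:
  assumes "finite (set_pmf p)" "\<And>x. x \<in> set_pmf p \<Longrightarrow> finite (set_pmf (K x))"
  shows "measure_pmf.expectation (bind_pmf p K) h = measure_pmf.expectation p (\<lambda>x. measure_pmf.expectation (K x) h :: real)"
proof -
  have "measure_pmf.expectation (bind_pmf p K) h = (\<Sum>x\<in>set_pmf p. pmf p x *\<^sub>R measure_pmf.expectation (K x) h)"
    using assms by (intro pmf_expectation_bind) auto
  also have "\<dots> = measure_pmf.expectation p (\<lambda>x. measure_pmf.expectation (K x) h)"
    by (rule integral_measure_pmf[symmetric]) (use assms in auto)
  finally show ?thesis .
qed

lemma emeasure_word_measure:
  assumes "B \<in> sets borel"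
  shows "emeasure (word_measure L R a w) B
    = (\<Sum>m | m < length w \<and> w ! m = a. indicator B (rauzy_proj L R (abelianisation (take m w))))"
proof -
  let ?S = "{m. m < length w \<and> w ! m = a}"
  have "emeasure (word_measure L R a w) B = (\<integral>\<^sup>+y. indicator B y \<partial>word_measure L R a w)"
    using assms by (simp add: word_measure_def)
  also have "\<dots> = (\<integral>\<^sup>+m. indicator B (rauzy_proj L R (abelianisation (take m w))) \<partial>count_space ?S)"
    unfolding word_measure_def using assms by (subst nn_integral_distr) auto
  also have "\<dots> = (\<Sum>m\<in>?S. indicator B (rauzy_proj L R (abelianisation (take m w))))"
    by (rule nn_integral_count_space_finite) simp
  finally show ?thesis .
qed

text \<open>This shows that the set function in the definition is countably additive, and makes integrals
  against it available.\<close>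

lemma expected_word_measure_eq_distr:
  fixes a :: "'a::finite"
  assumes fin: "finite (set_pmf W)"
  defines "S \<equiv> SIGMA w:set_pmf W. {m. m < length w \<and> w ! m = a}"
  shows "expected_word_measure L R a W
    = distr (point_measure S (\<lambda>(w, m). ennreal (pmf W w))) borel (\<lambda>(w, m). rauzy_proj L R (abelianisation (take m w)))"
    (is "_ = ?N")
proof -
  have finS: "finite S" unfolding S_def using fin by auto
  have em: "emeasure ?N B = (\<integral>\<^sup>+w. emeasure (word_measure L R a w) B \<partial>measure_pmf W)" if B: "B \<in> sets borel" for B
  proof -
    let ?h = "\<lambda>(w, m). indicator B (rauzy_proj L R (abelianisation (take m w))) :: ennreal"
    have "emeasure ?N B = (\<integral>\<^sup>+y. indicator B y \<partial>?N)" using B by simp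
    also have "\<dots> = (\<integral>\<^sup>+x. ?h x \<partial>point_measure S (\<lambda>(w, m). ennreal (pmf W w)))"
      using B by (subst nn_integral_distr) (auto simp: measurable_point_measure_eq1 case_prod_beta')
    also have "\<dots> = (\<Sum>x\<in>S. (case x of (w, m) \<Rightarrow> ennreal (pmf W w)) * ?h x)"
      using finS by (rule nn_integral_point_measure_finite)
    also have "\<dots> = (\<Sum>w\<in>set_pmf W. ennreal (pmf W w) * emeasure (word_measure L R a w) B)"
      unfolding S_def emeasure_word_measure[OF B] sum_distrib_left
      by (subst sum.Sigma) (use fin in \<open>auto simp: case_prod_beta'\<close>)
    also have "\<dots> = (\<integral>\<^sup>+w. emeasure (word_measure L R a w) B \<partial>measure_pmf W)"
      using fin by (simp add: nn_integral_measure_pmf_finite mult.commute)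
    finally show ?thesis .
  qed
  have "?N = measure_of UNIV (sets borel) (emeasure ?N)"
    using measure_of_of_measure[of ?N] by simp
  also have "\<dots> = expected_word_measure L R a W"
    unfolding expected_word_measure_def
    by (rule measure_of_eq) (use em sets.sigma_sets_eq[of borel] in auto)
  finally show ?thesis by simp
qed

context substitution_family
begin

lemma integral_expected_word_measure:
  assumes fin: "finite (set_pmf W)" and f: "f \<in> borel_measurable borel"
  shows "integral\<^sup>L (expected_word_measure L R a W) f = measure_pmf.expectation W (\<lambda>w. visits a w f)"
proof -
  let ?S = "SIGMA w:set_pmf W. {m. m < length w \<and> w ! m = a}"
  have finS: "finite ?S" using fin by auto
  have "integral\<^sup>L (expected_word_measure L R a W) f
      = (\<integral>x. (case x of (w, m) \<Rightarrow> f (proj (abelianisation (take m w)))) \<partial>point_measure ?S (\<lambda>x. ennreal (case x of (w, m) \<Rightarrow> pmf W w)))"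
    unfolding expected_word_measure_eq_distr[OF fin]
    using f by (subst integral_distr) (auto simp: measurable_point_measure_eq1 case_prod_beta')
  also have "\<dots> = (\<Sum>x\<in>?S. (case x of (w, m) \<Rightarrow> pmf W w) *\<^sub>R (case x of (w, m) \<Rightarrow> f (proj (abelianisation (take m w)))))"
    using finS by (rule lebesgue_integral_point_measure_finite) auto
  also have "\<dots> = (\<Sum>w\<in>set_pmf W. \<Sum>m | m < length w \<and> w ! m = a. pmf W w * f (proj (abelianisation (take m w))))"
    by (subst sum.Sigma) (use fin in \<open>auto simp: case_prod_beta'\<close>)
  also have "\<dots> = (\<Sum>w\<in>set_pmf W. pmf W w *\<^sub>R visits a w f)"
  proof (rule sum.cong[OF refl])
    fix w
    have "(\<Sum>m | m < length w \<and> w ! m = a. f (proj (abelianisation (take m w)))) = visits a w f"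
      unfolding proj_abelianisation visits_def displaced_sum_altdef by (rule sum.mono_neutral_cong_left) auto
    then show "(\<Sum>m | m < length w \<and> w ! m = a. pmf W w * f (proj (abelianisation (take m w)))) = pmf W w *\<^sub>R visits a w f"
      by (simp add: sum_distrib_left[symmetric])
  qed
  also have "\<dots> = measure_pmf.expectation W (\<lambda>w. visits a w f)"
    by (rule integral_measure_pmf[symmetric]) (use fin in auto)
  finally show ?thesis .
qed

context
  fixes p :: "'a subst \<Rightarrow> real" and P :: "'a \<Rightarrow> 'a list pmf"
  assumes p_nonneg: "\<And>\<theta>. \<theta> \<in> \<Theta> \<Longrightarrow> 0 \<le> p \<theta>" and p_sum: "(\<Sum>\<theta>\<in>\<Theta>. p \<theta>) = 1"
    and derived: "derived_data \<Theta> p P"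
begin

lemma stochastic_p: "stochastic (\<lambda>_. p)"
  using p_nonneg p_sum by (simp add: stochastic_def)

lemma set_P: "set_pmf (P b) \<subseteq> (\<lambda>\<theta>. \<theta> b) ` \<Theta>"
proof
  fix u assume "u \<in> set_pmf (P b)"
  then have "(\<Sum>\<theta> | \<theta> \<in> \<Theta> \<and> \<theta> b = u. p \<theta>) \<noteq> 0"
    using derived by (simp add: derived_data_def set_pmf_iff)
  then have "{\<theta>. \<theta> \<in> \<Theta> \<and> \<theta> b = u} \<noteq> {}" by (metis sum.empty)
  then show "u \<in> (\<lambda>\<theta>. \<theta> b) ` \<Theta>" by auto
qed

lemma finite_set_P: "finite (set_pmf (P b))"
  using set_P finite_family finite_subset by blast

text \<open>This is what makes the data \<open>P\<close> derived from \<open>p\<close>: drawing the image of one letter is the same as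
  drawing a substitution and applying it.\<close>

lemma expectation_P: "measure_pmf.expectation (P b) h = (\<Sum>\<theta>\<in>\<Theta>. p \<theta> * h (\<theta> b) :: real)"
proof -
  have "measure_pmf.expectation (P b) h = (\<Sum>u\<in>(\<lambda>\<theta>. \<theta> b) ` \<Theta>. pmf (P b) u *\<^sub>R h u)"
    by (rule integral_measure_pmf) (use set_P finite_family in auto)
  also have "\<dots> = (\<Sum>u\<in>(\<lambda>\<theta>. \<theta> b) ` \<Theta>. \<Sum>\<theta> | \<theta> \<in> \<Theta> \<and> \<theta> b = u. p \<theta> * h (\<theta> b))"
    using derived by (intro sum.cong refl) (simp add: derived_data_def sum_distrib_right)
  also have "\<dots> = (\<Sum>\<theta>\<in>\<Theta>. p \<theta> * h (\<theta> b))"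
    by (rule sum.image_gen[symmetric, OF finite_family])
  finally show ?thesis .
qed

lemma finite_random_subst: "finite (set_pmf (random_subst P w))"
  by (induction w) (auto simp: finite_set_P)

lemma finite_random_subst_iter: "finite (set_pmf (random_subst_iter P n w))"
  by (induction n) (auto simp: finite_random_subst)

lemma word_mass_random_subst: "u \<in> set_pmf (random_subst P w) \<Longrightarrow> word_mass k u = word_mass (Suc k) w"
proof (induction w arbitrary: u)
  case (Cons b w)
  then obtain x v where x: "x \<in> set_pmf (P b)" and v: "v \<in> set_pmf (random_subst P w)" and u: "u = x @ v"
    by auto
  obtain \<theta> where "\<theta> \<in> \<Theta>" "x = \<theta> b" using x set_P by blast
  then show ?case using Cons.IH[OF v] by (simp add: u word_mass_image)
qed simp

lemma word_mass_random_subst_iter: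
  "u \<in> set_pmf (random_subst_iter P n w) \<Longrightarrow> word_mass k u = word_mass (k + n) w"
proof (induction n arbitrary: u k)
  case (Suc n)
  then obtain v where v: "v \<in> set_pmf (random_subst_iter P n w)" "u \<in> set_pmf (random_subst P v)" by auto
  then show ?case using word_mass_random_subst[OF v(2)] Suc.IH[OF v(1), of "Suc k"] by simp
qed simp

lemma inflated_length_eq: "real (inflated_length P n w) = word_mass n w"
proof -
  have len: "real (length u) = word_mass n w" if "u \<in> set_pmf (random_subst_iter P n w)" for u
    using word_mass_random_subst_iter[OF that, of 0] by (simp add: word_mass_0)
  obtain u where u: "u \<in> set_pmf (random_subst_iter P n w)"
    using set_pmf_not_empty[of "random_subst_iter P n w"] by blast
  have "inflated_length P n w = length u"
    unfolding inflated_length_def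
  proof (rule the_equality)
    show "\<forall>v\<in>set_pmf (random_subst_iter P n w). length v = length u"
      using len u by (metis of_nat_eq_iff)
  qed (use u in auto)
  then show ?thesis using len[OF u] by simp
qed

text \<open>The counterpart of \<open>patch_average_outer\<close> with independent draws for the letters.  The right side is the
  same, as only the average over the image of each single letter enters.\<close>

lemma patch_random_subst:
  "measure_pmf.expectation (random_subst P w) (\<lambda>u. patch (\<lambda>_. p) a k u f) = patch (\<lambda>_. p) a (Suc k) w f"
proof (induction w arbitrary: f)
  case (Cons b w)
  let ?E = "measure_pmf.expectation (random_subst P w)"
  let ?g = "\<lambda>y. f (y + shift (Suc k) b)"
  have lin: "?E (\<lambda>v. c + h v) = c + ?E h" for c and h :: "'a list \<Rightarrow> real"
    by (subst Bochner_Integration.integral_add)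
       (auto intro!: integrable_measure_pmf_finite simp: finite_random_subst)
  have "measure_pmf.expectation (random_subst P (b # w)) (\<lambda>u. patch (\<lambda>_. p) a k u f)
      = measure_pmf.expectation (P b) (\<lambda>u. ?E (\<lambda>v. patch (\<lambda>_. p) a k (u @ v) f))"
    by (simp add: expectation_bind_finite finite_set_P finite_random_subst)
  also have "\<dots> = (\<Sum>\<theta>\<in>\<Theta>. p \<theta> * (patch (\<lambda>_. p) a k (\<theta> b) f + ?E (\<lambda>v. patch (\<lambda>_. p) a k v ?g)))"
    unfolding expectation_P
    by (intro sum.cong refl) (simp add: displaced_sum_append word_shift_image lin)
  also have "\<dots> = supertile (\<lambda>_. p) a (Suc k) b f + ?E (\<lambda>v. patch (\<lambda>_. p) a k v ?g)"
    using stochastic_const[OF stochastic_p] by (simp add: distrib_left sum.distrib)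
  also have "?E (\<lambda>v. patch (\<lambda>_. p) a k v ?g) = patch (\<lambda>_. p) a (Suc k) w ?g" by (rule Cons)
  finally show ?case by simp
qed simp

lemma patch_random_subst_iter:
  "measure_pmf.expectation (random_subst_iter P n w) (\<lambda>u. patch (\<lambda>_. p) a k u f) = patch (\<lambda>_. p) a (k + n) w f"
proof (induction n arbitrary: k)
  case (Suc n)
  have "measure_pmf.expectation (random_subst_iter P (Suc n) w) (\<lambda>u. patch (\<lambda>_. p) a k u f)
      = measure_pmf.expectation (random_subst_iter P n w) (\<lambda>v. patch (\<lambda>_. p) a (Suc k) v f)"
    by (simp add: expectation_bind_finite finite_random_subst finite_random_subst_iter patch_random_subst del: supertile.simps)
  then show ?case using Suc[of "Suc k"] by simp
qed simp

text \<open>Applies \<open>average_tendsto\<close> with \<open>len N = word_mass N v\<close>, the common length of the realisations.  The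
  letters of \<open>v\<close> are displaced relative to each other as well, so its length is added to the constant
  that bounds displacements.\<close>

lemma random_weak_limit:
  assumes v: "v \<noteq> []" and m: "finite_measure m" "sets m = sets borel"
    and lim: "\<And>f. continuous_on UNIV f \<Longrightarrow> bounded (range f) \<Longrightarrow>
      (\<lambda>n. (\<Sum>b\<in>UNIV. R $ b * supertile (\<lambda>_. p) a n b f) / lam ^ n) \<longlonglongrightarrow> integral\<^sup>L m f"
  shows "weakly_converges (\<lambda>n. scale_measure (ennreal (1 / real (inflated_length P n v)))
    (expected_word_measure L R a (random_subst_iter P n v))) m"
  unfolding weakly_converges_def
proof (intro conjI allI impI m)
  fix f :: "real ^ 'a \<Rightarrow> real" assume f: "continuous_on UNIV f \<and> bounded (range f)"
  have fm: "f \<in> borel_measurable borel" using f by (intro borel_measurable_continuous_onI) blast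
  \<comment> \<open>The same bound has to serve for \<open>v\<close> and for the images of letters.\<close>
  let ?K = "length_bound + real (length v)"
  have K: "0 \<le> ?K" using length_bound_nonneg by simp
  have "(\<lambda>N. patch (\<lambda>_. p) a N v f / word_mass N v) \<longlonglongrightarrow> integral\<^sup>L m f"
  proof (rule average_tendsto[where q = "\<lambda>_. p" and a = a and f = f])
    show "(\<lambda>n. (\<Sum>b\<in>UNIV. R $ b * supertile (\<lambda>_. p) a n b f) / lam ^ n) \<longlonglongrightarrow> integral\<^sup>L m f"
      using lim f by blast
    have "mass n (hd v) \<le> word_mass n v" for n
    proof -
      have "0 \<le> word_mass n (tl v)" by (rule sum_list_nonneg) (auto simp: mass_nonneg)
      then show ?thesis using v by (cases v) auto
    qed
    then show "filterlim (\<lambda>n. word_mass n v) at_top sequentially"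
      by (intro filterlim_at_top_mono[OF mass_at_top[of "\<lambda>_. hd v"]] always_eventually) blast
    fix \<epsilon> :: real assume \<epsilon>: "0 < \<epsilon>"
    have "\<forall>\<^sub>F n in sequentially. oscillates_at_most ?K n \<epsilon> f"
      using f \<epsilon> K by (intro eventually_oscillates_at_most) auto
    then show "\<forall>\<^sub>F n in sequentially. \<exists>C. \<forall>\<^sub>F N in sequentially. \<exists>e. norm (proj e) \<le> C
      \<and> \<bar>patch (\<lambda>_. p) a N v f - (\<Sum>c\<in>UNIV. e $ c * supertile (\<lambda>_. p) a n c f)\<bar> \<le> \<epsilon> * word_mass N v + C
      \<and> \<bar>word_mass N v - (\<Sum>c\<in>UNIV. e $ c * mass n c)\<bar> \<le> C"
    proof eventually_elim
      case (elim n)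
      define C where "C = real (length v) * tail 0"
      have C: "0 \<le> C" by (simp add: C_def tail_nonneg)
      have "\<exists>e. norm (proj e) \<le> C
          \<and> \<bar>patch (\<lambda>_. p) a N v f - (\<Sum>c\<in>UNIV. e $ c * supertile (\<lambda>_. p) a n c f)\<bar> \<le> \<epsilon> * word_mass N v + C
          \<and> \<bar>word_mass N v - (\<Sum>c\<in>UNIV. e $ c * mass n c)\<bar> \<le> C" if nN: "n \<le> N" for N
      proof -
        obtain k where N: "N = n + k" using le_Suc_ex[OF nN] by blast
        define e where "e = ((*v) A ^^ k) (abelianisation v)"
        have "norm (proj e) = norm (word_shift k v)"
          by (simp add: e_def proj_power proj_abelianisation_power)
        also have "\<dots> \<le> real (length v) * step_size k" by (rule norm_word_shift_le)
        also have "\<dots> \<le> C"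
          unfolding C_def using step_size_le_tail[of k] tail_0[of k] sum_nonneg[of "{..<k}" step_size] step_size_nonneg
          by (intro mult_left_mono) auto
        finally have 1: "norm (proj e) \<le> C" .
        have "\<bar>patch (\<lambda>_. p) a (n + k) v (\<lambda>y. f (y + 0)) - (\<Sum>c\<in>UNIV. e $ c * supertile (\<lambda>_. p) a n c f)\<bar> \<le> \<epsilon> * word_mass (n + k) v"
          unfolding e_def
          by (rule patch_decomposition[OF stochastic_p _ elim])
            (use length_bound_nonneg tail_nonneg K in auto)
        moreover have "word_mass N v = (\<Sum>c\<in>UNIV. e $ c * mass n c)"
          unfolding sum_mass word_mass_power e_def N by (simp add: funpow_add)
        ultimately show ?thesis using 1 C by (intro exI[of _ e]) (auto simp: N)
      qed
      then show ?case by (intro exI[of _ C]) (auto simp: eventually_sequentially)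
    qed
  qed
  moreover have "integral\<^sup>L (scale_measure (ennreal (1 / real (inflated_length P n v)))
      (expected_word_measure L R a (random_subst_iter P n v))) f = patch (\<lambda>_. p) a n v f / word_mass n v" for n
  proof -
    have "f \<in> borel_measurable (expected_word_measure L R a (random_subst_iter P n v))"
      using fm by (simp add: expected_word_measure_eq_distr[OF finite_random_subst_iter])
    then have "integral\<^sup>L (scale_measure (ennreal (1 / real (inflated_length P n v)))
        (expected_word_measure L R a (random_subst_iter P n v))) f
      = 1 / real (inflated_length P n v) * measure_pmf.expectation (random_subst_iter P n v) (\<lambda>u. visits a u f)"
      by (subst integral_scale_measure)
        (simp_all add: integral_expected_word_measure[OF finite_random_subst_iter fm])
    also have "measure_pmf.expectation (random_subst_iter P n v) (\<lambda>u. visits a u f) = patch (\<lambda>_. p) a n v f"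
      using patch_random_subst_iter[of n v a 0 f] by (simp only: visits_eq_patch[of a "\<lambda>_. p"]) simp
    finally show ?thesis by (simp add: inflated_length_eq)
  qed
  ultimately show "(\<lambda>n. integral\<^sup>L (scale_measure (ennreal (1 / real (inflated_length P n v)))
      (expected_word_measure L R a (random_subst_iter P n v))) f) \<longlonglongrightarrow> integral\<^sup>L m f"
    by simp
qed

lemma rauzy_measure_limit:
  shows "finite_measure (rauzy_measure L R P a)" "sets (rauzy_measure L R P a) = sets borel"
    and "continuous_on UNIV f \<Longrightarrow> bounded (range f) \<Longrightarrow>
      (\<lambda>n. (\<Sum>b\<in>UNIV. R $ b * supertile (\<lambda>_. p) a n b f) / lam ^ n) \<longlonglongrightarrow> integral\<^sup>L (rauzy_measure L R P a) f"
proof -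
  obtain m where m: "finite_measure m" "sets m = sets borel"
    and lim: "\<And>f. continuous_on UNIV f \<Longrightarrow> bounded (range f) \<Longrightarrow>
      (\<lambda>n. (\<Sum>b\<in>UNIV. R $ b * supertile (\<lambda>_. p) a n b f) / lam ^ n) \<longlonglongrightarrow> integral\<^sup>L m f"
    using supertile_limit_measure[OF stochastic_p, of a] by blast
  note conv = random_weak_limit[OF _ m lim]
  have "rauzy_measure L R P a = m"
    unfolding rauzy_measure_def
  proof (rule the_equality)
    fix m' assume "\<forall>v. v \<noteq> [] \<longrightarrow> weakly_converges (\<lambda>n. scale_measure (ennreal (1 / real (inflated_length P n v)))
      (expected_word_measure L R a (random_subst_iter P n v))) m'"
    then show "m' = m" using weakly_converges_unique conv[of "[undefined]"] by blast
  qed (use conv in blast)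
  then show "finite_measure (rauzy_measure L R P a)" "sets (rauzy_measure L R P a) = sets borel"
    and "continuous_on UNIV f \<Longrightarrow> bounded (range f) \<Longrightarrow>
      (\<lambda>n. (\<Sum>b\<in>UNIV. R $ b * supertile (\<lambda>_. p) a n b f) / lam ^ n) \<longlonglongrightarrow> integral\<^sup>L (rauzy_measure L R P a) f"
    using m lim by simp_all
qed

section \<open>Expectations of S-adic Rauzy measures\<close>

text \<open>The integral of \<open>f\<close> against the S-adic Rauzy measure is the pointwise limit of the functions \<open>g n\<close>, each of
  which depends on the first \<open>n\<close> substitutions only and is bounded by the bound \<open>D\<close> of \<open>f\<close>.  Their
  expectations are the weighted supertile sums with constant weights \<open>p\<close>, which tend to the integral
  against the Rauzy measure of the random substitution.\<close>

lemma expectation_sadic_rauzy_measure: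
  "has_measure_expectation (bernoulli_measure \<Theta> p) (\<lambda>\<theta>s. sadic_rauzy_measure L R \<theta>s a) (rauzy_measure L R P a)"
  unfolding has_measure_expectation_def
proof (intro conjI allI impI rauzy_measure_limit)
  fix f :: "real ^ 'a \<Rightarrow> real" assume f: "continuous_on UNIV f \<and> bounded (range f)"
  obtain D where D: "\<And>y. \<bar>f y\<bar> \<le> D" using f by (auto simp: bounded_iff)
  let ?N = "bernoulli_measure \<Theta> p"
  note bern = bernoulli_expectation[where p = p and f = f and D = D, OF p_nonneg p_sum D]
  interpret N: prob_space ?N by (rule bern(1))
  define g where "g n \<theta>s = (\<Sum>b\<in>UNIV. R $ b * visits a (sadic_image \<theta>s n [b]) f) / lam ^ n" for n \<theta>s
  let ?l = "\<lambda>\<theta>s. integral\<^sup>L (sadic_rauzy_measure L R \<theta>s a) f"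
  have vm: "(\<lambda>\<theta>s. visits a (sadic_image \<theta>s n w) f) \<in> borel_measurable ?N" for n w
    using measurable_compose[OF bern(3), of "\<lambda>u. visits a u f" borel] by simp
  have gm: "g n \<in> borel_measurable ?N" for n
    unfolding g_def using vm by measurable
  have lim: "(\<lambda>n. g n \<theta>s) \<longlonglongrightarrow> ?l \<theta>s" if "\<theta>s \<in> space ?N" for \<theta>s
  proof -
    have "\<theta>s n \<in> \<Theta>" for n using that by (simp add: bern(2))
    then show ?thesis using f unfolding g_def by (intro sadic_rauzy_measure_limit) auto
  qed
  have lm: "?l \<in> borel_measurable ?N"
    using lim gm by (rule borel_measurable_LIMSEQ_real)
  have vb: "\<bar>visits a (sadic_image \<theta>s n [b]) f\<bar> \<le> D * mass n b" if "\<theta>s \<in> space ?N" for \<theta>s n b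
    using visits_bound[OF D, of a "sadic_image \<theta>s n [b]"] that length_sadic_image[of \<theta>s n "[b]"]
    by (auto simp: bern(2))
  have gb: "norm (g n \<theta>s) \<le> D" if "\<theta>s \<in> space ?N" for n \<theta>s
  proof -
    have "\<bar>\<Sum>b\<in>UNIV. R $ b * visits a (sadic_image \<theta>s n [b]) f\<bar> \<le> (\<Sum>b\<in>UNIV. R $ b * (D * mass n b))"
      using vb[OF that] R_pos
      by (intro order_trans[OF sum_abs] sum_mono) (auto simp: abs_mult less_imp_le intro!: mult_left_mono)
    also have "\<dots> = D * lam ^ n" unfolding sum_R_mass[symmetric] by (simp add: sum_distrib_left mult.left_commute)
    finally show ?thesis using lam_pos by (simp add: g_def abs_divide divide_le_eq)
  qed
  have vi: "integrable ?N (\<lambda>\<theta>s. visits a (sadic_image \<theta>s n [b]) f)" for n b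
    using vb vm by (intro N.integrable_const_bound[where B = "D * mass n b"] AE_I2) auto
  have "(\<integral>\<theta>s. g n \<theta>s \<partial>?N) = (\<Sum>b\<in>UNIV. R $ b * supertile (\<lambda>_. p) a n b f) / lam ^ n" for n
  proof -
    have "(\<integral>\<theta>s. visits a (sadic_image \<theta>s n [b]) f \<partial>?N) = supertile (\<lambda>_. p) a n b f" for b
      using bern(4)[of a 0 n "[b]"] by (simp only: visits_eq_patch[of a "\<lambda>_. p"]) simp
    then show ?thesis unfolding g_def using vi by (simp add: Bochner_Integration.integral_sum)
  qed
  then have "(\<lambda>n. \<integral>\<theta>s. g n \<theta>s \<partial>?N) \<longlonglongrightarrow> integral\<^sup>L (rauzy_measure L R P a) f"
    using rauzy_measure_limit(3) f by simp
  moreover have "(\<lambda>n. \<integral>\<theta>s. g n \<theta>s \<partial>?N) \<longlonglongrightarrow> (\<integral>\<theta>s. ?l \<theta>s \<partial>?N)"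
    by (rule integral_dominated_convergence[where w = "\<lambda>_. D"])
      (use lm gm lim gb in \<open>auto intro!: AE_I2\<close>)
  ultimately show "(\<integral>\<theta>s. ?l \<theta>s \<partial>?N) = integral\<^sup>L (rauzy_measure L R P a) f"
    using LIMSEQ_unique by blast
  show "integrable ?N ?l"
    by (rule integrable_dominated_convergence[where w = "\<lambda>_. D" and s = g])
      (use lm gm lim gb in \<open>auto intro!: AE_I2\<close>)
qed

end

end

lemma substitution_family_of_pisot:
  fixes \<Theta> :: "('a::finite) subst set"
  assumes comp: "compatible \<Theta> M" and prim: "primitive_matrix M" and pisot: "irreducible_pisot M lam"
    and pf: "perron_frobenius_vectors M lam L R" and fin: "finite \<Theta>"
  shows "substitution_family \<Theta> (of_int_matrix M) lam L R"
proof
  show "abelianisation (\<theta> b) = of_int_matrix M *v axis b 1" if "\<theta> \<in> \<Theta>" for \<theta> b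
  proof -
    have "M $ i $ b = int (count_list (\<theta> b) i)" for i
      using comp that by (auto simp: compatible_def subst_matrix_def)
    then show ?thesis
      by (simp add: vec_eq_iff abelianisation_def matrix_vector_mult_def of_int_matrix_def axis_def
          if_distrib[of "\<lambda>x. _ * x"] cong: if_cong)
  qed
  have "\<bar>R $ i\<bar> = R $ i" for i using pf by (simp add: perron_frobenius_vectors_def less_imp_le)
  then show "(\<Sum>b\<in>UNIV. R $ b) = 1" using pf by (simp add: perron_frobenius_vectors_def)
  show "1 < lam" using pisot by (auto simp: irreducible_pisot_def pisot_number_def)
  show "summable (\<lambda>k. norm (((*v) (of_int_matrix M) ^^ k) x))" if "L \<bullet> x = 0" for x
    using hyperplane_orbit_summable[OF prim pisot pf that] .
qed (use comp pf fin in \<open>auto simp: compatible_def perron_frobenius_vectors_def\<close>)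

theorem theorem6p12:
  fixes \<Theta> :: "('a::finite) subst set"
    and M :: "int ^ 'a ^ 'a"
    and lam :: real
    and L R :: "real ^ 'a"
    and p :: "'a subst \<Rightarrow> real"
    and P :: "'a \<Rightarrow> 'a list pmf"
  assumes "compatible \<Theta> M"
    and "primitive_matrix M"
    and "irreducible_pisot M lam"
    and "perron_frobenius_vectors M lam L R"
    and "\<forall>\<theta>\<in>\<Theta>. 0 \<le> p \<theta>" and "(\<Sum>\<theta>\<in>\<Theta>. p \<theta>) = 1"
    and "derived_data \<Theta> p P"
    and "non_degenerate (enveloping \<Theta>) P"
  shows "\<forall>a. has_measure_expectation (bernoulli_measure \<Theta> p)
               (\<lambda>\<theta>. sadic_rauzy_measure L R \<theta> a) (rauzy_measure L R P a)"
proof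
  fix a
  \<comment> \<open>The sum over an infinite set would be zero.\<close>
  have "finite \<Theta>" using assms(6) by (metis sum.infinite zero_neq_one)
  then interpret substitution_family \<Theta> "of_int_matrix M" lam L R
    by (rule substitution_family_of_pisot[OF assms(1-4)])
  show "has_measure_expectation (bernoulli_measure \<Theta> p)
      (\<lambda>\<theta>. sadic_rauzy_measure L R \<theta> a) (rauzy_measure L R P a)"
    using assms(5-7) by (intro expectation_sadic_rauzy_measure) auto
qed

end
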